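(* Let $p$ be an odd prime, $S$ a finite $p$-group, $i\geq 1$ an integer, and suppose that $\Omega_i(S)$ has exponent $\leq p^i$ (for example, suppose $S$ has nilpotency class $<p$). Write $D=\Omega_i(S)$. Then all of $Z(J_o(D))$, $\Omega_1(Z(J_e(D)))$, $Z(J_{\mathrm{lex}}(D))$, $Z(J_{\mathrm{olex}}(D))$ and $I_{O,E,\zeta}(D)$ (for any integers $O,E$ and any sequence of integers $\zeta=(\zeta_1,\zeta_2,\dots)$) have the Glauberman property for $S$.
   Context: All groups are finite. $\Omega_i(P)$ is the subgroup of a $p$-group $P$ generated by all elements of order $\leq p^i$. For a $p$-group $D$, $\mathfrak{Ab}(D)$ is the set of abelian subgroups of $D$. The rank of an abelian group is the size of its smallest generating set; the rank of a nonabelian $p$-group is the maximum of the ranks of its abelian subgroups. For an abelian $p$-group $A$, $\omega_j(A):=|\Omega_j(A)|$. For sequences of integers, $\geq_{\mathrm{lex}}$ is the usual lexicographic order; when an abelian $p$-group $A$ appears on one side of $\geq_{\mathrm{lex}}$, it stands for the sequence $(\omega_1(A),\omega_2(A),\dots)$. Define: $\mathcal{A}_o(D)=\{A\in\mathfrak{Ab}(D): |A|\geq|A'|\text{ for all }A'\in\mathfrak{Ab}(D)\}$; $\mathcal{A}_e(D)=\{A\in\mathfrak{Ab}(D): \mathrm{rank}(A)=\mathrm{rank}(D)\text{ and }A\text{ is elementary abelian}\}$; $\mathcal{A}_{\mathrm{lex}}(D)=\{A\in\mathfrak{Ab}(D): A\geq_{\mathrm{lex}}A'\text{ for all }A'\in\mathfrak{Ab}(D)\}$;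 $\mathcal{A}_{\mathrm{olex}}(D)=\{A\in\mathcal{A}_o(D): A\geq_{\mathrm{lex}}A'\text{ for all }A'\in\mathcal{A}_o(D)\}$; $\mathcal{A}_{O,E,\zeta}(D)=\{A\in\mathfrak{Ab}(D): |A|=p^O,\ \mathrm{exponent}(A)\leq p^E,\ A\geq_{\mathrm{lex}}\zeta\}$. For each subscript, $J_{\cdots}(D)$ denotes the subgroup generated by all members of $\mathcal{A}_{\cdots}(D)$, and $I_{\cdots}(D)$ the intersection of all members of $\mathcal{A}_{\cdots}(D)$ (taken to be $1$ if $\mathcal{A}_{\cdots}(D)=\emptyset$). $Z(\cdot)$ denotes the center. A subgroup of $S$ has the Glauberman property for $S$ if it is characteristic in every finite group $G$ satisfying: (a) $S$ is a Sylow $p$-subgroup of $G$; (b) $C_G(O_p(G))\leq O_p(G)$; (c) $G$ acts (by conjugation) $p$-stably on every normal $p$-subgroup of $G$. $O_p(G)$ is the largest normal $p$-subgroup of $G$. If $G$ acts on a $p$-group $P$, then $O_p(G\curvearrowright P)\trianglelefteq G$ denotes the preimage of $O_p(G/C_G(P))$ under the natural map $G\to G/C_G(P)$. An element $x\in G$ acts quadratically on $P$ if $[P,x,x]=1$, where $[P,x,x]=[[P,x],x]$ and commutators are $[w,x]=w^{-1}x^{-1}wx$ (in $P\rtimes G$). The action of $G$ on $P$ is $p$-stable if every element of $G$ that acts quadratically on $P$ lies in $O_p(G\curvearrowright P)$. *)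

theory Defs
  imports "HOL-Algebra.Algebra" "HOL-Library.Extended_Nat" Complex_Main
begin

abbreviation subgrp :: "('a, 'm) monoid_scheme \<Rightarrow> 'a set \<Rightarrow> ('a, 'm) monoid_scheme"
    (infixl \<open>\<restriction>\<^sub>g\<close> 90)
  where "G \<restriction>\<^sub>g H \<equiv> G\<lparr>carrier := H\<rparr>"

section \<open>General group-theoretic notions\<close>

text \<open>The order of an infinite group is \<open>0\<close>, which is never a power of a prime, so a
  \<open>p\<close>-group is finite. The trivial group is a \<open>p\<close>-group.\<close>

definition p_group :: "nat \<Rightarrow> ('a, 'm) monoid_scheme \<Rightarrow> bool" where
  "p_group p G \<longleftrightarrow> group G \<and> (\<exists>n. order G = p ^ n)"

definition sylow_subgroup :: "nat \<Rightarrow> ('a, 'm) monoid_scheme \<Rightarrow> 'a set \<Rightarrow> bool" where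
  "sylow_subgroup p G P \<longleftrightarrow> subgroup P G \<and> card P = p ^ multiplicity p (order G)"

definition center :: "('a, 'm) monoid_scheme \<Rightarrow> 'a set" where
  "center G = {z \<in> carrier G. \<forall>g \<in> carrier G. g \<otimes>\<^bsub>G\<^esub> z = z \<otimes>\<^bsub>G\<^esub> g}"

definition centralizer :: "('a, 'm) monoid_scheme \<Rightarrow> 'a set \<Rightarrow> 'a set" where
  "centralizer G H = {g \<in> carrier G. \<forall>h \<in> H. g \<otimes>\<^bsub>G\<^esub> h = h \<otimes>\<^bsub>G\<^esub> g}"

definition characteristic :: "'a set \<Rightarrow> ('a, 'm) monoid_scheme \<Rightarrow> bool" where
  "characteristic H G \<longleftrightarrow> subgroup H G \<and> (\<forall>\<alpha> \<in> iso G G. \<alpha> ` H = H)"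

definition group_exponent :: "('a, 'm) monoid_scheme \<Rightarrow> nat" where
  "group_exponent G = (LEAST n. n > 0 \<and> (\<forall>x \<in> carrier G. x [^]\<^bsub>G\<^esub> n = \<one>\<^bsub>G\<^esub>))"

text \<open>The term with index \<open>n\<close> is $\gamma_{n+1}(G)$.\<close>

primrec lower_central :: "('a, 'm) monoid_scheme \<Rightarrow> nat \<Rightarrow> 'a set" where
  "lower_central G 0 = carrier G"
| "lower_central G (Suc n) = generate G
     {inv\<^bsub>G\<^esub> x \<otimes>\<^bsub>G\<^esub> inv\<^bsub>G\<^esub> y \<otimes>\<^bsub>G\<^esub> x \<otimes>\<^bsub>G\<^esub> y | x y. x \<in> lower_central G n \<and> y \<in> carrier G}"

text \<open>The value is \<open>\<infinity>\<close> if \<open>G\<close> is not nilpotent.\<close>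

definition nilpotency_class :: "('a, 'm) monoid_scheme \<Rightarrow> enat" where
  "nilpotency_class G = (INF n \<in> {n. lower_central G n = {\<one>\<^bsub>G\<^esub>}}. enat n)"

section \<open>Abelian subgroups of a \<open>p\<close>-group\<close>

definition Omega :: "nat \<Rightarrow> nat \<Rightarrow> ('a, 'm) monoid_scheme \<Rightarrow> 'a set" where
  "Omega p i P = generate P {x \<in> carrier P. group.ord P x \<le> p ^ i}"

definition omega :: "nat \<Rightarrow> ('a, 'm) monoid_scheme \<Rightarrow> nat \<Rightarrow> int" where
  "omega p A j = int (card (Omega p j A))"

definition abelian_subgroups :: "('a, 'm) monoid_scheme \<Rightarrow> 'a set set" where
  "abelian_subgroups D = {A. subgroup A D \<and> comm_group (D \<restriction>\<^sub>g A)}"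

definition min_generators :: "('a, 'm) monoid_scheme \<Rightarrow> nat" where
  "min_generators A =
     (LEAST n. \<exists>U. U \<subseteq> carrier A \<and> finite U \<and> card U = n \<and> generate A U = carrier A)"

definition rank :: "('a, 'm) monoid_scheme \<Rightarrow> nat" where
  "rank D = (if comm_group D then min_generators D
             else Max {min_generators (D \<restriction>\<^sub>g A) | A. A \<in> abelian_subgroups D})"

definition elementary_abelian :: "nat \<Rightarrow> ('a, 'm) monoid_scheme \<Rightarrow> bool" where
  "elementary_abelian p A \<longleftrightarrow> comm_group A \<and> (\<forall>x \<in> carrier A. x [^]\<^bsub>A\<^esub> p = \<one>\<^bsub>A\<^esub>)"

text \<open>Sequences are indexed from \<open>1\<close>; their value at \<open>0\<close> is irrelevant.\<close>

definition lex_ge :: "(nat \<Rightarrow> int) \<Rightarrow> (nat \<Rightarrow> int) \<Rightarrow> bool" where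
  "lex_ge a b \<longleftrightarrow> (\<forall>j \<ge> 1. a j = b j) \<or>
     (\<exists>k \<ge> 1. a k > b k \<and> (\<forall>j. 1 \<le> j \<and> j < k \<longrightarrow> a j = b j))"

definition A_o :: "('a, 'm) monoid_scheme \<Rightarrow> 'a set set" where
  "A_o D = {A \<in> abelian_subgroups D. \<forall>A' \<in> abelian_subgroups D. card A \<ge> card A'}"

definition A_e :: "nat \<Rightarrow> ('a, 'm) monoid_scheme \<Rightarrow> 'a set set" where
  "A_e p D = {A \<in> abelian_subgroups D.
     rank (D \<restriction>\<^sub>g A) = rank D \<and> elementary_abelian p (D \<restriction>\<^sub>g A)}"

definition A_lex :: "nat \<Rightarrow> ('a, 'm) monoid_scheme \<Rightarrow> 'a set set" where
  "A_lex p D = {A \<in> abelian_subgroups D. \<forall>A' \<in> abelian_subgroups D.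
     lex_ge (omega p (D \<restriction>\<^sub>g A)) (omega p (D \<restriction>\<^sub>g A'))}"

definition A_olex :: "nat \<Rightarrow> ('a, 'm) monoid_scheme \<Rightarrow> 'a set set" where
  "A_olex p D = {A \<in> A_o D. \<forall>A' \<in> A_o D.
     lex_ge (omega p (D \<restriction>\<^sub>g A)) (omega p (D \<restriction>\<^sub>g A'))}"

text \<open>The exponents \<open>m\<close> and \<open>e\<close> are arbitrary integers, so powers of \<open>p\<close> are taken in the
  rationals.\<close>

definition A_bounded ::
    "nat \<Rightarrow> int \<Rightarrow> int \<Rightarrow> (nat \<Rightarrow> int) \<Rightarrow> ('a, 'm) monoid_scheme \<Rightarrow> 'a set set" where
  "A_bounded p m e \<zeta> D = {A \<in> abelian_subgroups D.
     (of_nat (card A) :: rat) = of_nat p powi m \<and>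
     (of_nat (group_exponent (D \<restriction>\<^sub>g A)) :: rat) \<le> of_nat p powi e \<and>
     lex_ge (omega p (D \<restriction>\<^sub>g A)) \<zeta>}"

definition J_gen :: "('a, 'm) monoid_scheme \<Rightarrow> 'a set set \<Rightarrow> 'a set" where
  "J_gen D \<A> = generate D (\<Union>\<A>)"

definition I_int :: "('a, 'm) monoid_scheme \<Rightarrow> 'a set set \<Rightarrow> 'a set" where
  "I_int D \<A> = (if \<A> = {} then {\<one>\<^bsub>D\<^esub>} else \<Inter>\<A>)"

section \<open>\<open>p\<close>-stable actions\<close>

definition O_p :: "nat \<Rightarrow> ('a, 'm) monoid_scheme \<Rightarrow> 'a set" where
  "O_p p G = (GREATEST N. N \<lhd> G \<and> p_group p (G \<restriction>\<^sub>g N))"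

text \<open>An action of \<open>G\<close> on a group \<open>P\<close> is given, as in \<^locale>\<open>group_action\<close>, by a left action
  \<open>\<phi>\<close>: in $P \rtimes G$ one has $g w g^{-1} = \phi(g)(w)$. Consequently
  $[w,x] = w^{-1} x^{-1} w x = w^{-1} \phi(x^{-1})(w)$.\<close>

definition act_commutator ::
    "('g, 'n) monoid_scheme \<Rightarrow> ('a, 'm) monoid_scheme \<Rightarrow> ('g \<Rightarrow> 'a \<Rightarrow> 'a) \<Rightarrow>
     'a set \<Rightarrow> 'g \<Rightarrow> 'a set" where
  "act_commutator G P \<phi> U x = generate P {inv\<^bsub>P\<^esub> w \<otimes>\<^bsub>P\<^esub> \<phi> (inv\<^bsub>G\<^esub> x) w | w. w \<in> U}"

definition acts_quadratically ::
    "('g, 'n) monoid_scheme \<Rightarrow> ('a, 'm) monoid_scheme \<Rightarrow> ('g \<Rightarrow> 'a \<Rightarrow> 'a) \<Rightarrow> 'g \<Rightarrow> bool" where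
  "acts_quadratically G P \<phi> x \<longleftrightarrow>
     act_commutator G P \<phi> (act_commutator G P \<phi> (carrier P) x) x = {\<one>\<^bsub>P\<^esub>}"

definition act_kernel ::
    "('g, 'n) monoid_scheme \<Rightarrow> ('a, 'm) monoid_scheme \<Rightarrow> ('g \<Rightarrow> 'a \<Rightarrow> 'a) \<Rightarrow> 'g set" where
  "act_kernel G P \<phi> = {g \<in> carrier G. \<forall>w \<in> carrier P. \<phi> g w = w}"

definition O_p_act ::
    "nat \<Rightarrow> ('g, 'n) monoid_scheme \<Rightarrow> ('a, 'm) monoid_scheme \<Rightarrow> ('g \<Rightarrow> 'a \<Rightarrow> 'a) \<Rightarrow> 'g set" where
  "O_p_act p G P \<phi> = {g \<in> carrier G.
     act_kernel G P \<phi> #>\<^bsub>G\<^esub> g \<in> O_p p (G Mod act_kernel G P \<phi>)}"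

definition p_stable ::
    "nat \<Rightarrow> ('g, 'n) monoid_scheme \<Rightarrow> ('a, 'm) monoid_scheme \<Rightarrow> ('g \<Rightarrow> 'a \<Rightarrow> 'a) \<Rightarrow> bool" where
  "p_stable p G P \<phi> \<longleftrightarrow>
     (\<forall>x \<in> carrier G. acts_quadratically G P \<phi> x \<longrightarrow> x \<in> O_p_act p G P \<phi>)"

definition conj_act :: "('a, 'm) monoid_scheme \<Rightarrow> 'a set \<Rightarrow> 'a \<Rightarrow> 'a \<Rightarrow> 'a" where
  "conj_act G P = (\<lambda>g. \<lambda>w \<in> P. g \<otimes>\<^bsub>G\<^esub> w \<otimes>\<^bsub>G\<^esub> inv\<^bsub>G\<^esub> g)"

section \<open>The Glauberman property\<close>

text \<open>The inclusion of \<open>S\<close> as a Sylow \<open>p\<close>-subgroup of \<open>G\<close> is represented by an injective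
  homomorphism \<open>f\<close>, so that \<open>G\<close> need not live on the same type as \<open>S\<close>. A HOL definition cannot
  quantify over types, so the element type \<open>'g\<close> of the groups \<open>G\<close> is a parameter; for any
  infinite \<open>'g\<close> all finite groups occur up to isomorphism.\<close>

definition glauberman_property ::
    "'g itself \<Rightarrow> nat \<Rightarrow> ('a, 'm) monoid_scheme \<Rightarrow> 'a set \<Rightarrow> bool" where
  "glauberman_property (_ :: 'g itself) p S W \<longleftrightarrow> subgroup W S \<and>
     (\<forall>(G :: 'g monoid) f.
        group G \<and> finite (carrier G) \<and> f \<in> mon S G \<and>
        sylow_subgroup p G (f ` carrier S) \<and>
        centralizer G (O_p p G) \<subseteq> O_p p G \<and>
        (\<forall>P. P \<lhd> G \<and> p_group p (G \<restriction>\<^sub>g P) \<longrightarrow> p_stable p G (G \<restriction>\<^sub>g P) (conj_act G P))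
        \<longrightarrow> characteristic (f ` W) G)"

end

theory Submission
  imports Defs
begin

text \<open>All five subgroups are intersections of families of abelian subgroups of \<open>S\<close>, cut out by an
  order, an exponent bound and a lexicographic lower bound on the numbers \<open>\<omega>\<^sub>j\<close>: the members of
  the first four families are self-centralizing (up to elements of order \<open>p\<close> for \<open>A_e\<close>), so the
  center of the subgroup they generate is their intersection. Let \<open>I\<close> be such an intersection.
  By induction on \<open>card B\<close>, \<open>I \<inter> B\<close> is normal in \<open>G\<close> for every normal \<open>p\<close>-subgroup \<open>B\<close>. One may
  assume that \<open>B\<close> is the normal closure of \<open>I \<inter> B\<close>; then the commutator subgroup of \<open>B\<close> is
  contained in \<open>I\<close> and central in \<open>B\<close>. With \<open>K\<close> the preimage of \<open>O_p (G / C_G B)\<close>, a Frattini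
  argument gives $G = C_G(B) N_G(S \cap K)$, which settles the case that all members lie in \<open>K\<close>.
  Otherwise take a member \<open>A\<close> outside \<open>K\<close> with \<open>card (A \<inter> B)\<close> maximal; \<open>A\<close> does not act
  quadratically by \<open>p\<close>-stability, and a replacement theorem yields a member \<open>A'\<close> with larger
  intersection with \<open>B\<close>, hence inside \<open>K\<close>, not containing \<open>B\<close>. But \<open>B\<close>, as the normal closure of
  \<open>I \<inter> B\<close>, lies in every member inside \<open>K\<close>, a contradiction.\<close>


section \<open>Finite groups and finite \<open>p\<close>-groups\<close>

text \<open>Only \<open>S\<close> is visible from \<open>G\<close>, whereas the five subgroups are
  built inside D = Omega_i(S). The exponent hypothesis reconciles the two: members over D have
  exponent dividing p^k with k \<le> i, and every subgroup of \<open>S\<close> with such an exponent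
  lies in D, so the families over D are families over \<open>S\<close>. A family prescribes the
  order and otherwise imposes one-sided conditions: a replacement that keeps the order and the
  exponent bound and lowers no \<omega>_j stays inside it. The obstacle is that B need be neither
  abelian nor contained in the normalizer of A, so the new subgroup is in general not isomorphic to
  A, and its torsion has to be counted level by level. Oddness of p makes certain commutators
  trivial and n choose 2 divisible by n. The induction over B ends at B = O_p(G). The intersection I
  lies there because it is abelian and normal in \<open>S\<close>: its elements act quadratically on
  O_p(G), and p-stability together with C_G(O_p(G)) \<le> O_p(G) applies. Normal subgroups obtained
  in this way are characteristic since automorphisms carry \<open>S\<close> to a conjugate.\<close>

lemma card_eq_fibers:
  assumes "finite A" "\<And>x. x \<in> A \<Longrightarrow> card {y \<in> A. f y = f x} = k"
  shows "card A = k * card (f ` A)"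
proof -
  have "card A = (\<Sum>z\<in>f ` A. card {y \<in> A. f y = z})"
    using sum.image_gen[OF assms(1), of "\<lambda>_. 1::nat" f] by simp
  also have "\<dots> = (\<Sum>z\<in>f ` A. k)"
    by (rule sum.cong) (use assms(2) in auto)
  finally show ?thesis by (simp add: mult.commute)
qed

section \<open>Commutator and conjugation identities; orders, actions and Sylow conjugacy\<close>

context group
begin

definition comm :: "'a \<Rightarrow> 'a \<Rightarrow> 'a" where
  "comm x y = inv x \<otimes> inv y \<otimes> x \<otimes> y"

text \<open>This is left conjugation, as in \<open>conj_act\<close>, while \<open>comm\<close> is
  written in the right-handed convention; hence the inverses in \<open>conj_inv_eq_comm\<close> and
  \<open>comm_mult_left\<close>.\<close>

definition conjug :: "'a \<Rightarrow> 'a \<Rightarrow> 'a" where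
  "conjug g x = g \<otimes> x \<otimes> inv g"

lemma comm_closed [simp]: "x \<in> carrier G \<Longrightarrow> y \<in> carrier G \<Longrightarrow> comm x y \<in> carrier G"
  by (simp add: comm_def)

lemma conj_closed [simp]: "x \<in> carrier G \<Longrightarrow> y \<in> carrier G \<Longrightarrow> conjug x y \<in> carrier G"
  by (simp add: conjug_def)

lemma mult_inv_cancel [simp]:
  "x \<in> carrier G \<Longrightarrow> y \<in> carrier G \<Longrightarrow> x \<otimes> (inv x \<otimes> y) = y"
  "x \<in> carrier G \<Longrightarrow> y \<in> carrier G \<Longrightarrow> inv x \<otimes> (x \<otimes> y) = y"
  by (simp_all flip: m_assoc)

lemma eq_invI: "x \<otimes> y = \<one> \<Longrightarrow> x \<in> carrier G \<Longrightarrow> y \<in> carrier G \<Longrightarrow> y = inv x"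
  using inv_equality[of y x] inv_comm[of x y] by simp

lemmas word_simps = comm_def conjug_def inv_mult_group m_assoc

lemma conj_mult: "g \<in> carrier G \<Longrightarrow> x \<in> carrier G \<Longrightarrow> y \<in> carrier G
    \<Longrightarrow> conjug g (x \<otimes> y) = conjug g x \<otimes> conjug g y"
  by (simp add: word_simps)

lemma conj_conj: "g \<in> carrier G \<Longrightarrow> h \<in> carrier G \<Longrightarrow> x \<in> carrier G
    \<Longrightarrow> conjug g (conjug h x) = conjug (g \<otimes> h) x"
  by (simp add: word_simps)

lemma conj_one [simp]: "g \<in> carrier G \<Longrightarrow> conjug g \<one> = \<one>" "x \<in> carrier G \<Longrightarrow> conjug \<one> x = x"
  by (simp_all add: word_simps)

lemma conj_inv: "g \<in> carrier G \<Longrightarrow> x \<in> carrier G \<Longrightarrow> conjug g (inv x) = inv (conjug g x)"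
  by (simp add: word_simps)

lemma conj_inv_conj [simp]: "g \<in> carrier G \<Longrightarrow> x \<in> carrier G \<Longrightarrow> conjug g (conjug (inv g) x) = x"
  "g \<in> carrier G \<Longrightarrow> x \<in> carrier G \<Longrightarrow> conjug (inv g) (conjug g x) = x"
  by (simp_all add: conj_conj)

lemma conj_comm: "g \<in> carrier G \<Longrightarrow> x \<in> carrier G \<Longrightarrow> y \<in> carrier G
    \<Longrightarrow> conjug g (comm x y) = comm (conjug g x) (conjug g y)"
  by (simp add: word_simps)

lemma comm_eq_one_iff: "x \<in> carrier G \<Longrightarrow> y \<in> carrier G \<Longrightarrow> comm x y = \<one> \<longleftrightarrow> x \<otimes> y = y \<otimes> x"
proof -
  assume xy: "x \<in> carrier G" "y \<in> carrier G"
  have "x \<otimes> y = y \<otimes> x \<otimes> comm x y" using xy by (simp add: word_simps)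
  then show ?thesis using xy by simp
qed

lemma conj_eq_iff: "g \<in> carrier G \<Longrightarrow> x \<in> carrier G \<Longrightarrow> conjug g x = x \<longleftrightarrow> g \<otimes> x = x \<otimes> g"
  unfolding conjug_def by (metis inv_solve_right m_closed)

lemma comm_mult_left: "x \<in> carrier G \<Longrightarrow> y \<in> carrier G \<Longrightarrow> z \<in> carrier G
    \<Longrightarrow> comm (x \<otimes> y) z = conjug (inv y) (comm x z) \<otimes> comm y z"
  by (simp add: word_simps)

lemma comm_mult_right: "x \<in> carrier G \<Longrightarrow> y \<in> carrier G \<Longrightarrow> z \<in> carrier G
    \<Longrightarrow> comm x (y \<otimes> z) = comm x z \<otimes> conjug (inv z) (comm x y)"
  by (simp add: word_simps)

lemma comm_inv_left: "x \<in> carrier G \<Longrightarrow> y \<in> carrier G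
    \<Longrightarrow> comm (inv x) y = conjug x (inv (comm x y))"
  by (simp add: word_simps)

lemma inv_comm_eq: "x \<in> carrier G \<Longrightarrow> y \<in> carrier G \<Longrightarrow> inv (comm x y) = comm y x"
  by (simp add: word_simps)

lemma conj_inv_eq_comm: "x \<in> carrier G \<Longrightarrow> y \<in> carrier G \<Longrightarrow> conjug (inv y) x = x \<otimes> comm x y"
  by (simp add: word_simps)

lemma conj_pow: "g \<in> carrier G \<Longrightarrow> x \<in> carrier G \<Longrightarrow> conjug g (x [^] (n::nat)) = conjug g x [^] n"
  by (induction n) (simp_all add: conj_mult)

lemma subgroup_conj:
  assumes "subgroup H G" "g \<in> H" "x \<in> H" shows "conjug g x \<in> H"
  using assms by (simp add: conjug_def subgroup.m_closed subgroup.m_inv_closed)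

lemma subgroup_comm:
  assumes "subgroup H G" "g \<in> H" "x \<in> H" shows "comm g x \<in> H"
  using assms by (simp add: comm_def subgroup.m_closed subgroup.m_inv_closed)

lemma subgroup_pow:
  assumes "subgroup H G" "x \<in> H" shows "x [^] (n::nat) \<in> H"
  by (induction n) (use assms in \<open>auto simp: subgroup.one_closed subgroup.m_closed\<close>)

lemma subgroup_conj_image:
  assumes "subgroup H G" "g \<in> carrier G" shows "subgroup (conjug g ` H) G"
proof (rule subgroupI)
  have sub: "\<And>x. x \<in> H \<Longrightarrow> x \<in> carrier G" using assms subgroup.subset by blast
  show "conjug g ` H \<subseteq> carrier G" using sub assms by auto
  show "conjug g ` H \<noteq> {}" using assms(1) subgroup.one_closed by blast
  fix a assume "a \<in> conjug g ` H"
  then obtain x where x: "x \<in> H" "a = conjug g x" by blast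
  then have "inv a = conjug g (inv x)" using assms sub by (simp add: conj_inv)
  then show "inv a \<in> conjug g ` H" using x assms by (simp add: subgroup.m_inv_closed)
  fix b assume "b \<in> conjug g ` H"
  then obtain y where y: "y \<in> H" "b = conjug g y" by blast
  then have "a \<otimes> b = conjug g (x \<otimes> y)" using x assms sub by (simp add: conj_mult)
  then show "a \<otimes> b \<in> conjug g ` H" using x y assms by (simp add: subgroup.m_closed)
qed

lemma inj_on_conj:
  assumes "g \<in> carrier G" "H \<subseteq> carrier G" shows "inj_on (conjug g) H"
proof (rule inj_on_inverseI)
  fix x assume "x \<in> H"
  then show "conjug (inv g) (conjug g x) = x" using assms by (intro conj_inv_conj(2)) auto
qed

lemma card_conj_image:
  assumes "g \<in> carrier G" "H \<subseteq> carrier G" shows "card (conjug g ` H) = card H"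
  using card_image[OF inj_on_conj[OF assms]] .

text \<open>Lagrange's theorem for a map that separates exactly the left cosets of \<open>K\<close>.
  Since \<open>f\<close> may be any such map, this covers orbit maps and, in the replacement
  theorem, the crossed map sending x to the coset of \<open>comm b x\<close>.\<close>

lemma card_subgroup_fibers:
  assumes H: "subgroup H G" "finite H" and K: "subgroup K G" "K \<subseteq> H"
    and f: "\<And>x y. x \<in> H \<Longrightarrow> y \<in> H \<Longrightarrow> f x = f y \<longleftrightarrow> inv x \<otimes> y \<in> K"
  shows "card H = card K * card (f ` H)"
proof (rule card_eq_fibers[OF H(2)])
  fix x assume x: "x \<in> H"
  have HG: "\<And>y. y \<in> H \<Longrightarrow> y \<in> carrier G" using H subgroup.subset by blast
  have "{y \<in> H. f y = f x} = (\<lambda>k. x \<otimes> k) ` K"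
  proof (intro equalityI subsetI)
    fix y assume y: "y \<in> {y \<in> H. f y = f x}"
    then have "inv x \<otimes> y \<in> K" using f[OF x, of y] by simp
    then show "y \<in> (\<lambda>k. x \<otimes> k) ` K"
      using y x HG by (intro image_eqI[of _ _ "inv x \<otimes> y"]) auto
  next
    fix y assume "y \<in> (\<lambda>k. x \<otimes> k) ` K"
    then obtain k where k: "k \<in> K" "y = x \<otimes> k" by blast
    then have "y \<in> H" "inv x \<otimes> y \<in> K"
      using x H K HG by (auto intro: subgroup.m_closed simp: subsetD)
    then show "y \<in> {y \<in> H. f y = f x}" using f[OF x, of y] by simp
  qed
  moreover have "inj_on (\<lambda>k. x \<otimes> k) K"
    using x HG K by (auto simp: inj_on_def subset_iff)
  ultimately show "card {y \<in> H. f y = f x} = card K" by (simp add: card_image)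
qed

lemma l_coset_eq_iff:
  assumes "subgroup K G" "x \<in> carrier G" "y \<in> carrier G"
  shows "x <# K = y <# K \<longleftrightarrow> inv x \<otimes> y \<in> K"
proof
  assume "x <# K = y <# K"
  then have "y \<in> x <# K" using assms unfolding l_coset_def
    by (metis (no_types, lifting) UN_iff insertI1 r_one subgroup.one_closed)
  then show "inv x \<otimes> y \<in> K"
    using assms subgroup.subset[OF assms(1)] unfolding l_coset_def by (auto simp: subset_iff)
next
  assume a: "inv x \<otimes> y \<in> K"
  have "y \<in> x <# K" using subgroup.lcos_module_rev[OF assms(1) group_axioms assms(2,3) a] .
  then show "x <# K = y <# K" using l_repr_independence assms by blast
qed

lemma card_l_cosets:
  assumes "subgroup H G" "finite H" "subgroup K G" "K \<subseteq> H"
  shows "card H = card K * card ((\<lambda>x. x <# K) ` H)"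
  using assms l_coset_eq_iff subgroup.subset[OF assms(1)] by (intro card_subgroup_fibers) blast+

lemma card_subgroup_dvd:
  assumes "subgroup H G" "finite H" "subgroup K G" "K \<subseteq> H"
  shows "card K dvd card H"
  using card_l_cosets[OF assms] by simp

text \<open>The fiber of multiplication through (h, k) consists of the pairs (h t, t^-1 k) with t in
  the intersection; the product set itself may fail to be a subgroup.\<close>

lemma card_set_mult:
  assumes "subgroup H G" "finite H" "subgroup K G" "finite K"
  shows "card H * card K = card (H \<inter> K) * card (H <#> K)"
proof -
  have HG: "\<And>y. y \<in> H \<Longrightarrow> y \<in> carrier G" and KG: "\<And>y. y \<in> K \<Longrightarrow> y \<in> carrier G"
    using assms subgroup.subset by blast+
  define f where "f = (\<lambda>(h, k). h \<otimes> k)"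
  have "card (H \<times> K) = card (H \<inter> K) * card (f ` (H \<times> K))"
  proof (rule card_eq_fibers)
    show "finite (H \<times> K)" using assms by simp
    fix z assume "z \<in> H \<times> K"
    then obtain h k where z: "z = (h, k)" "h \<in> H" "k \<in> K" by blast
    have hk: "h \<in> carrier G" "k \<in> carrier G" using z HG KG by auto
    have "{y \<in> H \<times> K. f y = f z} = (\<lambda>t. (h \<otimes> t, inv t \<otimes> k)) ` (H \<inter> K)"
    proof (intro equalityI subsetI)
      fix y assume "y \<in> {y \<in> H \<times> K. f y = f z}"
      then obtain u v where y: "y = (u, v)" "u \<in> H" "v \<in> K" "u \<otimes> v = h \<otimes> k"
        unfolding f_def z by auto
      define t where "t = inv h \<otimes> u"
      have uv: "u \<in> carrier G" "v \<in> carrier G" using y HG KG by auto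
      have t1: "t = k \<otimes> inv v" unfolding t_def
        using y(4) uv hk by (metis inv_closed inv_solve_left inv_solve_right m_assoc m_closed)
      have "t \<in> H" unfolding t_def using y z assms by (simp add: subgroup.m_closed subgroup.m_inv_closed)
      moreover have "t \<in> K" unfolding t1 using y z assms by (simp add: subgroup.m_closed subgroup.m_inv_closed)
      moreover have "u = h \<otimes> t" using uv hk unfolding t_def by simp
      moreover have "v = inv t \<otimes> k" using uv hk unfolding t1 by (simp add: inv_mult_group m_assoc)
      ultimately show "y \<in> (\<lambda>t. (h \<otimes> t, inv t \<otimes> k)) ` (H \<inter> K)" using y by blast
    next
      fix y assume "y \<in> (\<lambda>t. (h \<otimes> t, inv t \<otimes> k)) ` (H \<inter> K)"
      then obtain t where t: "y = (h \<otimes> t, inv t \<otimes> k)" "t \<in> H" "t \<in> K" by blast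
      then show "y \<in> {y \<in> H \<times> K. f y = f z}"
        using z hk HG assms by (auto simp: f_def m_assoc intro!: subgroup.m_closed subgroup.m_inv_closed)
    qed
    moreover have "inj_on (\<lambda>t. (h \<otimes> t, inv t \<otimes> k)) (H \<inter> K)"
      using hk HG by (auto simp: inj_on_def)
    ultimately show "card {y \<in> H \<times> K. f y = f z} = card (H \<inter> K)" by (simp add: card_image)
  qed
  moreover have "f ` (H \<times> K) = H <#> K" unfolding f_def set_mult_def by force
  ultimately show ?thesis by (simp add: card_cartesian_product)
qed

lemma pow_card_subgroup:
  assumes "subgroup H G" "x \<in> H"
  shows "x [^] card H = \<one>"
proof -
  interpret H: group "G\<lparr>carrier := H\<rparr>" using assms(1) by (rule subgroup_imp_group)
  have "x [^]\<^bsub>G\<lparr>carrier := H\<rparr>\<^esub> card H = \<one>"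
    using H.pow_order_eq_1[of x] assms by (simp add: order_def)
  then show ?thesis by (simp add: nat_pow_def)
qed

text \<open>By orbit-stabilizer an orbit of a non-fixed point has size a nontrivial divisor of p^n.
  The equivalence is used both ways: to find a fixed coset when p does not divide the number of
  points, and a second fixed coset when it does.\<close>

lemma p_group_fixed_points:
  assumes p: "Factorial_Ring.prime p" and Q: "subgroup Q G" "card Q = p ^ n" and fin: "finite \<Omega>"
    and cl: "\<And>g x. g \<in> Q \<Longrightarrow> x \<in> \<Omega> \<Longrightarrow> \<phi> g x \<in> \<Omega>"
    and one: "\<And>x. x \<in> \<Omega> \<Longrightarrow> \<phi> \<one> x = x"
    and mult: "\<And>g h x. g \<in> Q \<Longrightarrow> h \<in> Q \<Longrightarrow> x \<in> \<Omega> \<Longrightarrow> \<phi> (g \<otimes> h) x = \<phi> g (\<phi> h x)"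
  shows "p dvd card \<Omega> \<longleftrightarrow> p dvd card {x \<in> \<Omega>. \<forall>g\<in>Q. \<phi> g x = x}"
proof -
  have finQ: "finite Q" using Q p by (metis card.infinite not_prime_0 power_eq_0_iff)
  have QG: "\<And>y. y \<in> Q \<Longrightarrow> y \<in> carrier G" using Q subgroup.subset by blast
  define F where "F = {x \<in> \<Omega>. \<forall>g\<in>Q. \<phi> g x = x}"
  define orb where "orb x = (\<lambda>g. \<phi> g x) ` Q" for x
  have inv_act: "\<phi> (inv g) (\<phi> g x) = x" if "g \<in> Q" "x \<in> \<Omega>" for g x
    using that Q mult[of "inv g" g x] one by (simp add: subgroup.m_inv_closed QG)
  have self: "x \<in> orb x" if "x \<in> \<Omega>" for x
    unfolding orb_def using one[OF that] Q by (metis image_eqI subgroup.one_closed)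
  have orb_eq: "orb y = orb x" if x: "x \<in> \<Omega>" and y: "y \<in> orb x" for x y
  proof -
    from y obtain g where g: "g \<in> Q" "y = \<phi> g x" unfolding orb_def by blast
    have "\<phi> h y = \<phi> (h \<otimes> g) x" if "h \<in> Q" for h using mult g x that by simp
    moreover have "\<phi> h x = \<phi> (h \<otimes> inv g) y" if "h \<in> Q" for h
      using mult[of h "inv g" y] inv_act[OF g(1) x] g x that cl Q by (simp add: subgroup.m_inv_closed)
    ultimately show ?thesis
      using subgroup.m_closed[OF Q(1)] subgroup.m_inv_closed[OF Q(1)] g(1)
      unfolding orb_def by (intro equalityI image_subsetI) (simp_all add: image_eqI)
  qed
  have dvd: "p dvd card (orb x)" if x: "x \<in> \<Omega> - F" for x
  proof -
    define St where "St = {g \<in> Q. \<phi> g x = x}"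
    have x': "x \<in> \<Omega>" using x by simp
    have St: "subgroup St G"
    proof (rule subgroupI)
      show "St \<subseteq> carrier G" unfolding St_def using QG by blast
      show "St \<noteq> {}" unfolding St_def using one[OF x'] Q subgroup.one_closed by blast
      show "inv a \<in> St" if "a \<in> St" for a
        using that inv_act[of a x] x' Q unfolding St_def by (auto simp: subgroup.m_inv_closed)
      show "a \<otimes> b \<in> St" if "a \<in> St" "b \<in> St" for a b
        using that mult[of a b x] x' Q unfolding St_def by (auto simp: subgroup.m_closed)
    qed
    have "card Q = card St * card (orb x)" unfolding orb_def
    proof (rule card_subgroup_fibers[OF Q(1) finQ St])
      show "St \<subseteq> Q" unfolding St_def by blast
      fix g h assume gh: "g \<in> Q" "h \<in> Q"
      have "\<phi> (inv g \<otimes> h) x = \<phi> (inv g) (\<phi> h x)"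
        using gh mult x' Q by (simp add: subgroup.m_inv_closed)
      moreover have "\<phi> g (\<phi> (inv g) (\<phi> h x)) = \<phi> h x"
        using inv_act[of "inv g" "\<phi> h x"] gh cl x' Q by (simp add: subgroup.m_inv_closed QG)
      ultimately show "\<phi> g x = \<phi> h x \<longleftrightarrow> inv g \<otimes> h \<in> St"
        using gh inv_act[of g x] x' Q unfolding St_def
        by (auto simp: subgroup.m_inv_closed subgroup.m_closed)
    qed
    then have "card (orb x) dvd p ^ n" using Q by (metis dvd_triv_right)
    moreover have "card (orb x) \<noteq> 1"
    proof
      assume "card (orb x) = 1"
      then have "orb x = {x}" using self[OF x'] by (metis card_1_singletonE singletonD)
      then have "\<forall>g\<in>Q. \<phi> g x = x" unfolding orb_def by blast
      then show False using x unfolding F_def by blast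
    qed
    ultimately show ?thesis using p
      by (metis divides_primepow_nat dvd_power power_0 zero_less_iff_neq_zero)
  qed
  have "p dvd card (\<Omega> - F)"
  proof -
    have U: "\<Union>(orb ` (\<Omega> - F)) = \<Omega> - F"
    proof (intro equalityI subsetI)
      fix y assume "y \<in> \<Union>(orb ` (\<Omega> - F))"
      then obtain x where x: "x \<in> \<Omega> - F" "y \<in> orb x" by blast
      then have y: "y \<in> \<Omega>" unfolding orb_def using cl by blast
      moreover have "y \<notin> F"
      proof
        assume "y \<in> F"
        then have "orb y = {y}" unfolding F_def orb_def using Q subgroup.one_closed by fastforce
        then have "x = y" using orb_eq[of x y] x self[of x] by auto
        then show False using x \<open>y \<in> F\<close> by blast
      qed
      ultimately show "y \<in> \<Omega> - F" by blast
    qed (use self in auto)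
    have "p dvd card (\<Union>(orb ` (\<Omega> - F)))"
    proof (rule dvd_partition)
      show "finite (\<Union>(orb ` (\<Omega> - F)))" using U fin by simp
      show "\<forall>c\<in>orb ` (\<Omega> - F). p dvd card c" using dvd by blast
      show "\<forall>c1\<in>orb ` (\<Omega> - F). \<forall>c2\<in>orb ` (\<Omega> - F). c1 \<noteq> c2 \<longrightarrow> c1 \<inter> c2 = {}"
        using orb_eq by blast
    qed
    then show ?thesis using U by simp
  qed
  moreover have "card \<Omega> = card (\<Omega> - F) + card F"
    using fin unfolding F_def by (metis (no_types, lifting) add.commute card_Diff_subset card_mono le_add_diff_inverse mem_Collect_eq rev_finite_subset subsetI)
  ultimately show ?thesis unfolding F_def[symmetric] by (simp add: dvd_add_right_iff)
qed

text \<open>\<open>Q\<close> acts by left multiplication on the cosets of \<open>P\<close> in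
  \<open>K\<close>, whose number is prime to p; a fixed coset k P says that k^-1 Q k lies in
  \<open>P\<close>. Working inside \<open>K\<close> allows \<open>P\<close> to be the intersection
  of a Sylow subgroup with a normal subgroup.\<close>

lemma sylow_conjugate:
  assumes p: "Factorial_Ring.prime p" and fin: "finite (carrier G)"
    and P: "subgroup P G" and K: "subgroup K G" and Q: "subgroup Q G" "card Q = p ^ n"
    and sub: "P \<subseteq> K" "Q \<subseteq> K" and idx: "\<not> p dvd card K div card P"
  obtains k where "k \<in> K" "\<And>q. q \<in> Q \<Longrightarrow> conjug (inv k) q \<in> P"
proof -
  have KG: "\<And>y. y \<in> K \<Longrightarrow> y \<in> carrier G" and PG: "P \<subseteq> carrier G"
    using K P subgroup.subset by blast+
  have finK: "finite K" using fin KG by (meson finite_subset subsetI)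
  define \<Omega> where "\<Omega> = (\<lambda>x. x <# P) ` K"
  have "card K = card P * card \<Omega>" unfolding \<Omega>_def by (rule card_l_cosets[OF K finK P sub(1)])
  moreover have "card P \<noteq> 0" using subgroup.one_closed[OF P] finite_subset[OF sub(1) finK] by auto
  ultimately have "\<not> p dvd card \<Omega>" using idx by simp
  moreover have "p dvd card \<Omega> \<longleftrightarrow> p dvd card {x \<in> \<Omega>. \<forall>g\<in>Q. g <# x = x}"
  proof (rule p_group_fixed_points[OF p Q])
    show "finite \<Omega>" unfolding \<Omega>_def using finK by simp
    show "g <# x \<in> \<Omega>" if "g \<in> Q" "x \<in> \<Omega>" for g x
      using that sub KG PG K unfolding \<Omega>_def by (auto simp: lcos_m_assoc intro!: imageI subgroup.m_closed)
    show "\<one> <# x = x" if "x \<in> \<Omega>" for x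
      using that KG PG unfolding \<Omega>_def by (auto simp: lcos_m_assoc)
    show "(g \<otimes> h) <# x = g <# (h <# x)" if gh: "g \<in> Q" "h \<in> Q" and x: "x \<in> \<Omega>" for g h x
    proof -
      from x obtain y where y: "y \<in> K" "x = y <# P" unfolding \<Omega>_def by blast
      have "x \<subseteq> carrier G" using y KG PG by (simp add: l_coset_subset_G)
      then show ?thesis using lcos_m_assoc[of x g h] gh sub KG by blast
    qed
  qed
  ultimately have "{x \<in> \<Omega>. \<forall>g\<in>Q. g <# x = x} \<noteq> {}" by (metis card.empty dvd_0_right)
  then obtain k where k: "k \<in> K" "\<And>q. q \<in> Q \<Longrightarrow> q <# (k <# P) = k <# P"
    unfolding \<Omega>_def by blast
  show thesis
  proof (rule that[OF k(1)])
    fix q assume q: "q \<in> Q"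
    then have qG: "q \<in> carrier G" "k \<in> carrier G" using sub KG k by auto
    have "k <# P = (q \<otimes> k) <# P" using k(2)[OF q] qG PG by (simp add: lcos_m_assoc)
    then show "conjug (inv k) q \<in> P" using l_coset_eq_iff[OF P, of k "q \<otimes> k"] qG
      by (simp add: conjug_def m_assoc)
  qed
qed

text \<open>A nontrivial central element of S/N, found without forming the quotient:
  \<open>S\<close> permutes the cosets of \<open>N\<close> by conjugation and fixes \<open>N\<close>
  itself, so p divides the positive number of fixed cosets and a second one exists.\<close>

lemma p_group_central_mod:
  assumes p: "Factorial_Ring.prime p" and S: "subgroup S G" "card S = p ^ n"
    and N: "subgroup N G" "N \<subset> S" and nrm: "\<And>s x. s \<in> S \<Longrightarrow> x \<in> N \<Longrightarrow> conjug s x \<in> N"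
  obtains x where "x \<in> S" "x \<notin> N" "\<And>s. s \<in> S \<Longrightarrow> comm x s \<in> N"
proof -
  have SG: "\<And>y. y \<in> S \<Longrightarrow> y \<in> carrier G" and NG: "\<And>y. y \<in> N \<Longrightarrow> y \<in> carrier G"
    using S N subgroup.subset by blast+
  have finS: "finite S" using S p by (metis card.infinite not_prime_0 power_eq_0_iff)
  define \<Omega> where "\<Omega> = (\<lambda>x. x <# N) ` S"
  have act: "conjug s ` (x <# N) = conjug s x <# N" if "s \<in> S" "x \<in> S" for s x
  proof (intro equalityI subsetI)
    fix y assume "y \<in> conjug s ` (x <# N)"
    then obtain z where "z \<in> N" "y = conjug s (x \<otimes> z)" unfolding l_coset_def by blast
    then show "y \<in> conjug s x <# N" using nrm that SG NG unfolding l_coset_def by (auto simp: conj_mult)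
  next
    fix y assume "y \<in> conjug s x <# N"
    then obtain z where z: "z \<in> N" "y = conjug s x \<otimes> z" unfolding l_coset_def by blast
    then have "y = conjug s (x \<otimes> conjug (inv s) z)" using that SG NG by (simp add: conj_mult)
    moreover have "conjug (inv s) z \<in> N" using nrm that z S by (simp add: subgroup.m_inv_closed)
    ultimately show "y \<in> conjug s ` (x <# N)" unfolding l_coset_def by blast
  qed
  have c: "p ^ n = card N * card \<Omega>" unfolding \<Omega>_def
    using card_l_cosets[OF S(1) finS N(1)] N(2) S(2) by auto
  moreover have "card N < p ^ n" using N(2) finS S(2) by (metis psubset_card_mono)
  ultimately have "card \<Omega> \<noteq> 1" "card \<Omega> dvd p ^ n" by auto
  then have "p dvd card \<Omega>" using p
    by (metis divides_primepow_nat dvd_power power_0 zero_less_iff_neq_zero)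
  moreover have "p dvd card \<Omega> \<longleftrightarrow> p dvd card {x \<in> \<Omega>. \<forall>g\<in>S. conjug g ` x = x}"
  proof (rule p_group_fixed_points[OF p S])
    show "finite \<Omega>" unfolding \<Omega>_def using finS by simp
    show "conjug g ` x \<in> \<Omega>" if "g \<in> S" "x \<in> \<Omega>" for g x
      using that subgroup_conj[OF S(1)] unfolding \<Omega>_def by (auto simp: act)
    show "conjug \<one> ` x = x" if x: "x \<in> \<Omega>" for x
    proof -
      from x obtain y where "y \<in> S" "x = y <# N" unfolding \<Omega>_def by blast
      then show ?thesis using act[OF subgroup.one_closed[OF S(1)]] SG by simp
    qed
    show "conjug (g \<otimes> h) ` x = conjug g ` conjug h ` x"
      if gh: "g \<in> S" "h \<in> S" and x: "x \<in> \<Omega>" for g h x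
    proof -
      from x obtain y where y: "y \<in> S" "x = y <# N" unfolding \<Omega>_def by blast
      then show ?thesis using act[of "g \<otimes> h" y] act[of h y] act[of g "conjug h y"] gh SG
          subgroup_conj[OF S(1)] subgroup.m_closed[OF S(1)] by (simp add: conj_conj)
    qed
  qed
  moreover have "N \<in> {x \<in> \<Omega>. \<forall>g\<in>S. conjug g ` x = x}" (is "_ \<in> ?F")
  proof -
    have "\<one> <# N = N" using NG by (auto simp: l_coset_def)
    then have "N \<in> \<Omega>" "\<And>g. g \<in> S \<Longrightarrow> conjug g ` N = N"
      unfolding \<Omega>_def using act[of _ \<one>] subgroup.one_closed[OF S(1)] SG by (auto intro!: image_eqI)
    then show ?thesis by blast
  qed
  ultimately have "\<not> ?F \<subseteq> {N}"
    using p prime_gt_1_nat[OF p] by (auto simp: subset_singleton_iff)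
  then obtain x where x: "x \<in> S" "x <# N \<noteq> N" "\<And>g. g \<in> S \<Longrightarrow> conjug g ` (x <# N) = x <# N"
    unfolding \<Omega>_def by blast
  show thesis
  proof (rule that[OF x(1)])
    show "x \<notin> N" using x(2) coset_join3[of x N] x SG N by blast
    fix s assume s: "s \<in> S"
    have "conjug (inv s) x <# N = x <# N" using act[of "inv s" x] x s S by (simp add: subgroup.m_inv_closed)
    then have "inv x \<otimes> conjug (inv s) x \<in> N"
      using l_coset_eq_iff[OF N(1), of x "conjug (inv s) x"] SG x s by simp
    then show "comm x s \<in> N" using SG x s by (simp add: word_simps)
  qed
qed

section \<open>The upper central series of a p-group\<close>

primrec upper_central :: "'a set \<Rightarrow> nat \<Rightarrow> 'a set" where
  "upper_central S 0 = {\<one>}"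
| "upper_central S (Suc n) = {x \<in> S. \<forall>s\<in>S. comm x s \<in> upper_central S n}"

lemma upper_central_normal:
  assumes S: "subgroup S G"
  shows "subgroup (upper_central S n) G \<and> upper_central S n \<subseteq> S \<and>
    (\<forall>s\<in>S. \<forall>x\<in>upper_central S n. conjug s x \<in> upper_central S n)"
proof (induction n)
  case 0
  have "\<And>s. s \<in> S \<Longrightarrow> s \<in> carrier G" using S subgroup.subset by blast
  then show ?case using S triv_subgroup subgroup.one_closed by auto
next
  case (Suc n)
  let ?U = "upper_central S n" and ?V = "upper_central S (Suc n)"
  have SG: "\<And>y. y \<in> S \<Longrightarrow> y \<in> carrier G" using S subgroup.subset by blast
  have U: "subgroup ?U G" "?U \<subseteq> S" "\<And>s x. s \<in> S \<Longrightarrow> x \<in> ?U \<Longrightarrow> conjug s x \<in> ?U" using Suc by auto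
  have "subgroup ?V G"
  proof (rule subgroupI)
    show "?V \<subseteq> carrier G" using SG by auto
    have "\<one> \<in> ?V" using S U SG by (auto simp: subgroup.one_closed comm_def)
    then show "?V \<noteq> {}" by blast
    show "inv a \<in> ?V" if a: "a \<in> ?V" for a
    proof -
      have "comm (inv a) s \<in> ?U" if s: "s \<in> S" for s
        using a s SG U S by (simp add: comm_inv_left subgroup.m_inv_closed)
      then show ?thesis using a S by (simp add: subgroup.m_inv_closed)
    qed
    show "a \<otimes> b \<in> ?V" if a: "a \<in> ?V" and b: "b \<in> ?V" for a b
    proof -
      have "comm (a \<otimes> b) s \<in> ?U" if s: "s \<in> S" for s
        using a b s SG U S by (auto simp: comm_mult_left subgroup.m_inv_closed intro!: subgroup.m_closed)
      then show ?thesis using a b S by (simp add: subgroup.m_closed)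
    qed
  qed
  moreover have "conjug s x \<in> ?V" if s: "s \<in> S" and x: "x \<in> ?V" for s x
  proof -
    have "comm (conjug s x) t \<in> ?U" if t: "t \<in> S" for t
    proof -
      have "comm (conjug s x) t = conjug s (comm x (conjug (inv s) t))"
        using s x t SG by (simp add: conj_comm)
      moreover have "conjug (inv s) t \<in> S" using s t S by (simp add: subgroup_conj subgroup.m_inv_closed)
      ultimately show ?thesis using x U s by simp
    qed
    then show ?thesis using x s S by (simp add: subgroup_conj)
  qed
  ultimately show ?case by auto
qed

lemma p_group_upper_central:
  assumes p: "Factorial_Ring.prime p" and S: "subgroup S G" "card S = p ^ n"
  obtains m where "upper_central S m = S"
proof -
  have finS: "finite S" using S p by (metis card.infinite not_prime_0 power_eq_0_iff)
  \<comment> \<open>Strict growth of the series is recorded by comparing m with the cardinality; at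
    m = \<open>card S\<close> the second alternative is impossible.\<close>
  have "upper_central S m = S \<or> m < card (upper_central S m)" for m
  proof (induction m)
    case 0 show ?case by simp
  next
    case (Suc m)
    note U = upper_central_normal[OF S(1), of m] and V = upper_central_normal[OF S(1), of "Suc m"]
    have UV: "upper_central S m \<subseteq> upper_central S (Suc m)"
    proof
      fix x assume x: "x \<in> upper_central S m"
      have "comm x s \<in> upper_central S m" if s: "s \<in> S" for s
      proof -
        have "x \<in> carrier G" "s \<in> carrier G" using x s U subgroup.subset S by blast+
        then have "comm x s = inv x \<otimes> conjug (inv s) x" by (simp add: word_simps)
        then show ?thesis using x s U S by (simp add: subgroup.m_closed subgroup.m_inv_closed)
      qed
      then show "x \<in> upper_central S (Suc m)" using x U by auto
    qed
    show ?case
    proof (cases "upper_central S m = S")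
      case True then show ?thesis using UV V by auto
    next
      case False
      then obtain x where x: "x \<in> S" "x \<notin> upper_central S m" "\<And>s. s \<in> S \<Longrightarrow> comm x s \<in> upper_central S m"
        using p_group_central_mod[OF p S, of "upper_central S m"] U by blast
      then have "upper_central S m \<subset> upper_central S (Suc m)" using UV by auto
      then have "card (upper_central S m) < card (upper_central S (Suc m))"
        using V finS by (metis finite_subset psubset_card_mono)
      then show ?thesis using Suc.IH False by linarith
    qed
  qed
  from this[of "card S"] have "upper_central S (card S) = S"
    using upper_central_normal[OF S(1), of "card S"] finS by (metis card_mono not_less)
  then show thesis by (rule that)
qed

text \<open>The measure is the level of x in the upper central series. It serves to pick a minimal
  element of \<open>B\<close> in the replacement theorem.\<close>

lemma p_group_comm_decreasing:
  assumes "Factorial_Ring.prime p" "subgroup S G" "card S = p ^ n"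
  obtains l :: "'a \<Rightarrow> nat" where
    "\<And>x s. x \<in> S \<Longrightarrow> s \<in> S \<Longrightarrow> comm x s \<noteq> \<one> \<Longrightarrow> l (comm x s) < l x"
proof -
  obtain m where m: "upper_central S m = S" using p_group_upper_central[OF assms] .
  define l where "l x = (LEAST n. x \<in> upper_central S n)" for x
  have "l (comm x s) < l x" if "x \<in> S" "s \<in> S" "comm x s \<noteq> \<one>" for x s
  proof -
    have x: "x \<in> upper_central S (l x)" unfolding l_def by (rule LeastI[of _ m]) (use m that in simp)
    show ?thesis
    proof (cases "l x")
      case 0
      then have "x = \<one>" using x by simp
      then have "comm x s = \<one>" using subgroup.subset[OF assms(2)] that(2) by (auto simp: comm_def)
      then show ?thesis using that by simp
    next
      case (Suc k)
      then have "comm x s \<in> upper_central S k" using x that by simp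
      then show ?thesis using Suc unfolding l_def by (metis Least_le less_Suc_eq_le)
    qed
  qed
  then show thesis by (rule that)
qed

text \<open>If k is the least level at which the upper central series reaches \<open>S\<close>, all
  commutators lie at level k - 1, a proper subgroup.\<close>

lemma p_group_derived_psubset:
  assumes p: "Factorial_Ring.prime p" and S: "subgroup S G" "card S = p ^ n" and ne: "S \<noteq> {\<one>}"
  shows "derived G S \<subset> S"
proof -
  obtain m where m: "upper_central S m = S" using p_group_upper_central[OF p S] .
  define k where "k = (LEAST k. S \<subseteq> upper_central S k)"
  have k: "S \<subseteq> upper_central S k" unfolding k_def by (rule LeastI[of _ m]) (use m in simp)
  have "k \<noteq> 0" using k ne S subgroup.one_closed by fastforce
  then obtain j where j: "k = Suc j" by (cases k) auto
  have SG: "\<And>y. y \<in> S \<Longrightarrow> y \<in> carrier G" using S subgroup.subset by blast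
  have "derived G S \<subseteq> upper_central S j" unfolding derived_def
  proof (rule generate_subgroup_incl)
    show "subgroup (upper_central S j) G" using upper_central_normal[OF S(1)] by blast
    show "derived_set G S \<subseteq> upper_central S j"
    proof
      fix z assume "z \<in> derived_set G S"
      then obtain x y where xy: "x \<in> S" "y \<in> S" "z = x \<otimes> y \<otimes> inv x \<otimes> inv y" by blast
      then have "z = comm (inv x) (inv y)" using SG by (simp add: comm_def)
      moreover have "inv x \<in> S" "inv y \<in> S" using xy S by (simp_all add: subgroup.m_inv_closed)
      ultimately show "z \<in> upper_central S j" using k j by auto
    qed
  qed
  moreover have "\<not> S \<subseteq> upper_central S j"
    using not_less_Least[of j "\<lambda>k. S \<subseteq> upper_central S k", folded k_def] j by simp
  ultimately show ?thesis using derived_incl[OF subset_refl S(1)] by blast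
qed

end

section \<open>Families of abelian subgroups\<close>

text \<open>For an abelian p-subgroup and n = p^j this set is already a subgroup, namely Omega_j(A),
  so generated subgroups can be avoided.\<close>

definition torsion :: "('a, 'm) monoid_scheme \<Rightarrow> nat \<Rightarrow> 'a set \<Rightarrow> 'a set" where
  "torsion G n A = {x \<in> A. x [^]\<^bsub>G\<^esub> n = \<one>\<^bsub>G\<^esub>}"

lemma torsion_subset: "torsion G n A \<subseteq> A"
  by (auto simp: torsion_def)

text \<open>All conditions are expressed through the operations of \<open>G\<close>, not of a
  restricted monoid, so that families over a subgroup, over \<open>S\<close> and over its image in
  another group can be compared directly. A lexicographic optimum is encoded as a lower bound
  \<zeta> equal to the optimal sequence.\<close>

definition abelian_family ::
    "nat \<Rightarrow> nat \<Rightarrow> nat \<Rightarrow> (nat \<Rightarrow> int) \<Rightarrow> ('a, 'm) monoid_scheme \<Rightarrow> 'a set \<Rightarrow> 'a set set" where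
  "abelian_family p N k \<zeta> G Y = {A. subgroup A G \<and> A \<subseteq> Y \<and>
     (\<forall>x\<in>A. \<forall>y\<in>A. x \<otimes>\<^bsub>G\<^esub> y = y \<otimes>\<^bsub>G\<^esub> x) \<and> card A = N \<and>
     (\<forall>x\<in>A. x [^]\<^bsub>G\<^esub> (p ^ k) = \<one>\<^bsub>G\<^esub>) \<and> lex_ge (\<lambda>j. int (card (torsion G (p ^ j) A))) \<zeta>}"

text \<open>At the first index where b leaves c, a cannot have exceeded c earlier, for then b would
  have done so too; hence a is at least c there and b exceeds c. So a lexicographic lower bound
  survives a replacement that lowers no entry.\<close>

lemma lex_ge_mono:
  assumes "lex_ge a c" "\<And>j. a j \<le> b j" shows "lex_ge b c"
proof (cases "\<forall>j\<ge>1. b j = c j")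
  case True then show ?thesis by (simp add: lex_ge_def)
next
  case False
  define j where "j = (LEAST j. 1 \<le> j \<and> b j \<noteq> c j)"
  have j: "1 \<le> j" "b j \<noteq> c j" "\<And>i. 1 \<le> i \<Longrightarrow> i < j \<Longrightarrow> b i = c i"
    using LeastI_ex[of "\<lambda>j. 1 \<le> j \<and> b j \<noteq> c j"] not_less_Least[of _ "\<lambda>j. 1 \<le> j \<and> b j \<noteq> c j"] False
    unfolding j_def by blast+
  from assms(1) consider "\<forall>i\<ge>1. a i = c i" | k where "k \<ge> 1" "a k > c k" "\<forall>i. 1 \<le> i \<and> i < k \<longrightarrow> a i = c i"
    unfolding lex_ge_def by blast
  then have "b j > c j"
  proof cases
    case 1 then show ?thesis using j assms(2)[of j] by fastforce
  next
    case 2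
    have "\<not> k < j" using j(3)[of k] 2 assms(2)[of k] by force
    then have "a j \<ge> c j" using 2 j by (cases "j = k") auto
    then show ?thesis using j(2) assms(2)[of j] by simp
  qed
  then show ?thesis using j unfolding lex_ge_def by blast
qed

section \<open>Torsion, products and one-step extensions of abelian subgroups\<close>

context group
begin

lemma torsion_subgroup:
  assumes A: "subgroup A G" and c: "\<And>x y. x \<in> A \<Longrightarrow> y \<in> A \<Longrightarrow> x \<otimes> y = y \<otimes> x"
  shows "subgroup (torsion G n A) G"
proof (rule subgroupI)
  have AG: "\<And>x. x \<in> A \<Longrightarrow> x \<in> carrier G" using A subgroup.subset by blast
  show "torsion G n A \<subseteq> carrier G" using AG by (auto simp: torsion_def)
  have "\<one> \<in> torsion G n A" using A by (simp add: torsion_def subgroup.one_closed)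
  then show "torsion G n A \<noteq> {}" by blast
  show "inv a \<in> torsion G n A" if "a \<in> torsion G n A" for a
    using that A AG by (auto simp: torsion_def subgroup.m_inv_closed nat_pow_inv)
  show "a \<otimes> b \<in> torsion G n A" if "a \<in> torsion G n A" "b \<in> torsion G n A" for a b
    using that A AG c[of a b] by (auto simp: torsion_def subgroup.m_closed pow_mult_distrib)
qed

lemma set_mult_subgroup:
  assumes H: "subgroup H G" and K: "subgroup K G"
    and n: "\<And>h k. h \<in> H \<Longrightarrow> k \<in> K \<Longrightarrow> conjug k h \<in> H"
  shows "subgroup (H <#> K) G"
proof (rule subgroupI)
  have HG: "\<And>x. x \<in> H \<Longrightarrow> x \<in> carrier G" and KG: "\<And>x. x \<in> K \<Longrightarrow> x \<in> carrier G"
    using H K subgroup.subset by blast+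
  show "H <#> K \<subseteq> carrier G" using HG KG by (auto simp: set_mult_def)
  have "\<one> \<otimes> \<one> \<in> H <#> K" using H K unfolding set_mult_def by (blast intro: subgroup.one_closed)
  then show "H <#> K \<noteq> {}" by blast
  fix a assume "a \<in> H <#> K"
  then obtain h k where a: "h \<in> H" "k \<in> K" "a = h \<otimes> k" unfolding set_mult_def by blast
  have "inv a = conjug (inv k) (inv h) \<otimes> inv k" using a HG KG by (simp add: word_simps)
  moreover have "conjug (inv k) (inv h) \<in> H" "inv k \<in> K" using a n H K by (simp_all add: subgroup.m_inv_closed)
  ultimately show "inv a \<in> H <#> K" unfolding set_mult_def by blast
  fix b assume "b \<in> H <#> K"
  then obtain h' k' where b: "h' \<in> H" "k' \<in> K" "b = h' \<otimes> k'" unfolding set_mult_def by blast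
  have "a \<otimes> b = (h \<otimes> conjug k h') \<otimes> (k \<otimes> k')" using a b HG KG by (simp add: word_simps)
  moreover have "h \<otimes> conjug k h' \<in> H" "k \<otimes> k' \<in> K" using a b n H K by (simp_all add: subgroup.m_closed)
  ultimately show "a \<otimes> b \<in> H <#> K" unfolding set_mult_def by blast
qed

lemma set_mult_superset:
  assumes "subgroup H G" "subgroup K G" shows "H \<subseteq> H <#> K" "K \<subseteq> H <#> K"
proof -
  show "H \<subseteq> H <#> K"
  proof
    fix x assume "x \<in> H"
    then have "x = x \<otimes> \<one>" using assms subgroup.mem_carrier by force
    then show "x \<in> H <#> K" using \<open>x \<in> H\<close> subgroup.one_closed[OF assms(2)] unfolding set_mult_def by blast
  qed
  show "K \<subseteq> H <#> K"
  proof
    fix x assume "x \<in> K"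
    then have "x = \<one> \<otimes> x" using assms subgroup.mem_carrier by force
    then show "x \<in> H <#> K" using \<open>x \<in> K\<close> subgroup.one_closed[OF assms(1)] unfolding set_mult_def by blast
  qed
qed

lemma commute_shuffle:
  assumes "x \<in> carrier G" "y \<in> carrier G" "z \<in> carrier G" "w \<in> carrier G" "y \<otimes> z = z \<otimes> y"
  shows "(x \<otimes> y) \<otimes> (z \<otimes> w) = (x \<otimes> z) \<otimes> (y \<otimes> w)"
  using assms by (metis m_assoc m_closed)

lemma set_mult_abelian:
  assumes H: "subgroup H G" and K: "subgroup K G"
    and cH: "\<And>x y. x \<in> H \<Longrightarrow> y \<in> H \<Longrightarrow> x \<otimes> y = y \<otimes> x"
    and cK: "\<And>x y. x \<in> K \<Longrightarrow> y \<in> K \<Longrightarrow> x \<otimes> y = y \<otimes> x"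
    and c: "\<And>x y. x \<in> H \<Longrightarrow> y \<in> K \<Longrightarrow> x \<otimes> y = y \<otimes> x"
  shows "subgroup (H <#> K) G" "\<And>x y. x \<in> H <#> K \<Longrightarrow> y \<in> H <#> K \<Longrightarrow> x \<otimes> y = y \<otimes> x"
proof -
  have HG: "\<And>x. x \<in> H \<Longrightarrow> x \<in> carrier G" and KG: "\<And>x. x \<in> K \<Longrightarrow> x \<in> carrier G"
    using H K subgroup.subset by blast+
  show "subgroup (H <#> K) G"
  proof (rule set_mult_subgroup[OF H K])
    fix h k assume "h \<in> H" "k \<in> K"
    then show "conjug k h \<in> H" using c[of h k] conj_eq_iff[of k h] HG KG by simp
  qed
  fix x y assume "x \<in> H <#> K" "y \<in> H <#> K"
  then obtain h k h' k' where e: "h \<in> H" "k \<in> K" "x = h \<otimes> k" "h' \<in> H" "k' \<in> K" "y = h' \<otimes> k'"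
    unfolding set_mult_def by blast
  have "x \<otimes> y = (h \<otimes> h') \<otimes> (k \<otimes> k')" using e HG KG c[of h' k] by (simp add: commute_shuffle)
  also have "\<dots> = (h' \<otimes> h) \<otimes> (k' \<otimes> k)" using e cH[of h h'] cK[of k k'] by simp
  also have "\<dots> = y \<otimes> x" using e HG KG c[of h k'] by (simp add: commute_shuffle)
  finally show "x \<otimes> y = y \<otimes> x" .
qed

lemma prime_power_step:
  fixes p s :: nat
  assumes H: "subgroup H G" and x: "x \<in> carrier G" "x \<notin> H" "x [^] (p ^ s) \<in> H"
  obtains r where "x [^] (p ^ r) \<notin> H" "(x [^] (p ^ r)) [^] p \<in> H"
proof -
  define r where "r = (LEAST r. x [^] (p ^ r) \<in> H)"
  have r: "x [^] (p ^ r) \<in> H" unfolding r_def by (rule LeastI[of _ s]) (rule x(3))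
  have "r \<noteq> 0"
  proof
    assume "r = 0" then show False using r x(1,2) by simp
  qed
  then obtain t where t: "r = Suc t" by (cases r) auto
  have "x [^] (p ^ t) \<notin> H" using not_less_Least[of t "\<lambda>r. x [^] (p ^ r) \<in> H"] t r_def by simp
  moreover have "(x [^] (p ^ t)) [^] p \<in> H" using r t x by (simp add: nat_pow_pow mult.commute)
  ultimately show thesis by (rule that)
qed

text \<open>\<open>K\<close> is the subgroup generated by \<open>H\<close> and x, written with the
  explicit coset representatives 1, x, ..., x^(p-1) so that its order can be read off.\<close>

lemma adjoin_prime:
  assumes p: "Factorial_Ring.prime p" and H: "subgroup H G" "finite H"
    and x: "x \<in> carrier G" "x \<notin> H" "x [^] p \<in> H" and c: "\<And>h. h \<in> H \<Longrightarrow> h \<otimes> x = x \<otimes> h"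
  defines "K \<equiv> {h \<otimes> x [^] i | h i. h \<in> H \<and> i < p}"
  shows "subgroup K G" "card K = p * card H" "H \<subseteq> K" "x \<in> K"
proof -
  have HG: "\<And>x. x \<in> H \<Longrightarrow> x \<in> carrier G" using H subgroup.subset by blast
  have p1: "p > 1" using p prime_gt_1_nat by blast
  have all: "h \<otimes> x [^] i \<in> K" if h: "h \<in> H" for h and i :: nat
  proof -
    have "x [^] i = (x [^] p) [^] (i div p) \<otimes> x [^] (i mod p)"
      using x by (simp add: nat_pow_pow nat_pow_mult)
    then have "h \<otimes> x [^] i = (h \<otimes> (x [^] p) [^] (i div p)) \<otimes> x [^] (i mod p)"
      using x h HG by (simp add: m_assoc)
    moreover have "h \<otimes> (x [^] p) [^] (i div p) \<in> H"
      using h x H subgroup_pow by (simp add: subgroup.m_closed)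
    ultimately show ?thesis using p1 unfolding K_def by force
  qed
  have cp: "h \<otimes> x [^] i = x [^] i \<otimes> h" if "h \<in> H" for h and i :: nat
    using group_commutes_pow[of x h i] c[OF that] that x HG by simp
  show KG: "subgroup K G"
  proof (rule subgroupI)
    show "K \<subseteq> carrier G" using HG x unfolding K_def by auto
    show "K \<noteq> {}" using all[of \<one> 0] H subgroup.one_closed by blast
    fix a assume "a \<in> K"
    then obtain h i where a: "h \<in> H" "i < p" "a = h \<otimes> x [^] i" unfolding K_def by blast
    have "inv a = (inv (x [^] p) \<otimes> inv h) \<otimes> x [^] (p - i)"
    proof -
      have "inv a = inv (x [^] i) \<otimes> inv h" using a x HG by (simp add: inv_mult_group)
      also have "inv (x [^] i) = inv (x [^] p) \<otimes> x [^] (p - i)"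
      proof -
        have "x [^] (p - i) \<otimes> x [^] i = x [^] p" using a x by (simp add: nat_pow_mult)
        then have "inv (x [^] p) = inv (x [^] i) \<otimes> inv (x [^] (p - i))"
          using x inv_mult_group[of "x [^] (p - i)" "x [^] i"] by simp
        then show ?thesis using x by (simp add: m_assoc)
      qed
      also have "\<dots> \<otimes> inv h = inv (x [^] p) \<otimes> (x [^] (p - i) \<otimes> inv h)" using a x HG by (simp add: m_assoc)
      also have "x [^] (p - i) \<otimes> inv h = inv h \<otimes> x [^] (p - i)"
        using cp[of "inv h"] a H by (simp add: subgroup.m_inv_closed)
      finally show ?thesis using a x HG by (simp add: m_assoc)
    qed
    then show "inv a \<in> K" using all a x H by (simp add: subgroup.m_closed subgroup.m_inv_closed)
    fix b assume "b \<in> K"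
    then obtain h' j where b: "h' \<in> H" "j < p" "b = h' \<otimes> x [^] j" unfolding K_def by blast
    have "a \<otimes> b = (h \<otimes> h') \<otimes> (x [^] i \<otimes> x [^] j)"
      using a b x HG cp[of h' i] by (simp add: commute_shuffle)
    then show "a \<otimes> b \<in> K" using all a b x H by (simp add: nat_pow_mult subgroup.m_closed)
  qed
  show "H \<subseteq> K"
  proof
    fix h assume "h \<in> H" then show "h \<in> K" using all[of h 0] HG by simp
  qed
  show "x \<in> K" using all[of \<one> 1] H x by (simp add: subgroup.one_closed)
  \<comment> \<open>Two representatives in one coset would put x^(j-i) in \<open>H\<close> with 0 <
    j-i < p. By Bezout a power of it is x times a power of x^p, which puts x in
    \<open>H\<close>.\<close>
  have ne: "False" if hh: "h \<in> H" "h' \<in> H" "h \<otimes> x [^] i = h' \<otimes> x [^] j" and ij: "i < j" "j < p" for h h' and i j :: nat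
  proof -
    have "x [^] j = x [^] (j - i) \<otimes> x [^] i" using ij x by (simp add: nat_pow_mult)
    then have "h \<otimes> x [^] i = (h' \<otimes> x [^] (j - i)) \<otimes> x [^] i" using hh x HG by (simp add: m_assoc)
    then have "h = h' \<otimes> x [^] (j - i)" using x hh HG by simp
    then have "inv h' \<otimes> h = x [^] (j - i)" using x hh HG by simp
    then have 1: "x [^] (j - i) \<in> H"
      using hh subgroup.m_closed[OF H(1) subgroup.m_inv_closed[OF H(1)]] by metis
    have "\<not> p dvd j - i" using ij by (auto dest: dvd_imp_le)
    then have "coprime (j - i) p" using p by (simp add: coprime_commute prime_imp_coprime)
    then obtain u v where "(j - i) * u = p * v + 1" using bezout_nat[of "j - i" p] ij by auto
    then have "(x [^] (j - i)) [^] u = (x [^] p) [^] v \<otimes> x" using x by (simp add: nat_pow_pow)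
    moreover have "(x [^] (j - i)) [^] u \<in> H" "(x [^] p) [^] v \<in> H" using 1 x H subgroup_pow by blast+
    moreover have "inv ((x [^] p) [^] v) \<otimes> ((x [^] p) [^] v \<otimes> x) = x" using x by simp
    ultimately have "x \<in> H" using subgroup.m_closed[OF H(1) subgroup.m_inv_closed[OF H(1)]] by metis
    then show False using x by simp
  qed
  have "inj_on (\<lambda>(h, i). h \<otimes> x [^] i) (H \<times> {..<p})"
  proof (rule inj_onI)
    fix u v assume uv: "u \<in> H \<times> {..<p}" "v \<in> H \<times> {..<p}"
      "(case u of (h, i) \<Rightarrow> h \<otimes> x [^] i) = (case v of (h, i) \<Rightarrow> h \<otimes> x [^] i)"
    obtain h i h' j where e: "u = (h, i)" "v = (h', j)" by fastforce
    have hh: "h \<in> H" "h' \<in> H" "i < p" "j < p" "h \<otimes> x [^] i = h' \<otimes> x [^] j" using uv e by auto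
    have "\<not> i < j" "\<not> j < i" using ne[of h h' i j] ne[of h' h j i] hh by auto
    then have ij: "i = j" by simp
    then have "h = h'" using hh x HG by simp
    then show "u = v" using e ij by simp
  qed
  moreover have "K = (\<lambda>(h, i). h \<otimes> x [^] i) ` (H \<times> {..<p})" unfolding K_def by force
  ultimately show "card K = p * card H" by (simp add: card_image card_cartesian_product)
qed

text \<open>Take \<open>Y\<close> maximal among the proper subgroups containing \<open>H\<close>. A
  suitable power x of an element outside \<open>Y\<close> has x^p in \<open>Y\<close>, and adjoining
  it must give all of \<open>K\<close>.\<close>

lemma index_prime_above:
  assumes p: "Factorial_Ring.prime p" and K: "subgroup K G" "finite K" "\<And>x. x \<in> K \<Longrightarrow> x [^] (p ^ s) = \<one>"
    and c: "\<And>x y. x \<in> K \<Longrightarrow> y \<in> K \<Longrightarrow> x \<otimes> y = y \<otimes> x" and H: "subgroup H G" "H \<subset> K"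
  obtains Y where "subgroup Y G" "H \<subseteq> Y" "Y \<subset> K" "card K = p * card Y"
proof -
  have KG: "\<And>x. x \<in> K \<Longrightarrow> x \<in> carrier G" using K subgroup.subset by blast
  define C where "C = {Y. subgroup Y G \<and> H \<subseteq> Y \<and> Y \<subset> K}"
  have "C \<subseteq> Pow K" unfolding C_def by blast
  then have "finite C" using K(2) by (simp add: finite_subset)
  moreover have "H \<in> C" unfolding C_def using H by simp
  ultimately obtain Y where Y: "Y \<in> C" "\<And>Z. Z \<in> C \<Longrightarrow> Y \<subseteq> Z \<Longrightarrow> Y = Z"
    using finite_has_maximal[of C] by blast
  have Y': "subgroup Y G" "H \<subseteq> Y" "Y \<subset> K" using Y unfolding C_def by auto
  then obtain z where z: "z \<in> K" "z \<notin> Y" by blast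
  have "z [^] (p ^ s) \<in> Y" using K(3)[OF z(1)] Y' by (simp add: subgroup.one_closed)
  then obtain r where r: "z [^] (p ^ r) \<notin> Y" "(z [^] (p ^ r)) [^] p \<in> Y"
    using prime_power_step[OF Y'(1) KG[OF z(1)] z(2)] by blast
  define x where "x = z [^] (p ^ r)"
  have xK: "x \<in> K" unfolding x_def by (rule subgroup_pow[OF K(1) z(1)])
  have fY: "finite Y" using Y'(3) K(2) by (meson finite_subset psubset_imp_subset)
  define Z where "Z = {h \<otimes> x [^] i | h i. h \<in> Y \<and> i < p}"
  have Z: "subgroup Z G" "card Z = p * card Y" "Y \<subseteq> Z" "x \<in> Z"
    unfolding Z_def
    by (rule adjoin_prime[OF p Y'(1) fY KG[OF xK] r[folded x_def]]; use xK c Y'(3) in blast)+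
  have ZK: "Z \<subseteq> K" unfolding Z_def
    using Y'(3) subgroup.m_closed[OF K(1)] subgroup_pow[OF K(1) xK] by blast
  have "Z = K"
  proof (rule ccontr)
    assume "Z \<noteq> K"
    then have "Z \<in> C" unfolding C_def using Z ZK Y' by blast
    then have "Y = Z" using Y(2) Z by blast
    then show False using Z(4) r(1) x_def by simp
  qed
  then show thesis using that[OF Y'] Z by simp
qed

lemma generate_commute:
  assumes "A \<subseteq> carrier G" "x \<in> carrier G" "\<And>a. a \<in> A \<Longrightarrow> x \<otimes> a = a \<otimes> x" "y \<in> generate G A"
  shows "x \<otimes> y = y \<otimes> x"
proof -
  have "subgroup {y \<in> carrier G. x \<otimes> y = y \<otimes> x} G"
  proof (rule subgroupI)
    show "inv a \<in> {y \<in> carrier G. x \<otimes> y = y \<otimes> x}" if "a \<in> {y \<in> carrier G. x \<otimes> y = y \<otimes> x}" for a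
    proof -
      have a: "a \<in> carrier G" "x \<otimes> a = a \<otimes> x" using that by auto
      then have "conjug a x = x" using conj_eq_iff[of a x] assms(2) by simp
      then have "conjug (inv a) x = x" using conj_inv_conj(2)[of a x] a assms(2) by simp
      then show ?thesis using conj_eq_iff[of "inv a" x] a assms(2) by simp
    qed
    show "a \<otimes> b \<in> {y \<in> carrier G. x \<otimes> y = y \<otimes> x}"
      if "a \<in> {y \<in> carrier G. x \<otimes> y = y \<otimes> x}" "b \<in> {y \<in> carrier G. x \<otimes> y = y \<otimes> x}" for a b
    proof -
      have ab: "a \<in> carrier G" "x \<otimes> a = a \<otimes> x" "b \<in> carrier G" "x \<otimes> b = b \<otimes> x" using that by auto
      have "x \<otimes> (a \<otimes> b) = (x \<otimes> a) \<otimes> b" using ab(1,3) assms(2) by (simp add: m_assoc)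
      also have "\<dots> = a \<otimes> (x \<otimes> b)" using ab(1,3) assms(2) by (simp add: m_assoc ab(2))
      also have "\<dots> = (a \<otimes> b) \<otimes> x" using ab(1,3) assms(2) by (simp add: m_assoc ab(4))
      finally show ?thesis using that by simp
    qed
  qed (use assms(2) in \<open>auto intro!: exI[of _ \<one>]\<close>)
  from generate_subgroup_incl[OF _ this, of A] show ?thesis using assms by blast
qed

lemma odd_involution_trivial:
  assumes "u \<in> carrier G" "u \<otimes> u = \<one>" "u [^] n = \<one>" "odd (n::nat)" shows "u = \<one>"
proof -
  obtain m where m: "n = 2 * m + 1" using assms(4) oddE by blast
  have "u [^] (2::nat) = \<one>" using assms(1,2) by (simp add: numeral_2_eq_2)
  moreover have "u [^] n = (u [^] (2::nat)) [^] m \<otimes> u" using m assms(1) by (simp add: nat_pow_pow)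
  ultimately have "u [^] n = u" using assms(1) by simp
  then show ?thesis using assms(3) by simp
qed

end

section \<open>The replacement theorem\<close>

text \<open>Write \<open>M\<close> for the subgroup generated by the commutators \<open>comm b x\<close>, \<open>x \<in> A\<close>. As \<open>p\<close> is odd,
  \<open>M\<close> is abelian, and \<open>x \<mapsto> comm b x\<close> induces an isomorphism of \<open>A / C_A M\<close> onto \<open>M / C_M A\<close> that
  does not increase orders. If \<open>C_M A\<close> is contained in \<open>A\<close>, then \<open>M C_A M\<close> replaces \<open>A\<close>. Otherwise
  adjoin to \<open>A\<close> an element \<open>w\<close> of \<open>C_M A\<close> with \<open>w [^] p \<in> A\<close> and pass to a suitable subgroup of
  index \<open>p\<close> containing \<open>w\<close>.\<close>

locale cubic_commutators = group +
  fixes A B :: "'a set" and b :: 'a and p s :: nat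
  assumes prime_p: "Factorial_Ring.prime p" and odd_p: "odd p"
    and A: "subgroup A G" and B: "subgroup B G"
    and A_comm: "\<And>x y. x \<in> A \<Longrightarrow> y \<in> A \<Longrightarrow> x \<otimes> y = y \<otimes> x"
    and A_exp: "\<And>x. x \<in> A \<Longrightarrow> x [^] (p ^ s) = \<one>"
    and A_norm: "\<And>a x. a \<in> A \<Longrightarrow> x \<in> B \<Longrightarrow> conjug a x \<in> B"
    and comm_A: "\<And>x y. x \<in> B \<Longrightarrow> y \<in> B \<Longrightarrow> comm x y \<in> A"
    and comm_central: "\<And>x y z. x \<in> B \<Longrightarrow> y \<in> B \<Longrightarrow> z \<in> B \<Longrightarrow> comm x y \<otimes> z = z \<otimes> comm x y"
    and b: "b \<in> B"
    and cubic: "\<And>x y z. x \<in> A \<Longrightarrow> y \<in> A \<Longrightarrow> z \<in> A \<Longrightarrow> comm (comm (comm b x) y) z = \<one>"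
begin

abbreviation c where "c x \<equiv> comm b x"
abbreviation d where "d x y \<equiv> comm (comm b x) y"

definition M where "M = generate G (c ` A)"
text \<open>\<open>N\<close> is C_M(A) and \<open>CM\<close> is C_A(M). The map \<open>c\<close>
  from \<open>A\<close> to \<open>M\<close> is not a homomorphism, and \<open>d\<close> measures its
  failure to be one.\<close>

definition N where "N = {m \<in> M. \<forall>x\<in>A. m \<otimes> x = x \<otimes> m}"
definition CM where "CM = {x \<in> A. \<forall>m\<in>M. m \<otimes> x = x \<otimes> m}"

lemma AG [simp]: "x \<in> A \<Longrightarrow> x \<in> carrier G" using A subgroup.subset by blast
lemma BG [simp]: "x \<in> B \<Longrightarrow> x \<in> carrier G" using B subgroup.subset by blast
lemmas A_cl [simp] = subgroup.m_closed[OF A] subgroup.m_inv_closed[OF A] subgroup.one_closed[OF A]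
lemmas B_cl [simp] = subgroup.m_closed[OF B] subgroup.m_inv_closed[OF B] subgroup.one_closed[OF B]
  subgroup_comm[OF B] b A_norm
lemma comm_BA [simp]: "x \<in> B \<Longrightarrow> y \<in> A \<Longrightarrow> comm x y \<in> B"
proof -
  assume xy: "x \<in> B" "y \<in> A"
  then have "comm x y = inv x \<otimes> conjug (inv y) x" by (simp add: word_simps)
  then show ?thesis using xy by simp
qed

text \<open>Commutators of \<open>B\<close> lie in the abelian group \<open>A\<close>, so
  \<open>A\<close> fixes them; as they are also central in \<open>B\<close>, \<open>comm\<close> on
  \<open>B\<close> is a bilinear map invariant under \<open>A\<close>. The calculations below rest
  on this.\<close>

lemma conj_comm_B: "x \<in> B \<Longrightarrow> y \<in> B \<Longrightarrow> z \<in> A \<Longrightarrow> conjug z (comm x y) = comm x y"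
  using A_comm[OF _ comm_A] conj_eq_iff by simp

lemma conj_comm_B': "x \<in> B \<Longrightarrow> y \<in> B \<Longrightarrow> z \<in> B \<Longrightarrow> conjug z (comm x y) = comm x y"
  using comm_central[of x y z] by (subst conj_eq_iff) simp_all

lemma comm_bilinear_left: "x \<in> B \<Longrightarrow> y \<in> B \<Longrightarrow> z \<in> B \<Longrightarrow> comm (x \<otimes> y) z = comm x z \<otimes> comm y z"
  by (simp add: comm_mult_left conj_comm_B')

lemma comm_bilinear_right: "x \<in> B \<Longrightarrow> y \<in> B \<Longrightarrow> z \<in> B \<Longrightarrow> comm x (y \<otimes> z) = comm x y \<otimes> comm x z"
  using comm_central[of x z "comm x y"] by (simp add: comm_mult_right conj_comm_B')

lemma comm_inv_left_B: "x \<in> B \<Longrightarrow> y \<in> B \<Longrightarrow> comm (inv x) y = inv (comm x y)"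
  by (simp add: comm_inv_left conj_inv conj_comm_B')

lemma comm_invariant: "x \<in> B \<Longrightarrow> y \<in> B \<Longrightarrow> z \<in> A \<Longrightarrow> comm (conjug z x) (conjug z y) = comm x y"
  using conj_comm[of z x y] conj_comm_B by simp

lemma c_eq: "x \<in> A \<Longrightarrow> c x = inv b \<otimes> conjug (inv x) b"
  by (simp add: word_simps)

lemma d_fixed: "x \<in> A \<Longrightarrow> y \<in> A \<Longrightarrow> z \<in> A \<Longrightarrow> d x y \<otimes> z = z \<otimes> d x y"
  using cubic[of x y z] comm_eq_one_iff[of "d x y" z] by simp

lemma conj_d: "x \<in> A \<Longrightarrow> y \<in> A \<Longrightarrow> z \<in> A \<Longrightarrow> conjug z (d x y) = d x y"
  using d_fixed by (subst conj_eq_iff) simp_all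

text \<open>The defect \<open>d x y\<close> is fixed by \<open>A\<close> because of the cubic
  condition. Thus \<open>c\<close> becomes multiplicative once elements fixed by \<open>A\<close>
  are factored out.\<close>

lemma c_mult: "x \<in> A \<Longrightarrow> y \<in> A \<Longrightarrow> c (x \<otimes> y) = c y \<otimes> (c x \<otimes> d x y)"
  by (simp add: comm_mult_right conj_inv_eq_comm)

lemma c_one [simp]: "c \<one> = \<one>" by (simp add: comm_def)

lemma d_mult: "x \<in> A \<Longrightarrow> y \<in> A \<Longrightarrow> z \<in> A \<Longrightarrow> d x (y \<otimes> z) = d x z \<otimes> d x y"
  by (simp add: comm_mult_right conj_d)

text \<open>Write \<open>c x\<close> as b^-1 times a conjugate of b and expand bilinearly. By
  invariance the conjugation moves to the other argument, where it turns \<open>c y\<close> into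
  \<open>c y\<close> times \<open>d y (inv x)\<close>; the two occurrences of
  \<open>comm b (c y)\<close> cancel.\<close>

lemma comm_c_c:
  assumes x: "x \<in> A" and y: "y \<in> A"
  shows "comm (c x) (c y) = comm b (d y (inv x))"
proof -
  have "comm (c x) (c y) = comm (inv b) (c y) \<otimes> comm (conjug (inv x) b) (c y)"
    using x y by (simp add: c_eq[OF x] comm_bilinear_left)
  also have "comm (conjug (inv x) b) (c y) = comm b (conjug x (c y))"
    using comm_invariant[of "conjug (inv x) b" "c y" x] x y by simp
  also have "conjug x (c y) = c y \<otimes> d y (inv x)"
    using conj_inv_eq_comm[of "c y" "inv x"] x y by simp
  finally show ?thesis using x y by (simp add: comm_inv_left_B comm_bilinear_right)
qed

text \<open>Put h(x, y) = [b, d x y]. Comparing c (x y) with c (y x) shows that h is symmetric, and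
  [c x, c y] = h(y, x)^-1. So this commutator is its own inverse, hence trivial, as it lies in
  \<open>A\<close>, where orders are odd.\<close>

lemma c_commute:
  assumes x: "x \<in> A" and y: "y \<in> A"
  shows "c x \<otimes> c y = c y \<otimes> c x"
proof -
  let ?h = "\<lambda>x y. comm b (d x y)"
  have g: "comm b (c (x \<otimes> y)) = comm b (c y) \<otimes> (comm b (c x) \<otimes> ?h x y)" if "x \<in> A" "y \<in> A" for x y
    using that by (simp add: c_mult comm_bilinear_right)
  have sym: "?h x y = ?h y x"
  proof -
    have "comm b (c y) \<otimes> (comm b (c x) \<otimes> ?h x y) = comm b (c x) \<otimes> (comm b (c y) \<otimes> ?h y x)"
      using g[OF x y] g[OF y x] A_comm[OF x y] by simp
    moreover have "comm b (c x) \<otimes> (comm b (c y) \<otimes> ?h y x) = comm b (c y) \<otimes> (comm b (c x) \<otimes> ?h y x)"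
      using A_comm[OF comm_A comm_A, of b "c x" b "c y"] x y by (simp flip: m_assoc)
    ultimately show ?thesis using x y by simp
  qed
  have hinv: "?h x (inv y) = inv (?h x y)" if x: "x \<in> A" and y: "y \<in> A" for x y
  proof -
    have "d x y \<otimes> d x (inv y) = \<one>" using d_mult[of x "inv y" y] x y by (simp add: comm_def)
    then have "d x (inv y) = inv (d x y)" using x y by (simp add: eq_invI)
    moreover have "comm b (inv (d x y)) = inv (comm b (d x y))"
    proof -
      have "comm b (d x y) \<otimes> comm b (inv (d x y)) = \<one>"
        using comm_bilinear_right[of b "d x y" "inv (d x y)", symmetric] x y by simp
      then show ?thesis using x y by (simp add: eq_invI)
    qed
    ultimately show ?thesis by simp
  qed
  define u where "u = comm (c x) (c y)"
  have uA: "u \<in> A" unfolding u_def using x y comm_A by simp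
  have "comm (c y) (c x) = u" unfolding u_def using x y by (simp add: comm_c_c hinv sym)
  moreover have "comm (c y) (c x) = inv u" unfolding u_def using inv_comm_eq[of "c x" "c y"] x y by simp
  ultimately have "u \<otimes> u = \<one>" using uA by (metis AG l_inv)
  then have "u = \<one>" using odd_involution_trivial[of u "p ^ s"] uA A_exp odd_p by simp
  then show ?thesis unfolding u_def using comm_eq_one_iff[of "c x" "c y"] x y by simp
qed

lemma cA: "c ` A \<subseteq> carrier G" "c ` A \<subseteq> B" by auto

lemma M: "subgroup M G" unfolding M_def using generate_is_subgroup[OF cA(1)] .

lemma MB [simp]: "m \<in> M \<Longrightarrow> m \<in> B"
  using generate_subgroup_incl[OF cA(2) B] unfolding M_def by blast

lemmas M_cl [simp] = subgroup.m_closed[OF M] subgroup.m_inv_closed[OF M] subgroup.one_closed[OF M]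

lemma cM [simp]: "x \<in> A \<Longrightarrow> c x \<in> M" unfolding M_def by (simp add: generate.incl)

lemma M_commI:
  assumes "x \<in> carrier G" "\<And>a. a \<in> A \<Longrightarrow> c a \<otimes> x = x \<otimes> c a" "m \<in> M" shows "m \<otimes> x = x \<otimes> m"
proof -
  have "x \<otimes> y = y \<otimes> x" if "y \<in> c ` A" for y using that assms(2) by auto
  then show ?thesis using generate_commute[OF cA(1) assms(1), of m] assms(3) unfolding M_def by simp
qed

lemma M_comm:
  assumes "m \<in> M" "m' \<in> M" shows "m \<otimes> m' = m' \<otimes> m"
proof (rule M_commI[OF _ _ assms(1)])
  show "m' \<in> carrier G" using assms by simp
  fix a assume a: "a \<in> A"
  have "m' \<otimes> c a = c a \<otimes> m'"
    by (rule M_commI[OF _ _ assms(2)]) (use a c_commute in simp_all)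
  then show "c a \<otimes> m' = m' \<otimes> c a" by simp
qed

lemma M_lcomm: "m \<in> M \<Longrightarrow> m' \<in> M \<Longrightarrow> m'' \<in> M \<Longrightarrow> m \<otimes> (m' \<otimes> m'') = m' \<otimes> (m \<otimes> m'')"
  using M_comm[of m m'] by (simp flip: m_assoc)

lemmas M_ac = m_assoc M_comm M_lcomm

lemma dM [simp]: "x \<in> A \<Longrightarrow> y \<in> A \<Longrightarrow> d x y \<in> M"
proof -
  assume xy: "x \<in> A" "y \<in> A"
  then have "d x y = inv (c x) \<otimes> (inv (c y) \<otimes> c (x \<otimes> y))"
    using c_mult[of x y] by simp
  then show ?thesis using xy by simp
qed

lemma d_sym:
  assumes "x \<in> A" "y \<in> A" shows "d x y = d y x"
proof -
  have "c y \<otimes> (c x \<otimes> d x y) = c y \<otimes> (c x \<otimes> d y x)"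
    using c_mult[of x y] c_mult[of y x] A_comm[OF assms] assms M_lcomm[of "c x" "c y" "d y x"] by simp
  then show ?thesis using assms by simp
qed

lemma N: "subgroup N G"
proof (rule subgroupI)
  show "N \<subseteq> carrier G" unfolding N_def by auto
  have "\<one> \<in> N" unfolding N_def by simp
  then show "N \<noteq> {}" by blast
  show "inv a \<in> N" if a: "a \<in> N" for a
  proof -
    have "inv a \<otimes> x = x \<otimes> inv a" if x: "x \<in> A" for x
    proof -
      have aM: "a \<in> M" "a \<otimes> x = x \<otimes> a" using a x unfolding N_def by auto
      have "conjug x a = a" using aM x by (subst conj_eq_iff) simp_all
      then have "conjug x (inv a) = inv a" using aM x by (simp add: conj_inv)
      then show ?thesis using conj_eq_iff[of x "inv a"] aM x by simp
    qed
    then show ?thesis using a unfolding N_def by simp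
  qed
  show "a \<otimes> a' \<in> N" if a: "a \<in> N" "a' \<in> N" for a a'
  proof -
    have "(a \<otimes> a') \<otimes> x = x \<otimes> (a \<otimes> a')" if x: "x \<in> A" for x
    proof -
      have aM: "a \<in> M" "a \<otimes> x = x \<otimes> a" "a' \<in> M" "a' \<otimes> x = x \<otimes> a'" using a x unfolding N_def by auto
      have "conjug x a = a" "conjug x a' = a'" using aM x conj_eq_iff by simp_all
      then have "conjug x (a \<otimes> a') = a \<otimes> a'" using aM x by (simp add: conj_mult)
      then show ?thesis using conj_eq_iff[of x "a \<otimes> a'"] aM x by simp
    qed
    then show ?thesis using a unfolding N_def by simp
  qed
qed

lemma NM [simp]: "m \<in> N \<Longrightarrow> m \<in> M" by (simp add: N_def)

lemmas N_cl [simp] = subgroup.m_closed[OF N] subgroup.m_inv_closed[OF N] subgroup.one_closed[OF N]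

lemma dN [simp]: "x \<in> A \<Longrightarrow> y \<in> A \<Longrightarrow> d x y \<in> N"
  unfolding N_def using d_fixed by simp

lemma CM: "subgroup CM G"
proof (rule subgroupI)
  show "CM \<subseteq> carrier G" unfolding CM_def by auto
  have "\<one> \<in> CM" unfolding CM_def by simp
  then show "CM \<noteq> {}" by blast
  show "inv a \<in> CM" if a: "a \<in> CM" for a
  proof -
    have "m \<otimes> inv a = inv a \<otimes> m" if m: "m \<in> M" for m
    proof -
      have aM: "a \<in> A" "m \<otimes> a = a \<otimes> m" using a m unfolding CM_def by auto
      have "conjug a m = m" using aM m by (subst conj_eq_iff) simp_all
      then have "conjug (inv a) m = m" using aM m conj_inv_conj(2)[of a m] by simp
      then show ?thesis using conj_eq_iff[of "inv a" m] aM m by simp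
    qed
    then show ?thesis using a unfolding CM_def by simp
  qed
  show "a \<otimes> a' \<in> CM" if a: "a \<in> CM" "a' \<in> CM" for a a'
  proof -
    have "m \<otimes> (a \<otimes> a') = (a \<otimes> a') \<otimes> m" if m: "m \<in> M" for m
    proof -
      have aM: "a \<in> A" "m \<otimes> a = a \<otimes> m" "a' \<in> A" "m \<otimes> a' = a' \<otimes> m" using a m unfolding CM_def by auto
      have "conjug a m = m" "conjug a' m = m" using aM m conj_eq_iff by simp_all
      then have "conjug (a \<otimes> a') m = m" using aM m by (simp flip: conj_conj)
      then show ?thesis using conj_eq_iff[of "a \<otimes> a'" m] aM m by simp
    qed
    then show ?thesis using a unfolding CM_def by simp
  qed
qed

lemma CMA [simp]: "x \<in> CM \<Longrightarrow> x \<in> A" by (simp add: CM_def)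

lemma M_CM_commute: "m \<in> M \<Longrightarrow> x \<in> CM \<Longrightarrow> m \<otimes> x = x \<otimes> m" unfolding CM_def by blast

text \<open>By the symmetry of \<open>d\<close>, the element c x is fixed by \<open>A\<close>
  exactly when x commutes with every c y. So C_A(M) is the kernel of the map that \<open>c\<close>
  induces from \<open>A\<close> to M/N.\<close>

lemma c_in_N_iff: "x \<in> A \<Longrightarrow> c x \<in> N \<longleftrightarrow> x \<in> CM"
proof -
  assume x: "x \<in> A"
  have "c x \<in> N \<longleftrightarrow> (\<forall>y\<in>A. d x y = \<one>)"
    unfolding N_def using x comm_eq_one_iff by simp
  also have "\<dots> \<longleftrightarrow> (\<forall>y\<in>A. c y \<otimes> x = x \<otimes> c y)"
    using x comm_eq_one_iff d_sym[OF x] by simp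
  also have "\<dots> \<longleftrightarrow> x \<in> CM"
  proof
    assume "\<forall>y\<in>A. c y \<otimes> x = x \<otimes> c y"
    then show "x \<in> CM" unfolding CM_def using x M_commI[OF AG[OF x]] by blast
  next
    assume "x \<in> CM"
    then show "\<forall>y\<in>A. c y \<otimes> x = x \<otimes> c y" using M_CM_commute cM by blast
  qed
  finally show ?thesis .
qed

text \<open>The map induced by \<open>c\<close> from \<open>A\<close> to M/N is onto: the defects
  lie in \<open>N\<close>, so elements of the form c x z are closed under products and contain the
  inverses of the generators.\<close>

lemma M_decompose:
  assumes "m \<in> M" shows "\<exists>x\<in>A. \<exists>z\<in>N. m = c x \<otimes> z"
  using assms unfolding M_def
proof (induction rule: generate.induct)
  case one
  show ?case by (intro bexI[of _ \<one>]) simp_all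
next
  case (incl h)
  then obtain x where "x \<in> A" "h = c x" by blast
  then have "x \<in> A" "h = c x \<otimes> \<one>" by simp_all
  then show ?case using N_cl(3) by blast
next
  case (inv h)
  then obtain x where x: "x \<in> A" "h = c x" by blast
  have "c x \<otimes> (c (inv x) \<otimes> d (inv x) x) = \<one>" using c_mult[of "inv x" x] x by simp
  then have "(c (inv x) \<otimes> d (inv x) x) \<otimes> c x = \<one>" using x M_comm[of "c x"] by simp
  then have "inv h = c (inv x) \<otimes> d (inv x) x" using x by (simp add: inv_equality)
  moreover have "inv x \<in> A" "d (inv x) x \<in> N" using x by simp_all
  ultimately show ?case by blast
next
  case (eng h1 h2)
  then obtain x z y w where e: "x \<in> A" "z \<in> N" "h1 = c x \<otimes> z" "y \<in> A" "w \<in> N" "h2 = c y \<otimes> w" by blast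
  have "h1 \<otimes> h2 = c (x \<otimes> y) \<otimes> (inv (d x y) \<otimes> (z \<otimes> w))"
    using e M_comm[of "c x" "c y"] by (simp add: c_mult M_ac)
  moreover have "x \<otimes> y \<in> A" "inv (d x y) \<otimes> (z \<otimes> w) \<in> N" using e by simp_all
  ultimately show ?case by blast
qed

lemma comm_M_N:
  assumes "m \<in> M" "x \<in> A" shows "comm m x \<in> N"
proof -
  obtain y z where m: "y \<in> A" "z \<in> N" "m = c y \<otimes> z" using M_decompose[OF assms(1)] by blast
  have z: "comm z x = \<one>" using m assms(2) comm_eq_one_iff[of z x] unfolding N_def by simp
  have "conjug (inv z) (d y x) = d y x"
    using m assms(2) M_comm[of "inv z" "d y x"] by (subst conj_eq_iff) simp_all
  then have "comm m x = d y x" using m z assms(2) comm_mult_left[of "c y" z x] by simp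
  then show ?thesis using m assms(2) by simp
qed

text \<open>Conjugation by x fixes t, so b and its conjugate by x^-1 have the same commutator with
  t, and c x is their quotient. Consequently A \<inter> B lies in C_A(M) and survives the
  replacement.\<close>

lemma c_commute_AB:
  assumes x: "x \<in> A" and t: "t \<in> A" "t \<in> B" shows "c x \<otimes> t = t \<otimes> c x"
proof -
  have "conjug x t = t" using A_comm[OF x t(1)] x t by (subst conj_eq_iff) simp_all
  then have "comm (conjug (inv x) b) t = comm b t"
    using comm_invariant[of "conjug (inv x) b" t x] x t by simp
  then have "comm (c x) t = \<one>" using x t by (simp add: c_eq[OF x] comm_bilinear_left comm_inv_left_B)
  then show ?thesis using comm_eq_one_iff[of "c x" t] x t by simp
qed

lemma AB_CM: "t \<in> A \<Longrightarrow> t \<in> B \<Longrightarrow> t \<in> CM"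
  unfolding CM_def using M_commI[of t] c_commute_AB by simp

lemma d_pow:
  assumes x: "x \<in> A" shows "d x (x [^] n) = d x x [^] (n::nat)"
proof (induction n)
  case 0 show ?case using x by (simp add: comm_def)
next
  case (Suc n)
  have "d x (x [^] n \<otimes> x) = d x x \<otimes> d x (x [^] n)"
    using d_mult[of x "x [^] n" x] x subgroup_pow[OF A x] by simp
  then show ?case using Suc x by (simp flip: nat_pow_Suc2)
qed

lemma c_pow:
  assumes x: "x \<in> A" shows "c (x [^] n) = c x [^] n \<otimes> d x x [^] (n choose 2)"
proof (induction n)
  case 0 show ?case by (simp add: numeral_2_eq_2)
next
  case (Suc n)
  have pM: "m [^] (k::nat) \<in> M" if "m \<in> M" for m k using subgroup_pow[OF M that] .
  have xn: "x [^] n \<in> A" for n :: nat using subgroup_pow[OF A x] .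
  have "c (x [^] Suc n) = c (x \<otimes> x [^] n)" using x by (simp only: nat_pow_Suc2 AG)
  also have "\<dots> = c (x [^] n) \<otimes> (c x \<otimes> d x (x [^] n))" using c_mult x xn by simp
  also have "\<dots> = (c x [^] n \<otimes> c x) \<otimes> (d x x [^] (n choose 2) \<otimes> d x x [^] n)"
    unfolding Suc d_pow[OF x] using x pM by (simp add: M_ac)
  also have "\<dots> = c x [^] Suc n \<otimes> d x x [^] (Suc n choose 2)"
    using x by (simp add: nat_pow_mult numeral_2_eq_2 add.commute)
  finally show ?case .
qed

text \<open>For odd n the number n choose 2 is a multiple of n, so the correction factor in
  \<open>c_pow\<close> is trivial, d x x itself having trivial n-th power.\<close>

lemma c_torsion:
  assumes x: "x \<in> A" "x [^] n = \<one>" and n: "odd (n::nat)" shows "c x [^] n = \<one>"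
proof -
  have z: "d x x [^] n = \<one>" using d_pow[of x n] x by (simp add: comm_def)
  have "n choose 2 = n * ((n - 1) div 2)"
    using n by (simp add: choose_two div_mult_swap)
  then have "d x x [^] (n choose 2) = (d x x [^] n) [^] ((n - 1) div 2)" using x by (simp add: nat_pow_pow)
  then have "d x x [^] (n choose 2) = \<one>" using z by simp
  then show ?thesis using c_pow[OF x(1), of n] x by simp
qed

lemma M_torsion:
  assumes "\<And>x. x \<in> A \<Longrightarrow> x [^] n = \<one>" "odd (n::nat)" "m \<in> M" shows "m [^] n = \<one>"
proof -
  have "M \<subseteq> torsion G n M" unfolding M_def
  proof (rule generate_subgroup_incl)
    show "c ` A \<subseteq> torsion G n (generate G (c ` A))"
      using c_torsion assms cM unfolding torsion_def M_def by auto
    show "subgroup (torsion G n (generate G (c ` A))) G"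
      using torsion_subgroup[OF M M_comm] unfolding M_def .
  qed
  then show ?thesis using assms(3) unfolding torsion_def by blast
qed

end

lemma prime_power_less_imp:
  fixes p x y :: nat
  assumes "Factorial_Ring.prime p" "x dvd p ^ s" "y dvd p ^ s" "x < y" shows "p * x \<le> y"
proof -
  obtain i where i: "x = p ^ i" using divides_primepow_nat[OF assms(1)] assms(2) by blast
  obtain j where j: "y = p ^ j" using divides_primepow_nat[OF assms(1)] assms(3) by blast
  note ij = i j
  have "i < j" using assms(4) prime_gt_0_nat[OF assms(1)] unfolding ij by (rule nat_power_less_imp_less[rotated])
  then have "p ^ Suc i \<le> p ^ j" using prime_ge_1_nat[OF assms(1)] by (intro power_increasing) simp_all
  then show ?thesis using ij by simp
qed

section \<open>The two replacements for \<open>A\<close> and the count of their torsion\<close>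

context cubic_commutators
begin

context
  assumes fin: "finite A" "finite B"
begin

lemma finM: "finite M" using fin MB by (meson finite_subset subsetI)

lemma finCM: "finite CM" using fin(1) CMA by (meson finite_subset subsetI)

text \<open>The elements \<open>c (inv x \<otimes> y)\<close> and
  \<open>inv (c x) \<otimes> c y\<close> differ by an element of \<open>N\<close>. With
  \<open>c_in_N_iff\<close> this is injectivity of the induced map on cosets of
  \<open>CM\<close>.\<close>

lemma coset_c_eq_iff:
  assumes "x \<in> A" "y \<in> A" shows "inv (c x) \<otimes> c y \<in> N \<longleftrightarrow> inv x \<otimes> y \<in> CM"
proof -
  have "c (inv x) \<otimes> (c x \<otimes> d x (inv x)) = \<one>" using c_mult[of x "inv x"] assms by simp
  then have 1: "c x \<otimes> (c (inv x) \<otimes> d x (inv x)) = \<one>" using assms M_lcomm[of "c x" "c (inv x)" "d x (inv x)"] by simp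
  then have 2: "inv (c x) = c (inv x) \<otimes> d x (inv x)" using assms eq_invI[OF 1] by simp
  have "c (inv x \<otimes> y) = c y \<otimes> (c (inv x) \<otimes> d (inv x) y)" using c_mult assms by simp
  also have "\<dots> = (inv (c x) \<otimes> c y) \<otimes> (inv (d x (inv x)) \<otimes> d (inv x) y)"
    using assms unfolding 2 by (simp add: M_ac)
  finally have e: "c (inv x \<otimes> y) = (inv (c x) \<otimes> c y) \<otimes> (inv (d x (inv x)) \<otimes> d (inv x) y)" .
  define w where "w = inv (d x (inv x)) \<otimes> d (inv x) y"
  have w: "w \<in> N" unfolding w_def using assms by simp
  have "inv (c x) \<otimes> c y \<in> M" using assms by simp
  then have e': "inv (c x) \<otimes> c y = c (inv x \<otimes> y) \<otimes> inv w"
    unfolding e w_def[symmetric] using w by (simp add: m_assoc)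
  have "inv (c x) \<otimes> c y \<in> N \<longleftrightarrow> c (inv x \<otimes> y) \<in> N"
  proof
    assume "inv (c x) \<otimes> c y \<in> N"
    then show "c (inv x \<otimes> y) \<in> N" unfolding e w_def[symmetric] by (rule N_cl(1)[OF _ w])
  next
    assume "c (inv x \<otimes> y) \<in> N"
    then show "inv (c x) \<otimes> c y \<in> N" unfolding e' by (rule N_cl(1)[OF _ N_cl(2)[OF w]])
  qed
  then show ?thesis using c_in_N_iff[of "inv x \<otimes> y"] assms by simp
qed

lemma cm_subgroup: "subgroup (M <#> CM) G"
  and cm_abelian: "\<And>x y. x \<in> M <#> CM \<Longrightarrow> y \<in> M <#> CM \<Longrightarrow> x \<otimes> y = y \<otimes> x"
  by (rule set_mult_abelian[OF M CM M_comm A_comm[OF CMA CMA] M_CM_commute]; assumption)+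

text \<open>Since \<open>c\<close> preserves n-torsion, the torsion of \<open>A\<close> modulo that
  of \<open>CM\<close> embeds into the torsion of \<open>M\<close> modulo that of \<open>N\<close>.
  If \<open>N\<close> lies in \<open>A\<close>, then \<open>M\<close> and \<open>CM\<close> meet
  exactly in \<open>N\<close>, and the product formula turns this into the stated bound.\<close>

lemma card_torsion_le:
  assumes NA: "N \<subseteq> A" and n: "odd n"
  shows "card (torsion G n A) \<le> card (torsion G n (M <#> CM))"
proof -
  let ?A = "torsion G n A" and ?M = "torsion G n M" and ?N = "torsion G n N" and ?C = "torsion G n CM"
  have sA: "subgroup ?A G" using torsion_subgroup[OF A A_comm] .
  have sM: "subgroup ?M G" using torsion_subgroup[OF M M_comm] .
  have sN: "subgroup ?N G" using torsion_subgroup[OF N M_comm[OF NM NM]] .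
  have sC: "subgroup ?C G" using torsion_subgroup[OF CM A_comm[OF CMA CMA]] .
  have fM: "finite ?M" and fA: "finite ?A" and fC: "finite ?C"
    using finM fin(1) finCM by (simp_all add: finite_subset[OF torsion_subset])
  have NM': "?N \<subseteq> ?M" by (auto simp: torsion_def)
  have cM': "c ` ?A \<subseteq> ?M" using c_torsion n by (auto simp: torsion_def)
  define f where "f x = c x <# ?N" for x
  have "card ?A = card ?C * card (f ` ?A)"
  proof (rule card_subgroup_fibers[OF sA fA sC])
    show "?C \<subseteq> ?A" by (auto simp: torsion_def)
    fix x y assume xy: "x \<in> ?A" "y \<in> ?A"
    then have xA: "x \<in> A" "y \<in> A" by (auto simp: torsion_def)
    have cxy: "c x \<in> ?M" "c y \<in> ?M" using xy cM' by auto
    have "f x = f y \<longleftrightarrow> inv (c x) \<otimes> c y \<in> ?N" unfolding f_def using l_coset_eq_iff[OF sN] xA by simp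
    also have "\<dots> \<longleftrightarrow> inv (c x) \<otimes> c y \<in> N"
      using subgroup.m_closed[OF sM subgroup.m_inv_closed[OF sM cxy(1)] cxy(2)] by (auto simp: torsion_def)
    also have "\<dots> \<longleftrightarrow> inv x \<otimes> y \<in> CM" using coset_c_eq_iff xA .
    also have "\<dots> \<longleftrightarrow> inv x \<otimes> y \<in> ?C"
      using subgroup.m_closed[OF sA subgroup.m_inv_closed[OF sA xy(1)] xy(2)] by (auto simp: torsion_def)
    finally show "f x = f y \<longleftrightarrow> inv x \<otimes> y \<in> ?C" .
  qed
  also have "\<dots> \<le> card ?C * card ((\<lambda>m. m <# ?N) ` ?M)"
  proof (rule mult_le_mono2, rule card_mono)
    show "finite ((\<lambda>m. m <# ?N) ` ?M)" using fM by simp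
    show "f ` ?A \<subseteq> (\<lambda>m. m <# ?N) ` ?M" unfolding f_def using cM' by blast
  qed
  finally have "card ?A * card ?N \<le> card ?C * card ((\<lambda>m. m <# ?N) ` ?M) * card ?N" by simp
  also have "\<dots> = card ?M * card ?C" using card_l_cosets[OF sM fM sN NM'] by simp
  also have "\<dots> = card (?M \<inter> ?C) * card (?M <#> ?C)" by (rule card_set_mult[OF sM fM sC fC])
  also have "?M \<inter> ?C = ?N"
  proof -
    have "N \<subseteq> CM" unfolding CM_def using NA M_comm NM by blast
    moreover have "M \<inter> CM \<subseteq> N" unfolding N_def using A_comm CMA by blast
    ultimately show ?thesis unfolding torsion_def using NM by blast
  qed
  finally have "card ?N * card ?A \<le> card ?N * card (?M <#> ?C)" by (simp add: mult.commute)
  moreover have "card ?N > 0" using subgroup.one_closed[OF sN] finite_subset[OF NM' fM] card_gt_0_iff by blast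
  ultimately have "card ?A \<le> card (?M <#> ?C)" by simp
  also have "\<dots> \<le> card (torsion G n (M <#> CM))"
  proof (rule card_mono)
    have "M <#> CM \<subseteq> (\<lambda>(x, y). x \<otimes> y) ` (M \<times> CM)" unfolding set_mult_def by force
    moreover have "finite (M \<times> CM)" using finM finCM by simp
    ultimately have "finite (M <#> CM)" by (meson finite_imageI finite_subset)
    then show "finite (torsion G n (M <#> CM))" by (rule finite_subset[OF torsion_subset])
    show "?M <#> ?C \<subseteq> torsion G n (M <#> CM)"
    proof
      fix z assume "z \<in> ?M <#> ?C"
      then obtain m x where mx: "m \<in> ?M" "x \<in> ?C" "z = m \<otimes> x" unfolding set_mult_def by blast
      then have "m \<in> M" "x \<in> CM" "m [^] n = \<one>" "x [^] n = \<one>" by (auto simp: torsion_def)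
      then have "z [^] n = \<one>" using mx pow_mult_distrib[OF M_CM_commute, of m x n] by simp
      moreover have "z \<in> M <#> CM" using mx unfolding set_mult_def torsion_def by blast
      ultimately show "z \<in> torsion G n (M <#> CM)" by (simp add: torsion_def)
    qed
  qed
  finally show ?thesis .
qed

text \<open>The same count on the whole groups; now the induced map is also onto, which gives
  equality.\<close>

lemma card_M_CM:
  assumes NA: "N \<subseteq> A" shows "card (M <#> CM) = card A"
proof -
  have "card A = card CM * card ((\<lambda>x. c x <# N) ` A)"
    by (rule card_subgroup_fibers[OF A fin(1) CM])
       (use l_coset_eq_iff[OF N] coset_c_eq_iff in auto)
  also have "(\<lambda>x. c x <# N) ` A = (\<lambda>m. m <# N) ` M"
  proof (intro equalityI subsetI)
    fix z assume "z \<in> (\<lambda>m. m <# N) ` M"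
    then obtain m where m: "m \<in> M" "z = m <# N" by blast
    then obtain x w where x: "x \<in> A" "w \<in> N" "m = c x \<otimes> w" using M_decompose by blast
    then have "c x <# N = m <# N" using l_coset_eq_iff[OF N, of "c x" m] by simp
    then show "z \<in> (\<lambda>x. c x <# N) ` A" using x m by blast
  qed auto
  finally have "card N * card A = card M * card CM"
    using card_l_cosets[OF M finM N] NM by (simp add: subsetI)
  also have "\<dots> = card (M \<inter> CM) * card (M <#> CM)" by (rule card_set_mult[OF M finM CM finCM])
  also have "M \<inter> CM = N"
  proof
    show "N \<subseteq> M \<inter> CM" unfolding CM_def using NA M_comm NM by blast
    show "M \<inter> CM \<subseteq> N" unfolding N_def using A_comm CMA by blast
  qed
  finally have "card N * card A = card N * card (M <#> CM)" .
  moreover have "card N > 0" using N_cl(3) finite_subset[of N M] finM NM card_gt_0_iff by blast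
  ultimately show ?thesis by simp
qed

lemma replacement_M:
  assumes NA: "N \<subseteq> A" and d: "x \<in> A" "y \<in> A" "d x y \<noteq> \<one>"
    and AS: "A \<in> abelian_family p n k \<zeta> G S" "subgroup S G" "B \<subseteq> S"
  shows "\<exists>A'\<in>abelian_family p n k \<zeta> G S. card (A \<inter> B) < card (A' \<inter> B) \<and> b \<notin> A'"
proof (intro bexI conjI)
  let ?A' = "M <#> CM"
  have ASS: "A \<subseteq> S" using AS by (simp add: abelian_family_def)
  have sup: "M \<subseteq> ?A'" "CM \<subseteq> ?A'" using set_mult_superset[OF M CM] by auto
  show "?A' \<in> abelian_family p n k \<zeta> G S" unfolding abelian_family_def
  proof (intro CollectI conjI ballI)
    show "subgroup ?A' G" by (rule cm_subgroup)
    show "?A' \<subseteq> S" using ASS AS(3) subgroup.m_closed[OF AS(2)] MB CMA unfolding set_mult_def by blast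
    show "card ?A' = n" using card_M_CM[OF NA] AS by (simp add: abelian_family_def)
    show "x \<otimes> y = y \<otimes> x" if "x \<in> ?A'" "y \<in> ?A'" for x y using cm_abelian that .
    show "z [^] (p ^ k) = \<one>" if z: "z \<in> ?A'" for z
    proof -
      obtain m x where mx: "m \<in> M" "x \<in> CM" "z = m \<otimes> x" using z unfolding set_mult_def by blast
      have e: "x [^] (p ^ k) = \<one>" if "x \<in> A" for x using AS(1) that by (simp add: abelian_family_def)
      have "m [^] (p ^ k) = \<one>" using M_torsion[of "p ^ k" m] e odd_p mx by simp
      then show ?thesis using mx pow_mult_distrib[OF M_CM_commute, of m x "p ^ k"] e by simp
    qed
    show "lex_ge (\<lambda>j. int (card (torsion G (p ^ j) ?A'))) \<zeta>"
    proof (rule lex_ge_mono)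
      show "lex_ge (\<lambda>j. int (card (torsion G (p ^ j) A))) \<zeta>" using AS by (simp add: abelian_family_def)
      show "int (card (torsion G (p ^ j) A)) \<le> int (card (torsion G (p ^ j) ?A'))" for j
        using card_torsion_le[OF NA] odd_p by simp
    qed
  qed
  \<comment> \<open>As d x y is nontrivial, c x does not commute with y. It lies in
    \<open>M\<close>, hence in \<open>B\<close>, and makes the intersection with \<open>B\<close>
    strictly larger.\<close>
  have "c x \<notin> A"
  proof
    assume "c x \<in> A"
    then have "d x y = \<one>" using A_comm[of "c x" y] d comm_eq_one_iff[of "c x" y] by simp
    then show False using d by simp
  qed
  then have "A \<inter> B \<subset> ?A' \<inter> B" using AB_CM sup cM[OF d(1)] MB by blast
  then show "card (A \<inter> B) < card (?A' \<inter> B)" using fin by (simp add: psubset_card_mono)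
  \<comment> \<open>If b = m u with u in C_A(M), then u commutes with x, so c x = [m, x] lies in
    \<open>N\<close> and d x y is trivial.\<close>
  show "b \<notin> ?A'"
  proof
    assume "b \<in> ?A'"
    then obtain m u where mu: "m \<in> M" "u \<in> CM" "b = m \<otimes> u" unfolding set_mult_def by blast
    have "comm u x = \<one>" using A_comm[of u x] mu d comm_eq_one_iff[of u x] by simp
    moreover have "comm m x \<in> N" using comm_M_N mu d by simp
    moreover have "conjug (inv u) (comm m x) = comm m x"
    proof -
      have "inv u \<otimes> comm m x = comm m x \<otimes> inv u"
        using \<open>comm m x \<in> N\<close> mu unfolding N_def by simp
      then show ?thesis using conj_eq_iff[of "inv u" "comm m x"] mu d by simp
    qed
    ultimately have "c x = comm m x" using mu d comm_mult_left[of m u x] by simp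
    then have "c x \<otimes> y = y \<otimes> c x" using \<open>comm m x \<in> N\<close> d unfolding N_def by auto
    then show False using d comm_eq_one_iff[of "c x" y] by simp
  qed
qed

text \<open>\<open>A\<close> is enlarged to an abelian group \<open>K\<close> of order p |A| and
  then cut down by index p. The cut must retain K \<inter> B, which contains the new element w, and
  enough torsion that no \<omega>_j drops. The crux is that these two parts do not yet make up
  \<open>K\<close>.\<close>

lemma replacement_adjoin:
  assumes z: "z \<in> N" "z \<notin> A" and d: "x \<in> A" "y \<in> A" "d x y \<noteq> \<one>"
    and AS: "A \<in> abelian_family p n k \<zeta> G S" "subgroup S G" "B \<subseteq> S" "card S = p ^ t"
  shows "\<exists>A'\<in>abelian_family p n k \<zeta> G S. card (A \<inter> B) < card (A' \<inter> B) \<and> b \<notin> A'"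
proof -
  have M_exp: "m [^] (p ^ s) = \<one>" if "m \<in> M" for m using M_torsion[OF A_exp] odd_p that by simp
  have z': "z [^] (p ^ s) \<in> A" using M_exp z by simp
  then obtain r where r: "z [^] (p ^ r) \<notin> A" "(z [^] (p ^ r)) [^] p \<in> A"
    using prime_power_step[OF A _ z(2) z'] z(1) by auto
  define w where "w = z [^] (p ^ r)"
  have w: "w \<in> N" "w \<notin> A" "w [^] p \<in> A" using r subgroup_pow[OF N z(1)] unfolding w_def by auto
  have wc: "h \<otimes> w = w \<otimes> h" if "h \<in> A" for h using w(1) that unfolding N_def by simp
  define K where "K = {h \<otimes> w [^] i | h i. h \<in> A \<and> i < p}"
  have wG: "w \<in> carrier G" using w(1) by simp
  have K: "subgroup K G" "card K = p * card A" "A \<subseteq> K" "w \<in> K"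
    unfolding K_def using adjoin_prime[OF prime_p A fin(1) wG w(2,3) wc] by blast+
  have XE: "\<exists>h\<in>A. \<exists>i::nat. v = h \<otimes> w [^] i" if "v \<in> K" for v using that unfolding K_def by blast
  have wi: "w [^] i \<in> N" for i :: nat using subgroup_pow[OF N w(1)] .
  have X_comm: "u \<otimes> v = v \<otimes> u" if uv: "u \<in> K" "v \<in> K" for u v
  proof -
    obtain h i h' j where e: "h \<in> A" "u = h \<otimes> w [^] (i::nat)" "h' \<in> A" "v = h' \<otimes> w [^] (j::nat)"
      using XE uv by meson
    have "w [^] i \<otimes> h' = h' \<otimes> w [^] i" "w [^] j \<otimes> h = h \<otimes> w [^] j" using wi e unfolding N_def by auto
    then show ?thesis using e A_comm[of h h'] wi M_comm[of "w [^] i" "w [^] j"] by (simp add: commute_shuffle)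
  qed
  have pw: "v [^] q = \<one>" if v: "v \<in> K" and h: "\<And>h. h \<in> A \<Longrightarrow> h [^] q = \<one>" and q: "odd q"
    for v and q :: nat
  proof -
    obtain h i where e: "h \<in> A" "v = h \<otimes> w [^] (i::nat)" using XE[OF v] by blast
    have "(w [^] i) [^] q = \<one>" using M_torsion[OF h q NM[OF wi]] .
    moreover have "h \<otimes> w [^] i = w [^] i \<otimes> h" using wi e unfolding N_def by auto
    ultimately show ?thesis using e h wi pow_mult_distrib[of h "w [^] i" q] by simp
  qed
  have X_exp: "v [^] (p ^ s) = \<one>" if "v \<in> K" for v using pw[OF that A_exp] odd_p by simp
  have XS: "K \<subseteq> S"
  proof -
    have "A \<subseteq> S" "w \<in> S" using AS w(1) MB NM by (auto simp: abelian_family_def)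
    then show ?thesis unfolding K_def using subgroup.m_closed[OF AS(2)] subgroup_pow[OF AS(2)] by blast
  qed
  have finS: "finite S" using AS(4) prime_p by (metis card.infinite not_prime_0 power_eq_0_iff)
  have finX: "finite K" using XS finS finite_subset by blast
  \<comment> \<open>The first level at which \<open>K\<close> has torsion outside \<open>A\<close>.
    Below it the torsion of \<open>K\<close> and of \<open>A\<close> agree; from it on, that of
    \<open>K\<close> is larger by at least a factor p, which offsets the loss of index p.\<close>
  define j where "j = (LEAST j. \<not> torsion G (p ^ j) K \<subseteq> A)"
  have "\<not> torsion G (p ^ s) K \<subseteq> A" using w K X_exp unfolding torsion_def by blast
  then have j: "\<not> torsion G (p ^ j) K \<subseteq> A" unfolding j_def by (rule LeastI)
  have jl: "torsion G (p ^ i) K \<subseteq> A" if "i < j" for i using not_less_Least that unfolding j_def by blast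
  have "j \<noteq> 0"
  proof
    assume "j = 0"
    then have "torsion G (p ^ j) K \<subseteq> {\<one>}" using K(1) subgroup.mem_carrier unfolding torsion_def by force
    then show False using j A_cl(3) by blast
  qed
  then obtain l where l: "j = Suc l" by (cases j) auto
  let ?T = "torsion G (p ^ l) K"
  have sT: "subgroup ?T G" using torsion_subgroup[OF K(1) X_comm] .
  have TA: "?T \<subseteq> A" using jl[of l] l by simp
  have sXB: "subgroup (K \<inter> B) G" using subgroups_Inter_pair[OF K(1) B] .
  let ?H = "?T <#> (K \<inter> B)"
  have TX: "?T \<subseteq> K" by (rule torsion_subset)
  have sH: "subgroup ?H G"
    by (rule set_mult_abelian(1)[OF sT sXB]) (use X_comm TX in blast)+
  have HX: "?H \<subseteq> K" using subgroup.m_closed[OF K(1)] TX unfolding set_mult_def by blast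
  \<comment> \<open>Otherwise every a in \<open>A\<close> is u t with u^(p^l) = 1 and t in A
    \<inter> B, and c a is c u times an element of A \<inter> B. The elements of \<open>M\<close>
    that some factor from A \<inter> B turns into p^l-torsion form a subgroup, so they exhaust
    \<open>M\<close>. For w this gives t with w t in \<open>?T\<close>, a subset of
    \<open>A\<close>, so w would lie in \<open>A\<close>.\<close>
  have "?H \<noteq> K"
  proof
    assume H: "?H = K"
    let ?P = "{m \<in> M. \<exists>t\<in>A \<inter> B. (m \<otimes> t) [^] (p ^ l) = \<one>}"
    have "subgroup ?P G"
    proof (rule subgroupI)
      show "?P \<subseteq> carrier G" by auto
      have "\<one> \<in> ?P" by (auto intro!: bexI[of _ \<one>])
      then show "?P \<noteq> {}" by blast
      show "inv m \<in> ?P" if "m \<in> ?P" for m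
      proof -
        obtain t where t: "m \<in> M" "t \<in> A" "t \<in> B" "(m \<otimes> t) [^] (p ^ l) = \<one>" using \<open>m \<in> ?P\<close> by blast
        have "inv m \<otimes> inv t = inv (m \<otimes> t)"
          using t M_CM_commute[OF t(1) AB_CM[OF t(2,3)]] by (simp add: inv_mult_group)
        then have "(inv m \<otimes> inv t) [^] (p ^ l) = \<one>" using t by (simp add: nat_pow_inv)
        then show ?thesis using t by (auto intro!: bexI[of _ "inv t"])
      qed
      show "m \<otimes> m' \<in> ?P" if "m \<in> ?P" "m' \<in> ?P" for m m'
      proof -
        obtain t where t: "m \<in> M" "t \<in> A" "t \<in> B" "(m \<otimes> t) [^] (p ^ l) = \<one>" using \<open>m \<in> ?P\<close> by blast
        obtain t' where t': "m' \<in> M" "t' \<in> A" "t' \<in> B" "(m' \<otimes> t') [^] (p ^ l) = \<one>" using \<open>m' \<in> ?P\<close> by blast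
        note cc = M_CM_commute[OF t(1) AB_CM[OF t'(2,3)]] M_CM_commute[OF t'(1) AB_CM[OF t(2,3)]]
          M_comm[OF t(1) t'(1)] A_comm[OF t(2) t'(2)]
        have e: "(m \<otimes> m') \<otimes> (t \<otimes> t') = (m \<otimes> t) \<otimes> (m' \<otimes> t')"
          using t t' cc by (simp add: commute_shuffle)
        have "(m \<otimes> t) \<otimes> (m' \<otimes> t') = (m' \<otimes> t') \<otimes> (m \<otimes> t)"
          using t t' cc by (simp add: commute_shuffle)
        then have "((m \<otimes> m') \<otimes> (t \<otimes> t')) [^] (p ^ l) = \<one>"
          unfolding e using t t' by (simp add: pow_mult_distrib)
        then show ?thesis using t t' by (auto intro!: bexI[of _ "t \<otimes> t'"])
      qed
    qed
    moreover have "c ` A \<subseteq> ?P"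
    proof (rule image_subsetI)
      fix a assume a: "a \<in> A"
      then obtain u t where ut: "u \<in> ?T" "t \<in> K" "t \<in> B" "a = u \<otimes> t"
        using H K(3) unfolding set_mult_def by blast
      have u: "u \<in> A" "u [^] (p ^ l) = \<one>" using ut(1) TA by (auto simp: torsion_def)
      have "t = inv u \<otimes> a" using ut u by simp
      then have t: "t \<in> A" using u a by simp
      have ct: "c t \<in> A" "c t \<in> B" using comm_A b ut(3) by auto
      have "d u t = \<one>" using M_CM_commute[OF cM[OF u(1)] AB_CM[OF t ut(3)]] u t comm_eq_one_iff[of "c u" t] by simp
      then have ca: "c a = c t \<otimes> c u" using ut(4) c_mult[OF u(1) t] u by simp
      have "c a \<otimes> inv (c t) = c u"
        unfolding ca using M_comm[of "c t" "c u"] t u by (simp add: m_assoc)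
      then have "(c a \<otimes> inv (c t)) [^] (p ^ l) = \<one>" using c_torsion[OF u] odd_p by simp
      then show "c a \<in> ?P" using ct a by (auto intro!: bexI[of _ "inv (c t)"])
    qed
    ultimately have "M \<subseteq> ?P" unfolding M_def[symmetric] using generate_subgroup_incl[of "c ` A" ?P] by (simp add: M_def)
    then obtain t where t: "t \<in> A" "t \<in> B" "(w \<otimes> t) [^] (p ^ l) = \<one>" using NM[OF w(1)] by blast
    have "w \<otimes> t \<in> K" using K t subgroup.m_closed[OF K(1)] by blast
    then have "w \<otimes> t \<in> A" using t TA by (auto simp: torsion_def)
    then have "(w \<otimes> t) \<otimes> inv t \<in> A" using t by simp
    then show False using w wG t by (simp add: m_assoc)
  qed
  then obtain Y where Y: "subgroup Y G" "?H \<subseteq> Y" "Y \<subset> K" "card K = p * card Y"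
    using index_prime_above[OF prime_p K(1) finX X_exp X_comm sH] HX by blast
  have sub: "?T \<subseteq> Y" "K \<inter> B \<subseteq> Y" using set_mult_superset[OF sT sXB] Y(2) by auto
  have p0: "p > 0" using prime_p prime_gt_0_nat by blast
  have finY: "finite Y" using Y finX finite_subset by blast
  have YX: "\<And>u. u \<in> Y \<Longrightarrow> u \<in> K" using Y by blast
  have tors: "card (torsion G (p ^ i) A) \<le> card (torsion G (p ^ i) Y)" for i
  proof (cases "i < j")
    case True
    have "torsion G (p ^ i) A \<subseteq> torsion G (p ^ i) Y"
    proof
      fix u assume u: "u \<in> torsion G (p ^ i) A"
      then have u': "u \<in> K" "u [^] (p ^ i) = \<one>" "u \<in> carrier G" using K(3) AG by (auto simp: torsion_def)
      obtain e where "l = i + e" using True l by (metis less_Suc_eq_le le_iff_add)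
      then have "u [^] (p ^ l) = (u [^] (p ^ i)) [^] (p ^ e)" using u'(3) by (simp add: nat_pow_pow power_add)
      then have "u \<in> ?T" using u' by (simp add: torsion_def)
      then show "u \<in> torsion G (p ^ i) Y" using sub u' by (auto simp: torsion_def)
    qed
    then show ?thesis using finY by (meson card_mono finite_subset torsion_subset)
  next
    case False
    let ?n = "p ^ i"
    have sTA: "subgroup (torsion G ?n A) G" using torsion_subgroup[OF A A_comm] .
    have sTX: "subgroup (torsion G ?n K) G" using torsion_subgroup[OF K(1) X_comm] .
    have fTX: "finite (torsion G ?n K)" using finX finite_subset[OF torsion_subset] by blast
    have AX: "torsion G ?n A \<subseteq> torsion G ?n K" using K(3) by (auto simp: torsion_def)
    obtain u where u: "u \<in> torsion G (p ^ j) K" "u \<notin> A" using j by blast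
    have uX: "u \<in> K" "u [^] (p ^ j) = \<one>" "u \<in> carrier G"
      using u K(1) subgroup.mem_carrier by (auto simp: torsion_def)
    obtain e where "i = j + e" using False by (metis not_less le_iff_add)
    then have "u [^] ?n = (u [^] (p ^ j)) [^] (p ^ e)" using uX(3) by (simp add: nat_pow_pow power_add)
    then have "u \<in> torsion G ?n K" using uX by (simp add: torsion_def)
    then have "torsion G ?n A \<subset> torsion G ?n K" using AX u(2) by (auto simp: torsion_def)
    then have lt: "card (torsion G ?n A) < card (torsion G ?n K)" using fTX by (simp add: psubset_card_mono)
    have dv: "card (torsion G ?n K) dvd p ^ t"
      using card_subgroup_dvd[OF AS(2) finS sTX] XS torsion_subset[of G ?n K] AS(4) by auto
    moreover have "card (torsion G ?n A) dvd p ^ t"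
      using card_subgroup_dvd[OF sTX fTX sTA AX] dv by (rule dvd_trans)
    ultimately have 1: "p * card (torsion G ?n A) \<le> card (torsion G ?n K)"
      using prime_power_less_imp[OF prime_p] lt by blast
    \<comment> \<open>The product formula shows that passing from \<open>K\<close> to
      \<open>Y\<close> costs the torsion at most a factor p.\<close>
    have "card (torsion G ?n K) * card Y = card (torsion G ?n K \<inter> Y) * card (torsion G ?n K <#> Y)"
      by (rule card_set_mult[OF sTX fTX Y(1) finY])
    also have "torsion G ?n K \<inter> Y = torsion G ?n Y" using YX by (auto simp: torsion_def)
    also have "card (torsion G ?n Y) * card (torsion G ?n K <#> Y) \<le> card (torsion G ?n Y) * card K"
    proof (intro mult_le_mono2 card_mono finX)
      show "torsion G ?n K <#> Y \<subseteq> K"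
        using YX subgroup.m_closed[OF K(1)] unfolding set_mult_def torsion_def by blast
    qed
    finally have "card (torsion G ?n K) * card Y \<le> (p * card (torsion G ?n Y)) * card Y"
      unfolding Y(4) by (simp only: ac_simps)
    moreover have "card Y > 0" using subgroup.one_closed[OF Y(1)] finY card_gt_0_iff by blast
    ultimately have "card (torsion G ?n K) \<le> p * card (torsion G ?n Y)" by simp
    with 1 have "p * card (torsion G ?n A) \<le> p * card (torsion G ?n Y)" by linarith
    then show ?thesis using p0 by simp
  qed
  have "Y \<in> abelian_family p n k \<zeta> G S" unfolding abelian_family_def
  proof (intro CollectI conjI ballI)
    show "subgroup Y G" by fact
    show "Y \<subseteq> S" using XS YX by blast
    show "card Y = n" using K(2) Y(4) p0 AS(1) by (simp add: abelian_family_def)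
    show "u \<otimes> v = v \<otimes> u" if "u \<in> Y" "v \<in> Y" for u v using that X_comm YX by blast
    show "u [^] (p ^ k) = \<one>" if u: "u \<in> Y" for u
      using pw[OF YX[OF u], of "p ^ k"] AS(1) odd_p by (simp add: abelian_family_def)
    show "lex_ge (\<lambda>j. int (card (torsion G (p ^ j) Y))) \<zeta>"
    proof (rule lex_ge_mono)
      show "lex_ge (\<lambda>j. int (card (torsion G (p ^ j) A))) \<zeta>" using AS by (simp add: abelian_family_def)
    qed (use tors in simp)
  qed
  moreover have "card (A \<inter> B) < card (Y \<inter> B)"
  proof (rule psubset_card_mono)
    show "finite (Y \<inter> B)" using finY by simp
    have "w \<in> B" using w(1) by simp
    then show "A \<inter> B \<subset> Y \<inter> B" using sub(2) K(3,4) w(2) by blast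
  qed
  moreover have "b \<notin> Y"
  proof
    assume "b \<in> Y"
    then have "b \<otimes> x = x \<otimes> b" using X_comm[of b x] YX K(3) d by blast
    then have "c x = \<one>" using comm_eq_one_iff[of b x] d by simp
    then show False using d by (simp add: comm_def)
  qed
  ultimately show ?thesis by blast
qed

end

end

text \<open>The cubic condition comes from the choice of b: among the elements x of \<open>B\<close>
  with some [[x, a], a'] nontrivial, one of least level in the upper central series of
  \<open>S\<close>. A nontrivial commutator of b with an element of \<open>A\<close> has smaller
  level, so it no longer has this property.\<close>

lemma (in group) replacement:
  assumes p: "Factorial_Ring.prime p" "odd p"
    and S: "subgroup S G" "card S = p ^ t"
    and A: "A \<in> abelian_family p n k \<zeta> G S"
    and B: "subgroup B G" "B \<subseteq> S" "\<And>a x. a \<in> A \<Longrightarrow> x \<in> B \<Longrightarrow> conjug a x \<in> B"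
    and BA: "\<And>x y. x \<in> B \<Longrightarrow> y \<in> B \<Longrightarrow> comm x y \<in> A"
    and BZ: "\<And>x y z. x \<in> B \<Longrightarrow> y \<in> B \<Longrightarrow> z \<in> B \<Longrightarrow> comm x y \<otimes> z = z \<otimes> comm x y"
    and nq: "b\<^sub>0 \<in> B" "a\<^sub>0 \<in> A" "a\<^sub>1 \<in> A" "comm (comm b\<^sub>0 a\<^sub>0) a\<^sub>1 \<noteq> \<one>"
  obtains A' where "A' \<in> abelian_family p n k \<zeta> G S" "card (A \<inter> B) < card (A' \<inter> B)" "\<not> B \<subseteq> A'"
proof -
  have A': "subgroup A G" "A \<subseteq> S" "\<And>x y. x \<in> A \<Longrightarrow> y \<in> A \<Longrightarrow> x \<otimes> y = y \<otimes> x"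
    using A by (auto simp: abelian_family_def)
  have AG: "\<And>x. x \<in> A \<Longrightarrow> x \<in> carrier G" and BG: "\<And>x. x \<in> B \<Longrightarrow> x \<in> carrier G"
    using A'(1) B(1) subgroup.subset by blast+
  have finS: "finite S" using S(2) p by (metis card.infinite not_prime_0 power_eq_0_iff)
  obtain l :: "'a \<Rightarrow> nat" where l: "\<And>x s. x \<in> S \<Longrightarrow> s \<in> S \<Longrightarrow> comm x s \<noteq> \<one> \<Longrightarrow> l (comm x s) < l x"
    using p_group_comm_decreasing[OF p(1) S] by blast
  define P where "P x \<longleftrightarrow> x \<in> B \<and> (\<exists>a\<in>A. \<exists>a'\<in>A. comm (comm x a) a' \<noteq> \<one>)" for x
  have "P b\<^sub>0" unfolding P_def using nq by blast
  then obtain b where bP: "P b" "\<And>x. P x \<Longrightarrow> l b \<le> l x"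
    using exists_least_iff[of "\<lambda>m. \<exists>x. P x \<and> l x = m"] by (metis not_less)
  have bB: "b \<in> B" using bP(1) unfolding P_def by blast
  have cubic: "comm (comm (comm b x) y) z = \<one>" if xyz: "x \<in> A" "y \<in> A" "z \<in> A" for x y z
  proof (rule ccontr)
    assume ne: "comm (comm (comm b x) y) z \<noteq> \<one>"
    have "comm b x = inv b \<otimes> conjug (inv x) b" using xyz AG BG bB by (simp add: word_simps)
    then have "comm b x \<in> B" using B xyz bB A'(1) by (simp add: subgroup.m_closed subgroup.m_inv_closed)
    then have "P (comm b x)" unfolding P_def using ne xyz by blast
    moreover have "comm b x \<noteq> \<one>" using ne xyz AG by (auto simp: comm_def)
    ultimately show False using bP(2)[of "comm b x"] l[of b x] bB B(2) A'(2) xyz by fastforce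
  qed
  have A_exp: "x [^] (p ^ t) = \<one>" if "x \<in> A" for x
    using pow_card_subgroup[OF S(1), of x] S(2) A'(2) that by auto
  note AS = A and BS = B(2)
  interpret cubic_commutators G A B b p t
    by (intro cubic_commutators.intro cubic_commutators_axioms.intro group_axioms p A'(1,3) B(1,3) BA BZ bB cubic A_exp)
  obtain x y where xy: "x \<in> A" "y \<in> A" "comm (comm b x) y \<noteq> \<one>" using bP(1) unfolding P_def by blast
  have fin: "finite A" "finite B" using finS A'(2) BS finite_subset by blast+
  have "\<exists>A'\<in>abelian_family p n k \<zeta> G S. card (A \<inter> B) < card (A' \<inter> B) \<and> b \<notin> A'"
    using replacement_M[OF fin _ xy AS S(1) BS] replacement_adjoin[OF fin _ _ xy AS S(1) BS S(2)] by blast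
  then show thesis using that bB by blast
qed

section \<open>Normal \<open>p\<close>-subgroups and \<open>p\<close>-stability\<close>

lemma torsion_image:
  assumes "group G" "group H" "f \<in> mon G H" "A \<subseteq> carrier G"
  shows "torsion H n (f ` A) = f ` torsion G n A"
proof -
  interpret f: group_hom G H f
    using assms by (simp add: group_hom_def group_hom_axioms_def mon_def)
  have inj: "inj_on f (carrier G)" using assms by (simp add: mon_def)
  have "f x [^]\<^bsub>H\<^esub> n = \<one>\<^bsub>H\<^esub> \<longleftrightarrow> x [^]\<^bsub>G\<^esub> n = \<one>\<^bsub>G\<^esub>" if "x \<in> A" for x
  proof -
    have x: "x \<in> carrier G" using that assms by blast
    have "f x [^]\<^bsub>H\<^esub> n = f (x [^]\<^bsub>G\<^esub> n)" using x by (simp add: f.hom_nat_pow)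
    then show ?thesis using inj_on_eq_iff[OF inj, of "x [^]\<^bsub>G\<^esub> n" "\<one>\<^bsub>G\<^esub>"] x by simp
  qed
  then show ?thesis unfolding torsion_def by blast
qed

lemma abelian_family_image:
  assumes "group G" "group H" and f: "f \<in> mon G H" and Y: "Y \<subseteq> carrier G"
  shows "abelian_family p N k \<zeta> H (f ` Y) = (`) f ` abelian_family p N k \<zeta> G Y"
proof -
  interpret f: group_hom G H f
    using assms by (simp add: group_hom_def group_hom_axioms_def mon_def)
  have inj: "inj_on f (carrier G)" using assms by (simp add: mon_def)
  have iff: "f ` A \<in> abelian_family p N k \<zeta> H (f ` Y) \<longleftrightarrow> A \<in> abelian_family p N k \<zeta> G Y"
    if A: "subgroup A G" for A
  proof -
    have AG: "A \<subseteq> carrier G" using A subgroup.subset by blast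
    have 1: "subgroup (f ` A) H" using f.subgroup_img_is_subgroup[OF A] .
    have 2: "f ` A \<subseteq> f ` Y \<longleftrightarrow> A \<subseteq> Y"
      using inj AG Y unfolding inj_on_def by blast
    have 3: "f x \<otimes>\<^bsub>H\<^esub> f y = f y \<otimes>\<^bsub>H\<^esub> f x \<longleftrightarrow> x \<otimes>\<^bsub>G\<^esub> y = y \<otimes>\<^bsub>G\<^esub> x" if "x \<in> A" "y \<in> A" for x y
    proof -
      have xy: "x \<in> carrier G" "y \<in> carrier G" using that AG by auto
      then show ?thesis using inj_on_eq_iff[OF inj, of "x \<otimes>\<^bsub>G\<^esub> y" "y \<otimes>\<^bsub>G\<^esub> x"] by simp
    qed
    have 4: "card (f ` A) = card A" using card_image[OF inj_on_subset[OF inj AG]] .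
    have 5: "f x [^]\<^bsub>H\<^esub> n = \<one>\<^bsub>H\<^esub> \<longleftrightarrow> x [^]\<^bsub>G\<^esub> n = \<one>\<^bsub>G\<^esub>" if "x \<in> A" for x and n :: nat
    proof -
      have x: "x \<in> carrier G" using that AG by blast
      have "f x [^]\<^bsub>H\<^esub> n = f (x [^]\<^bsub>G\<^esub> n)" using x by (simp add: f.hom_nat_pow)
      then show ?thesis using inj_on_eq_iff[OF inj, of "x [^]\<^bsub>G\<^esub> n" "\<one>\<^bsub>G\<^esub>"] x by simp
    qed
    have 6: "card (torsion H n (f ` A)) = card (torsion G n A)" for n
    proof -
      have "torsion G n A \<subseteq> carrier G" using torsion_subset AG by (rule subset_trans)
      then have "inj_on f (torsion G n A)" by (rule inj_on_subset[OF inj])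
      then show ?thesis using torsion_image[OF assms(1,2) f AG] by (simp add: card_image)
    qed
    have 7: "(\<forall>x\<in>f ` A. \<forall>y\<in>f ` A. x \<otimes>\<^bsub>H\<^esub> y = y \<otimes>\<^bsub>H\<^esub> x) \<longleftrightarrow> (\<forall>x\<in>A. \<forall>y\<in>A. x \<otimes>\<^bsub>G\<^esub> y = y \<otimes>\<^bsub>G\<^esub> x)"
      using 3 by blast
    have 8: "(\<forall>x\<in>f ` A. x [^]\<^bsub>H\<^esub> n = \<one>\<^bsub>H\<^esub>) \<longleftrightarrow> (\<forall>x\<in>A. x [^]\<^bsub>G\<^esub> n = \<one>\<^bsub>G\<^esub>)" for n :: nat
      using 5 by blast
    show ?thesis unfolding abelian_family_def mem_Collect_eq 2 4 6 7 8 using 1 A by blast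
  qed
  show ?thesis
  proof (intro equalityI subsetI)
    fix A' assume A': "A' \<in> abelian_family p N k \<zeta> H (f ` Y)"
    then have sub: "subgroup A' H" "A' \<subseteq> f ` Y" unfolding abelian_family_def by auto
    define A where "A = {x \<in> carrier G. f x \<in> A'}"
    have "subgroup A G"
    proof (rule group.subgroupI[OF assms(1)])
      have "\<one>\<^bsub>G\<^esub> \<in> A" unfolding A_def using subgroup.one_closed[OF sub(1)] by simp
      then show "A \<noteq> {}" by blast
    qed (auto simp: A_def subgroup.m_closed[OF sub(1)] subgroup.m_inv_closed[OF sub(1)])
    moreover have "A' = f ` A" using sub Y unfolding A_def by blast
    ultimately show "A' \<in> (`) f ` abelian_family p N k \<zeta> G Y" using iff A' by blast
  next
    fix A' assume "A' \<in> (`) f ` abelian_family p N k \<zeta> G Y"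
    then obtain A where A: "A \<in> abelian_family p N k \<zeta> G Y" "A' = f ` A" by blast
    then have "subgroup A G" by (simp add: abelian_family_def)
    then show "A' \<in> abelian_family p N k \<zeta> H (f ` Y)" using iff A by simp
  qed
qed

text \<open>An empty family yields the trivial subgroup, which is why several facts below split off
  that case.\<close>

definition family_core ::
    "nat \<Rightarrow> nat \<Rightarrow> nat \<Rightarrow> (nat \<Rightarrow> int) \<Rightarrow> ('a, 'm) monoid_scheme \<Rightarrow> 'a set \<Rightarrow> 'a set" where
  "family_core p N k \<zeta> G Y = I_int G (abelian_family p N k \<zeta> G Y)"

lemma family_core_image:
  assumes "group G" "group H" and f: "f \<in> mon G H" and Y: "Y \<subseteq> carrier G"
  shows "family_core p N k \<zeta> H (f ` Y) = f ` family_core p N k \<zeta> G Y"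
proof -
  interpret f: group_hom G H f
    using assms by (simp add: group_hom_def group_hom_axioms_def mon_def)
  have inj: "inj_on f (carrier G)" using assms by (simp add: mon_def)
  let ?F = "abelian_family p N k \<zeta> G Y"
  have sub: "\<forall>A\<in>?F. A \<subseteq> carrier G" using subgroup.subset unfolding abelian_family_def by auto
  show ?thesis
  proof (cases "?F = {}")
    case True
    then show ?thesis unfolding family_core_def abelian_family_image[OF assms] by (simp add: I_int_def)
  next
    case False
    have "\<Inter> ((`) f ` ?F) = f ` \<Inter> ?F"
    proof -
      obtain A where "A \<in> ?F" using False by blast
      then have "f ` \<Inter> ?F = (\<Inter>A\<in>?F. f ` A)" using image_INT[OF inj sub, of A] by simp
      then show ?thesis by simp
    qed
    then show ?thesis unfolding family_core_def abelian_family_image[OF assms] by (simp add: I_int_def False)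
  qed
qed

context group
begin

lemma conj_mon: "g \<in> carrier G \<Longrightarrow> conjug g \<in> mon G G"
  using inj_on_conj[of g "carrier G"] by (simp add: mon_def hom_def conj_mult)

lemma family_core_subgroup: "subgroup (family_core p N k \<zeta> G Y) G"
  unfolding family_core_def I_int_def
  using triv_subgroup subgroups_Inter[of "abelian_family p N k \<zeta> G Y"]
  by (simp add: abelian_family_def)

lemma family_core_le: "A \<in> abelian_family p N k \<zeta> G Y \<Longrightarrow> family_core p N k \<zeta> G Y \<subseteq> A"
  unfolding family_core_def I_int_def by auto

lemma family_core_le':
  assumes "subgroup Y G" shows "family_core p N k \<zeta> G Y \<subseteq> Y"
proof (cases "abelian_family p N k \<zeta> G Y = {}")
  case True then show ?thesis unfolding family_core_def I_int_def using assms by (simp add: subgroup.one_closed)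
next
  case False then show ?thesis using family_core_le unfolding abelian_family_def by blast
qed

lemma family_core_commute:
  assumes "x \<in> family_core p N k \<zeta> G Y" "y \<in> family_core p N k \<zeta> G Y" shows "x \<otimes> y = y \<otimes> x"
proof (cases "abelian_family p N k \<zeta> G Y = {}")
  case True then show ?thesis using assms unfolding family_core_def I_int_def by simp
next
  case False
  then obtain A where A: "A \<in> abelian_family p N k \<zeta> G Y" by blast
  then have "x \<in> A" "y \<in> A" using assms family_core_le by blast+
  then show ?thesis using A unfolding abelian_family_def by blast
qed

lemma family_core_conj:
  assumes "g \<in> carrier G" "Y \<subseteq> carrier G"
  shows "family_core p N k \<zeta> G (conjug g ` Y) = conjug g ` family_core p N k \<zeta> G Y"
  using family_core_image[OF group_axioms group_axioms conj_mon[OF assms(1)] assms(2)] .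

lemma family_core_conj_closed:
  assumes "g \<in> carrier G" "Y \<subseteq> carrier G" "conjug g ` Y = Y" "x \<in> family_core p N k \<zeta> G Y"
  shows "conjug g x \<in> family_core p N k \<zeta> G Y"
  using family_core_conj[OF assms(1,2), of p N k \<zeta>] assms(3,4) by auto

lemma conj_image_subgroup:
  assumes "subgroup Y G" "g \<in> Y" shows "conjug g ` Y = Y"
proof
  show "conjug g ` Y \<subseteq> Y" using subgroup_conj assms by blast
  show "Y \<subseteq> conjug g ` Y"
  proof
    fix y assume y: "y \<in> Y"
    have "y = conjug g (conjug (inv g) y)" using y assms subgroup.mem_carrier by force
    moreover have "conjug (inv g) y \<in> Y" using subgroup_conj assms y by (simp add: subgroup.m_inv_closed)
    ultimately show "y \<in> conjug g ` Y" by blast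
  qed
qed

section \<open>O_p(G), centralizers and p-stable conjugation\<close>

lemma normal_conj: "H \<lhd> G \<Longrightarrow> g \<in> carrier G \<Longrightarrow> x \<in> H \<Longrightarrow> conjug g x \<in> H"
  using normal.inv_op_closed2 unfolding conjug_def by fastforce

lemma normal_conjI: "subgroup H G \<Longrightarrow> (\<And>g x. g \<in> carrier G \<Longrightarrow> x \<in> H \<Longrightarrow> conjug g x \<in> H) \<Longrightarrow> H \<lhd> G"
  unfolding conjug_def by (rule normal_invI) auto

lemma p_group_subgroup_iff: "subgroup H G \<Longrightarrow> p_group p (G \<restriction>\<^sub>g H) \<longleftrightarrow> (\<exists>n. card H = p ^ n)"
  unfolding p_group_def order_def using subgroup_imp_group by simp

text \<open>As \<open>O_p\<close> is a \<open>GREATEST\<close> for inclusion, a greatest normal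
  p-subgroup has to be exhibited: a maximal one absorbs all others, the product of two normal
  p-subgroups being again one.\<close>

lemma O_p_greatest:
  assumes p: "Factorial_Ring.prime p" and fin: "finite (carrier G)"
  shows "O_p p G \<lhd> G" "\<exists>n. card (O_p p G) = p ^ n"
    "\<And>N n. N \<lhd> G \<Longrightarrow> card N = p ^ n \<Longrightarrow> N \<subseteq> O_p p G"
proof -
  define C where "C = {N. N \<lhd> G \<and> (\<exists>n. card N = p ^ n)}"
  have ns: "subgroup N G" if "N \<lhd> G" for N using that normal_imp_subgroup by blast
  have "C \<subseteq> Pow (carrier G)" unfolding C_def using ns subgroup.subset by blast
  then have "finite C" using fin by (simp add: finite_subset)
  moreover have "{\<one>} \<in> C" unfolding C_def using one_is_normal by (auto intro: exI[of _ 0])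
  ultimately obtain N where N: "N \<in> C" "\<And>M. M \<in> C \<Longrightarrow> N \<subseteq> M \<Longrightarrow> N = M"
    using finite_has_maximal[of C] by blast
  have le: "M \<subseteq> N" if M: "M \<in> C" for M
  proof -
    have nN: "N \<lhd> G" and nM: "M \<lhd> G" using N(1) M unfolding C_def by auto
    have sN: "subgroup N G" and sM: "subgroup M G" using ns nN nM by auto
    have NG: "\<And>x. x \<in> N \<Longrightarrow> x \<in> carrier G" and MG: "\<And>x. x \<in> M \<Longrightarrow> x \<in> carrier G"
      using sN sM subgroup.subset by blast+
    have sNM: "subgroup (N <#> M) G" using set_mult_subgroup[OF sN sM] normal_conj[OF nN] MG by blast
    have "N <#> M \<lhd> G"
    proof (rule normal_conjI[OF sNM])
      fix g x assume g: "g \<in> carrier G" and "x \<in> N <#> M"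
      then obtain u v where uv: "u \<in> N" "v \<in> M" "x = u \<otimes> v" unfolding set_mult_def by blast
      then have "conjug g x = conjug g u \<otimes> conjug g v" using g NG MG conj_mult by simp
      then show "conjug g x \<in> N <#> M"
        using normal_conj[OF nN g uv(1)] normal_conj[OF nM g uv(2)] unfolding set_mult_def by blast
    qed
    moreover have "\<exists>n. card (N <#> M) = p ^ n"
    proof -
      obtain i j where "card N = p ^ i" "card M = p ^ j" using N(1) M unfolding C_def by blast
      moreover have "finite N" "finite M"
        using finite_subset[OF subgroup.subset fin] sN sM by blast+
      ultimately have "card (N <#> M) dvd p ^ (i + j)"
        using card_set_mult[OF sN _ sM] by (metis dvd_triv_right power_add)
      then show ?thesis using divides_primepow_nat[OF p] by blast
    qed
    ultimately have "N <#> M \<in> C" unfolding C_def by blast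
    then have "N = N <#> M" using N(2) set_mult_superset(1)[OF sN sM] by blast
    then show ?thesis using set_mult_superset(2)[OF sN sM] by blast
  qed
  have iff: "M \<lhd> G \<and> p_group p (G \<restriction>\<^sub>g M) \<longleftrightarrow> M \<in> C" for M
    unfolding C_def using p_group_subgroup_iff ns by blast
  have "O_p p G = N" unfolding O_p_def iff
    by (rule Greatest_equality) (use N le in auto)
  then show "O_p p G \<lhd> G" "\<exists>n. card (O_p p G) = p ^ n"
    "\<And>M n. M \<lhd> G \<Longrightarrow> card M = p ^ n \<Longrightarrow> M \<subseteq> O_p p G"
    using N(1) le unfolding C_def by auto
qed

lemma act_kernel_conj:
  assumes "B \<subseteq> carrier G" shows "act_kernel G (G \<restriction>\<^sub>g B) (conj_act G B) = centralizer G B"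
proof -
  have "conj_act G B g w = w \<longleftrightarrow> g \<otimes> w = w \<otimes> g" if "g \<in> carrier G" "w \<in> B" for g w
    using that assms conj_eq_iff[of g w] unfolding conj_act_def conjug_def by auto
  then show ?thesis unfolding act_kernel_def centralizer_def by auto
qed

lemma centralizer_normal:
  assumes B: "B \<lhd> G" shows "centralizer G B \<lhd> G"
proof -
  have BG: "\<And>x. x \<in> B \<Longrightarrow> x \<in> carrier G" using B normal_imp_subgroup subgroup.subset by blast
  have iff: "x \<in> centralizer G B \<longleftrightarrow> x \<in> carrier G \<and> (\<forall>w\<in>B. conjug x w = w)" for x
    unfolding centralizer_def using BG conj_eq_iff[of x] by auto
  have sub: "subgroup (centralizer G B) G"
  proof (rule subgroupI)
    show "centralizer G B \<subseteq> carrier G" unfolding iff[abs_def] using iff by blast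
    have "\<one> \<in> centralizer G B" unfolding iff using BG by simp
    then show "centralizer G B \<noteq> {}" by blast
    show "inv a \<in> centralizer G B" if "a \<in> centralizer G B" for a
    proof -
      have a: "a \<in> carrier G" "\<And>w. w \<in> B \<Longrightarrow> conjug a w = w" using that unfolding iff by auto
      have "conjug (inv a) w = w" if w: "w \<in> B" for w
        using conj_inv_conj(2)[OF a(1) BG[OF w]] a(2)[OF w] by simp
      then show ?thesis unfolding iff using a(1) by simp
    qed
    show "a \<otimes> b \<in> centralizer G B" if "a \<in> centralizer G B" "b \<in> centralizer G B" for a b
      using that BG unfolding iff by (simp flip: conj_conj)
  qed
  show ?thesis
  proof (rule normal_conjI[OF sub])
    fix g x assume g: "g \<in> carrier G" and x: "x \<in> centralizer G B"
    have xG: "x \<in> carrier G" using x iff by blast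
    have "conjug (conjug g x) w = w" if w: "w \<in> B" for w
    proof -
      have "conjug (conjug g x) w = conjug g (conjug x (conjug (inv g) w))"
        using g xG BG[OF w] by (simp add: word_simps)
      also have "conjug x (conjug (inv g) w) = conjug (inv g) w"
        using x iff normal_conj[OF B _ w, of "inv g"] g by simp
      finally show ?thesis using g BG[OF w] by simp
    qed
    then show "conjug g x \<in> centralizer G B" unfolding iff using g xG by simp
  qed
qed

text \<open>\<open>K\<close> is the preimage of O_p(G/C). The last claim says that K/C is a p-group,
  in the form in which the Frattini argument uses it.\<close>

lemma O_p_act_conj:
  assumes p: "Factorial_Ring.prime p" and fin: "finite (carrier G)" and B: "B \<lhd> G"
  defines "K \<equiv> O_p_act p G (G \<restriction>\<^sub>g B) (conj_act G B)" and "C \<equiv> centralizer G B"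
  shows "K \<lhd> G" "C \<subseteq> K" "\<exists>r. card K = card C * p ^ r"
proof -
  have BG: "B \<subseteq> carrier G" using B normal_imp_subgroup subgroup.subset by blast
  have C: "C \<lhd> G" unfolding C_def by (rule centralizer_normal[OF B])
  then interpret C: normal C G .
  have sC: "subgroup C G" by (rule normal_imp_subgroup[OF C])
  let ?Q = "G Mod C"
  interpret Q: group ?Q by (rule C.factorgroup_is_group)
  define \<pi> where "\<pi> g = C #> g" for g
  interpret pi: group_hom G ?Q \<pi>
    unfolding \<pi>_def by (intro group_hom.intro group_hom_axioms.intro group_axioms Q.group_axioms C.r_coset_hom_Mod)
  have finQ: "finite (carrier ?Q)" using fin by (simp add: FactGroup_def RCOSETS_def)
  define R where "R = O_p p ?Q"
  have R: "R \<lhd> ?Q" "\<exists>n. card R = p ^ n" using Q.O_p_greatest[OF p finQ] unfolding R_def by auto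
  have sO: "subgroup R ?Q" by (rule normal_imp_subgroup[OF R(1)])
  have K: "K = {g \<in> carrier G. \<pi> g \<in> R}"
    unfolding K_def O_p_act_def act_kernel_conj[OF BG] \<pi>_def R_def C_def by simp
  have sK: "subgroup K G" unfolding K
  proof (rule subgroupI)
    have "\<one> \<in> {g \<in> carrier G. \<pi> g \<in> R}" using subgroup.one_closed[OF sO] by simp
    then show "{g \<in> carrier G. \<pi> g \<in> R} \<noteq> {}" by blast
  qed (auto simp: subgroup.m_closed[OF sO, simplified] subgroup.m_inv_closed[OF sO])
  show "K \<lhd> G"
  proof (rule normal_conjI[OF sK])
    fix g x assume g: "g \<in> carrier G" and x: "x \<in> K"
    have "\<pi> g \<otimes>\<^bsub>?Q\<^esub> \<pi> x \<otimes>\<^bsub>?Q\<^esub> inv\<^bsub>?Q\<^esub> \<pi> g \<in> R"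
      using normal.inv_op_closed2[OF R(1), of "\<pi> g" "\<pi> x"] g x unfolding K by simp
    then have "\<pi> (conjug g x) \<in> R" using g x unfolding K conjug_def by simp
    then show "conjug g x \<in> K" using g x unfolding K by simp
  qed
  show CK: "C \<subseteq> K"
  proof
    fix x assume x: "x \<in> C"
    then have "\<pi> x = C" unfolding \<pi>_def using coset_join2[OF _ sC x] C.subset by blast
    moreover have "C \<in> R" using subgroup.one_closed[OF sO] by (simp add: FactGroup_def)
    ultimately show "x \<in> K" unfolding K using x C.subset by auto
  qed
  have finK: "finite K" unfolding K using fin by simp
  have "card K = card C * card (\<pi> ` K)"
  proof (rule card_subgroup_fibers[OF sK finK sC CK])
    fix x y assume xy: "x \<in> K" "y \<in> K"
    then have "x \<in> carrier G" "y \<in> carrier G" unfolding K by auto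
    then show "\<pi> x = \<pi> y \<longleftrightarrow> inv x \<otimes> y \<in> C"
      unfolding \<pi>_def using l_coset_eq_iff[OF sC] C.coset_eq by auto
  qed
  also have "\<pi> ` K = R"
  proof -
    have "R \<subseteq> carrier ?Q" using sO subgroup.subset by blast
    then have "R \<subseteq> \<pi> ` carrier G" unfolding \<pi>_def FactGroup_def RCOSETS_def by auto
    then show ?thesis unfolding K by blast
  qed
  finally show "\<exists>r. card K = card C * p ^ r" using R(2) by auto
qed

text \<open>Quadratic action is defined through the subgroup generated by the commutators [w, x]; x
  centralizes it as soon as it centralizes these generators, so p-stability can be applied
  elementwise.\<close>

lemma quadratic_in_O_p_act:
  assumes B: "B \<lhd> G" and st: "p_stable p G (G \<restriction>\<^sub>g B) (conj_act G B)"
    and x: "x \<in> carrier G" and q: "\<And>w. w \<in> B \<Longrightarrow> comm (comm w x) x = \<one>"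
  shows "x \<in> O_p_act p G (G \<restriction>\<^sub>g B) (conj_act G B)"
proof -
  have sB: "subgroup B G" using B normal_imp_subgroup by blast
  have BG: "\<And>w. w \<in> B \<Longrightarrow> w \<in> carrier G" using sB subgroup.subset by blast
  have cB: "comm w x \<in> B" if "w \<in> B" for w
  proof -
    have "comm w x = inv w \<otimes> conjug (inv x) w" using that BG x by (simp add: word_simps)
    then show ?thesis using that normal_conj[OF B, of "inv x" w] x sB by (simp add: subgroup.m_closed subgroup.m_inv_closed)
  qed
  have gen: "act_commutator G (G \<restriction>\<^sub>g B) (conj_act G B) U x = generate G {comm w x | w. w \<in> U}" if U: "U \<subseteq> B" for U
  proof -
    have "inv\<^bsub>G \<restriction>\<^sub>g B\<^esub> w \<otimes>\<^bsub>G \<restriction>\<^sub>g B\<^esub> conj_act G B (inv x) w = comm w x" if "w \<in> U" for w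
    proof -
      have "w \<in> B" using that U by blast
      then show ?thesis using BG x m_inv_consistent[OF sB] by (simp add: conj_act_def word_simps)
    qed
    then have "{inv\<^bsub>G \<restriction>\<^sub>g B\<^esub> w \<otimes>\<^bsub>G \<restriction>\<^sub>g B\<^esub> conj_act G B (inv x) w | w. w \<in> U} = {comm w x | w. w \<in> U}"
      by (metis (no_types, lifting))
    moreover have "{comm w x | w. w \<in> U} \<subseteq> B" using cB U by blast
    ultimately show ?thesis unfolding act_commutator_def using generate_consistent[OF _ sB] by simp
  qed
  let ?U = "generate G {comm w x | w. w \<in> B}"
  have sub: "{comm w x | w. w \<in> B} \<subseteq> B" using cB by blast
  have UB: "?U \<subseteq> B" using generate_subgroup_incl[OF sub sB] .
  have "comm u x = \<one>" if u: "u \<in> ?U" for u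
  proof -
    have "x \<otimes> u = u \<otimes> x"
    proof (rule generate_commute[OF _ x _ u])
      show "{comm w x | w. w \<in> B} \<subseteq> carrier G" using sub BG by blast
      fix a assume "a \<in> {comm w x | w. w \<in> B}"
      then obtain w where w: "w \<in> B" "a = comm w x" by blast
      then have "comm a x = \<one>" "a \<in> carrier G" using q[OF w(1)] BG[OF w(1)] x by simp_all
      then have "a \<otimes> x = x \<otimes> a" using comm_eq_one_iff[of a x] x by blast
      then show "x \<otimes> a = a \<otimes> x" by (rule sym)
    qed
    then have "u \<otimes> x = x \<otimes> u" by (rule sym)
    moreover have "u \<in> carrier G" using u UB BG by blast
    ultimately show ?thesis using comm_eq_one_iff[of u x] x by blast
  qed
  moreover have "\<one> \<in> ?U" by (rule generate.one)
  ultimately have "{comm w x | w. w \<in> ?U} = {\<one>}" by (intro equalityI subsetI) (force, metis (mono_tags, lifting) mem_Collect_eq singletonD)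
  then have "act_commutator G (G \<restriction>\<^sub>g B) (conj_act G B) ?U x = {\<one>}" using gen[OF UB] generate_one by simp
  moreover have "act_commutator G (G \<restriction>\<^sub>g B) (conj_act G B) (carrier (G \<restriction>\<^sub>g B)) x = ?U" using gen[of B] by simp
  ultimately have "acts_quadratically G (G \<restriction>\<^sub>g B) (conj_act G B) x" unfolding acts_quadratically_def by simp
  then show ?thesis using st x unfolding p_stable_def by blast
qed

end

section \<open>The Glauberman property\<close>

context group
begin

text \<open>The order of K S is |K : S \<inter> K| times |S| and divides |G|, so a factor p in the
  index would exceed the p-part of |G|.\<close>

lemma sylow_inter_normal:
  assumes p: "Factorial_Ring.prime p" and fin: "finite (carrier G)"
    and S: "sylow_subgroup p G S" and K: "K \<lhd> G"
  shows "\<not> p dvd card K div card (S \<inter> K)"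
proof
  have sS: "subgroup S G" and cS: "card S = p ^ multiplicity p (order G)"
    using S by (auto simp: sylow_subgroup_def)
  have sK: "subgroup K G" by (rule normal_imp_subgroup[OF K])
  have f: "finite S" "finite K" using finite_subset[OF subgroup.subset fin] sS sK by blast+
  have sSK: "subgroup (S \<inter> K) G" by (rule subgroups_Inter_pair[OF sS sK])
  assume dv: "p dvd card K div card (S \<inter> K)"
  have SG: "S \<subseteq> carrier G" using sS subgroup.subset by blast
  have sKS: "subgroup (K <#> S) G"
    using set_mult_subgroup[OF sK sS] normal_conj[OF K] SG by blast
  have "card (S \<inter> K) dvd card K" by (rule card_subgroup_dvd[OF sK f(2) sSK]) simp
  then obtain r where r: "card K = card (S \<inter> K) * r" by blast
  have pos: "card (S \<inter> K) > 0" using subgroup.one_closed[OF sSK] f card_gt_0_iff by blast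
  have "card (S \<inter> K) * (r * card S) = card (S \<inter> K) * card (K <#> S)"
    using card_set_mult[OF sK f(2) sS f(1)] r by (simp add: Int_commute ac_simps)
  then have "r * card S = card (K <#> S)" using pos by simp
  moreover have "card (K <#> S) dvd order G"
    unfolding order_def by (rule card_subgroup_dvd[OF subgroup_self fin sKS]) (rule subgroup.subset[OF sKS])
  moreover have "p dvd r" using dv r pos by simp
  ultimately have "p * p ^ multiplicity p (order G) dvd order G"
    using cS by (metis dvd_trans mult_dvd_mono dvd_refl)
  then have "p ^ Suc (multiplicity p (order G)) dvd order G" by simp
  moreover have "order G \<noteq> 0" using fin unfolding order_def by (simp add: card_eq_0_iff) (use one_closed in blast)
  ultimately show False using p power_dvd_iff_le_multiplicity[of "order G" p]
    by (metis Suc_n_not_le_n not_prime_unit)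
qed

text \<open>Frattini's argument for Q = S \<inter> K. As K/C is a p-group, K = C Q, and the element
  of \<open>K\<close> relating Q to its conjugate by g is c q with q in Q; the factor q normalizes Q
  and is absorbed, so G = C N_G(Q).\<close>

lemma frattini_mod:
  assumes p: "Factorial_Ring.prime p" and fin: "finite (carrier G)"
    and S: "sylow_subgroup p G S" and K: "K \<lhd> G" and C: "C \<lhd> G" "C \<subseteq> K" "card K = card C * p ^ r"
    and g: "g \<in> carrier G"
  obtains c n where "c \<in> C" "n \<in> carrier G" "g = c \<otimes> n" "conjug n ` (S \<inter> K) = S \<inter> K"
proof -
  let ?Q = "S \<inter> K"
  have sS: "subgroup S G" and cS: "card S = p ^ multiplicity p (order G)"
    using S by (auto simp: sylow_subgroup_def)
  have sK: "subgroup K G" and sC: "subgroup C G" by (auto intro: normal_imp_subgroup K C)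
  have sQ: "subgroup ?Q G" by (rule subgroups_Inter_pair[OF sS sK])
  have f: "finite S" "finite K" "finite C" using finite_subset[OF subgroup.subset fin] sS sK sC by blast+
  have fQ: "finite ?Q" using f by simp
  have QG: "?Q \<subseteq> carrier G" and KG: "K \<subseteq> carrier G" and CG: "C \<subseteq> carrier G"
    using sQ sK sC subgroup.subset by blast+
  have idx: "\<not> p dvd card K div card ?Q" by (rule sylow_inter_normal[OF p fin S K])
  have sCQ: "subgroup (C <#> ?Q) G" using set_mult_subgroup[OF sC sQ] normal_conj[OF C(1)] QG by blast
  have CQK: "C <#> ?Q \<subseteq> K" using C(2) subgroup.m_closed[OF sK] unfolding set_mult_def by blast
  have fCQ: "finite (C <#> ?Q)" using finite_subset[OF CQK f(2)] .
  have pos: "card ?Q > 0" "card C > 0" "card (C <#> ?Q) > 0"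
    using subgroup.one_closed[OF sQ] subgroup.one_closed[OF sC] subgroup.one_closed[OF sCQ] f fQ fCQ card_gt_0_iff by blast+
  have "C <#> ?Q = K"
  proof -
    \<comment> \<open>The index t of C Q in \<open>K\<close> divides |K : C| = p^r and also the
      index of Q, which is prime to p; hence t = 1.\<close>
    obtain t where t: "card K = card (C <#> ?Q) * t" using card_subgroup_dvd[OF sK f(2) sCQ CQK] by blast
    obtain u where u: "card (C <#> ?Q) = card C * u"
      using card_subgroup_dvd[OF sCQ fCQ sC set_mult_superset(1)[OF sC sQ]] by blast
    obtain v where v: "card (C <#> ?Q) = card ?Q * v"
      using card_subgroup_dvd[OF sCQ fCQ sQ set_mult_superset(2)[OF sC sQ]] by blast
    have "p ^ r = u * t" using t u C(3) pos by simp
    then have tp: "t dvd p ^ r" by simp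
    have "card K div card ?Q = v * t" using t v pos by simp
    then have "\<not> p dvd t" using idx by auto
    obtain i where i: "t = p ^ i" using divides_primepow_nat[OF p] tp by blast
    then have "i = 0" using \<open>\<not> p dvd t\<close> by (cases i) auto
    then have "t = 1" using i by simp
    then show ?thesis using t card_subset_eq[OF f(2) CQK] by simp
  qed
  note CQ = this
  let ?R = "conjug g ` ?Q"
  have sR: "subgroup ?R G" by (rule subgroup_conj_image[OF sQ g])
  have RK: "?R \<subseteq> K" using normal_conj[OF K g] by blast
  have "card ?Q dvd p ^ multiplicity p (order G)"
    using card_subgroup_dvd[OF sS f(1) sQ] cS by simp
  then obtain e where e: "card ?Q = p ^ e" using divides_primepow_nat[OF p] by blast
  then have cR: "card ?R = p ^ e" using card_conj_image[OF g QG] by simp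
  obtain k where k: "k \<in> K" "\<And>q. q \<in> ?R \<Longrightarrow> conjug (inv k) q \<in> ?Q"
    using sylow_conjugate[OF p fin sQ sK sR cR _ RK idx] by blast
  then obtain c q where cq: "c \<in> C" "q \<in> ?Q" "k = c \<otimes> q" using CQ unfolding set_mult_def by blast
  have G: "k \<in> carrier G" "c \<in> carrier G" "q \<in> carrier G" using k(1) cq(1,2) KG CG QG by auto
  define m where "m = inv k \<otimes> g"
  have mG: "m \<in> carrier G" unfolding m_def using G g by simp
  have "conjug m x \<in> ?Q" if x: "x \<in> ?Q" for x
  proof -
    have "conjug (inv k) (conjug g x) \<in> ?Q" using k(2) x by blast
    then show ?thesis unfolding m_def using G g x QG by (simp add: conj_conj subsetD)
  qed
  then have "conjug m ` ?Q \<subseteq> ?Q" by blast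
  then have mQ: "conjug m ` ?Q = ?Q" using card_subset_eq[OF fQ] card_conj_image[OF mG QG] by blast
  have "conjug (q \<otimes> m) ` ?Q = conjug q ` conjug m ` ?Q"
    unfolding image_image using conj_conj[OF G(3) mG] QG by (intro image_cong) auto
  then have "conjug (q \<otimes> m) ` ?Q = ?Q" using mQ conj_image_subgroup[OF sQ cq(2)] by simp
  moreover have "g = c \<otimes> (q \<otimes> m)"
  proof -
    have "c \<otimes> (q \<otimes> m) = k \<otimes> m" using cq G mG by (simp add: m_assoc)
    then show ?thesis unfolding m_def using G g by simp
  qed
  ultimately show thesis using that[OF cq(1), of "q \<otimes> m"] G mG by blast
qed

text \<open>A p-subgroup is conjugate into \<open>S\<close>, and a normal one equals all its
  conjugates.\<close>

lemma normal_p_subgroup_le_sylow: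
  assumes p: "Factorial_Ring.prime p" and fin: "finite (carrier G)"
    and S: "sylow_subgroup p G S" and B: "B \<lhd> G" "card B = p ^ n"
  shows "B \<subseteq> S"
proof
  have sS: "subgroup S G" and sB: "subgroup B G"
    using S B normal_imp_subgroup by (auto simp: sylow_subgroup_def)
  have "\<not> p dvd card (carrier G) div card (S \<inter> carrier G)"
    using sylow_inter_normal[OF p fin S, of "carrier G"] normal_invI[OF subgroup_self] by simp
  then have idx: "\<not> p dvd card (carrier G) div card S"
    using subgroup.subset[OF sS] by (simp add: Int_absorb2)
  obtain g where g: "g \<in> carrier G" "\<And>x. x \<in> B \<Longrightarrow> conjug (inv g) x \<in> S"
    using sylow_conjugate[OF p fin sS subgroup_self sB B(2) _ _ idx] subgroup.subset[OF sS] subgroup.subset[OF sB] by blast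
  fix x assume x: "x \<in> B"
  have "conjug (inv g) (conjug g x) \<in> S" using g(2) normal_conj[OF B(1) g(1) x] .
  then show "x \<in> S" using g(1) x subgroup.mem_carrier[OF sB] by simp
qed

lemma conj_closed_generate:
  assumes "A \<subseteq> carrier G" "g \<in> carrier G" "\<And>x. x \<in> A \<Longrightarrow> conjug g x \<in> A" "x \<in> generate G A"
  shows "conjug g x \<in> generate G A"
proof -
  interpret f: group_hom G G "conjug g"
    using conj_mon[OF assms(2)] by (simp add: group_hom_def group_hom_axioms_def mon_def)
  have "conjug g x \<in> generate G (conjug g ` A)" using f.generate_img[OF assms(1)] assms(4) by blast
  then show ?thesis using mono_generate[of "conjug g ` A" A] assms(3) by blast
qed

section \<open>The induction over normal p-subgroups\<close>

context
  fixes p :: nat and S :: "'a set"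
  assumes p: "Factorial_Ring.prime p" "odd p" and fin: "finite (carrier G)"
    and S: "sylow_subgroup p G S"
    and stab: "\<And>P. P \<lhd> G \<Longrightarrow> p_group p (G \<restriction>\<^sub>g P) \<Longrightarrow> p_stable p G (G \<restriction>\<^sub>g P) (conj_act G P)"
begin

lemma family_core_inter_normal:
  assumes "B \<lhd> G" "card B = p ^ m" "g \<in> carrier G" "x \<in> family_core p N k \<zeta> G S \<inter> B"
  shows "conjug g x \<in> family_core p N k \<zeta> G S \<inter> B"
  using assms
proof (induction "card B" arbitrary: B m g x rule: less_induct)
  case less
  let ?F = "abelian_family p N k \<zeta> G" and ?I = "family_core p N k \<zeta> G"
  note B = less.prems(1) and cB = less.prems(2)
  have sS: "subgroup S G" and cS: "card S = p ^ multiplicity p (order G)"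
    using S by (auto simp: sylow_subgroup_def)
  have sB: "subgroup B G" by (rule normal_imp_subgroup[OF B])
  have sI: "subgroup (?I S) G" by (rule family_core_subgroup)
  have SG: "S \<subseteq> carrier G" and BG: "B \<subseteq> carrier G" and IG: "?I S \<subseteq> carrier G"
    using sS sB sI subgroup.subset by blast+
  have fS: "finite S" and fB: "finite B" using fin SG BG finite_subset by blast+
  have BS: "B \<subseteq> S" by (rule normal_p_subgroup_le_sylow[OF p(1) fin S B cB])
  define B0 where "B0 = (\<Union>h\<in>carrier G. conjug h ` (?I S \<inter> B))"
  have B0B: "B0 \<subseteq> B" unfolding B0_def using normal_conj[OF B] by blast
  have B0G: "B0 \<subseteq> carrier G" using B0B BG by blast
  have B0c: "conjug h y \<in> B0" if h: "h \<in> carrier G" and y: "y \<in> B0" for h y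
  proof -
    obtain h' z where z: "h' \<in> carrier G" "z \<in> ?I S \<inter> B" "y = conjug h' z" using y unfolding B0_def by blast
    have "z \<in> carrier G" using z(2) BG by blast
    then have "conjug h y = conjug (h \<otimes> h') z" using conj_conj[OF h z(1)] z(3) by simp
    moreover have "h \<otimes> h' \<in> carrier G" using h z(1) by simp
    ultimately show ?thesis unfolding B0_def using z(2) by blast
  qed
  have IB0: "?I S \<inter> B \<subseteq> B0"
  proof
    fix z assume z: "z \<in> ?I S \<inter> B"
    then have "z = conjug \<one> z" using BG by auto
    then show "z \<in> B0" unfolding B0_def using z by blast
  qed
  let ?B1 = "generate G B0"
  have B1: "?B1 \<lhd> G"
    by (rule normal_conjI[OF generate_is_subgroup[OF B0G]]) (rule conj_closed_generate[OF B0G _ B0c])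
  have B1B: "?B1 \<subseteq> B" by (rule generate_subgroup_incl[OF B0B sB])
  have sub_card: "\<exists>j. card H = p ^ j" if "H \<lhd> G" "H \<subseteq> B" for H
  proof -
    have "card H dvd p ^ m" using card_subgroup_dvd[OF sB fB normal_imp_subgroup[OF that(1)] that(2)] cB by simp
    then show ?thesis using divides_primepow_nat[OF p(1)] by blast
  qed
  show ?case
  proof (cases "?B1 = B \<and> B \<noteq> {\<one>}")
    case False
    show ?thesis
    proof (cases "B = {\<one>}")
      case True
      then show ?thesis using less.prems(3,4) subgroup.one_closed[OF sI] by simp
    next
      \<comment> \<open>The normal closure \<open>?B1\<close> of I \<inter> B is smaller than
        \<open>B\<close> and still contains I \<inter> B, so the induction hypothesis for it
        suffices.\<close>
      case F: False
      then have "?B1 \<subset> B" using False B1B by blast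
      then have lt: "card ?B1 < card B" using fB by (simp add: psubset_card_mono)
      obtain j where j: "card ?B1 = p ^ j" using sub_card[OF B1 B1B] by blast
      have "x \<in> ?I S \<inter> ?B1" using less.prems(4) IB0 generate.incl[of _ B0 G] by blast
      then have "conjug g x \<in> ?I S \<inter> ?B1" using less.hyps[OF lt B1 j less.prems(3)] by blast
      then show ?thesis using B1B by blast
    qed
  next
    case True
    then have B1eq: "?B1 = B" and Bne: "B \<noteq> {\<one>}" by auto
    \<comment> \<open>A proper subgroup because \<open>B\<close> is a nontrivial p-group; by
      induction I \<inter> ?D is normal in \<open>G\<close>, so its elements may be moved by
      arbitrary conjugations although I itself is so far only normal in \<open>S\<close>.\<close>
    let ?D = "derived G B"
    have D: "?D \<lhd> G" by (rule derived_is_normal[OF B])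
    have DB: "?D \<subset> B" by (rule p_group_derived_psubset[OF p(1) sB cB Bne])
    have lt: "card ?D < card B" using DB fB by (simp add: psubset_card_mono)
    obtain j where j: "card ?D = p ^ j" using sub_card[OF D] DB by blast
    have IDc: "conjug h y \<in> ?I S \<inter> ?D" if "h \<in> carrier G" "y \<in> ?I S \<inter> ?D" for h y
      using less.hyps[OF lt D j that] .
    have sID: "subgroup (?I S \<inter> ?D) G" by (rule subgroups_Inter_pair[OF sI normal_imp_subgroup[OF D]])
    have commD: "comm y z \<in> ?D" if "y \<in> B" "z \<in> B" for y z
    proof -
      have yz: "inv y \<in> B" "inv z \<in> B" "y \<in> carrier G" "z \<in> carrier G"
        using that sB BG by (auto simp: subgroup.m_inv_closed)
      then have "comm y z = inv y \<otimes> inv z \<otimes> inv (inv y) \<otimes> inv (inv z)" by (simp add: comm_def)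
      then have "comm y z \<in> derived_set G B" using yz(1,2) by blast
      then show ?thesis unfolding derived_def by (rule generate.incl)
    qed
    have Ic: "conjug s y \<in> ?I S" if "s \<in> S" "y \<in> ?I S" for s y
      using family_core_conj_closed[OF _ SG conj_image_subgroup[OF sS that(1)] that(2)] that(1) SG by blast
    \<comment> \<open>Conjugation carries y back to w in I. There the commutator lies in I because
      \<open>S\<close> contains \<open>B\<close> and normalizes I; being also in \<open>?D\<close>,
      it can be conjugated forward again.\<close>
    have comm0: "comm y z \<in> ?I S \<inter> ?D" if y: "y \<in> B0" and z: "z \<in> B" for y z
    proof -
      obtain h w where w: "h \<in> carrier G" "w \<in> ?I S" "w \<in> B" "y = conjug h w" using y unfolding B0_def by blast
      have wG: "w \<in> carrier G" "z \<in> carrier G" using w z BG by auto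
      define z' where "z' = conjug (inv h) z"
      have z': "z' \<in> B" "z' \<in> carrier G" unfolding z'_def using normal_conj[OF B _ z, of "inv h"] w BG by auto
      have "comm w z' = inv w \<otimes> conjug (inv z') w" using wG z' by (simp add: word_simps)
      moreover have "conjug (inv z') w \<in> ?I S" using Ic[OF _ w(2), of "inv z'"] z' BS sS by (auto simp: subgroup.m_inv_closed)
      ultimately have "comm w z' \<in> ?I S" using w(2) sI by (simp add: subgroup.m_closed subgroup.m_inv_closed)
      then have "comm w z' \<in> ?I S \<inter> ?D" using commD[OF w(3) z'(1)] by blast
      then have "conjug h (comm w z') \<in> ?I S \<inter> ?D" by (rule IDc[OF w(1)])
      moreover have "conjug h (comm w z') = comm y z" unfolding w(4) z'_def using w(1) wG z' by (simp add: conj_comm)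
      ultimately show ?thesis by simp
    qed
    \<comment> \<open>This is a subgroup by the normality of I \<inter> ?D, and it contains the
      generators \<open>B0\<close> of \<open>B\<close>; hence all commutators of \<open>B\<close>
      lie in I.\<close>
    let ?Z = "{y \<in> B. \<forall>z\<in>B. comm y z \<in> ?I S \<inter> ?D}"
    have "subgroup ?Z G"
    proof (rule subgroupI)
      show "?Z \<subseteq> carrier G" using BG by blast
      have "\<one> \<in> ?Z" using subgroup.one_closed[OF sB] subgroup.one_closed[OF sID] BG by (auto simp: comm_def)
      then show "?Z \<noteq> {}" by blast
      show "inv a \<in> ?Z" if a: "a \<in> ?Z" for a
      proof -
        have aG: "a \<in> B" "a \<in> carrier G" using a BG by auto
        have "comm (inv a) z \<in> ?I S \<inter> ?D" if z: "z \<in> B" for z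
        proof -
          have "comm (inv a) z = conjug a (inv (comm a z))" using aG z BG by (simp add: comm_inv_left subsetD)
          moreover have "inv (comm a z) \<in> ?I S \<inter> ?D" using a z subgroup.m_inv_closed[OF sID] by blast
          ultimately show ?thesis using IDc[OF aG(2)] by simp
        qed
        then show ?thesis using aG(1) sB by (simp add: subgroup.m_inv_closed)
      qed
      show "a \<otimes> b \<in> ?Z" if a: "a \<in> ?Z" and b: "b \<in> ?Z" for a b
      proof -
        have aG: "a \<in> B" "a \<in> carrier G" "b \<in> B" "b \<in> carrier G" using a b BG by auto
        have "comm (a \<otimes> b) z \<in> ?I S \<inter> ?D" if z: "z \<in> B" for z
        proof -
          have "comm (a \<otimes> b) z = conjug (inv b) (comm a z) \<otimes> comm b z" using aG z BG by (simp add: comm_mult_left subsetD)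
          moreover have "conjug (inv b) (comm a z) \<in> ?I S \<inter> ?D" using IDc[of "inv b" "comm a z"] a z aG by blast
          moreover have "comm b z \<in> ?I S \<inter> ?D" using b z by blast
          ultimately show ?thesis using subgroup.m_closed[OF sID] by simp
        qed
        then show ?thesis using aG sB by (simp add: subgroup.m_closed)
      qed
    qed
    moreover have "B0 \<subseteq> ?Z" using comm0 B0B by blast
    ultimately have "B \<subseteq> ?Z" using generate_subgroup_incl[of B0 ?Z] B1eq by simp
    then have commI: "comm y z \<in> ?I S" if "y \<in> B" "z \<in> B" for y z using that by blast
    have DI: "?D \<subseteq> ?I S"
    proof -
      have "derived_set G B \<subseteq> ?I S"
      proof
        fix w assume "w \<in> derived_set G B"
        then obtain y z where yz: "y \<in> B" "z \<in> B" "w = y \<otimes> z \<otimes> inv y \<otimes> inv z" by blast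
        then have "w = comm (inv y) (inv z)" using BG by (simp add: comm_def subsetD)
        then show "w \<in> ?I S" using commI yz sB by (simp add: subgroup.m_inv_closed)
      qed
      then show ?thesis unfolding derived_def by (rule generate_subgroup_incl[OF _ sI])
    qed
    \<comment> \<open>A generator of \<open>B\<close> is conjugate to some u in I. The same
      conjugation keeps the commutator in \<open>?D\<close>, hence in I, and I is abelian.\<close>
    have central: "comm y z \<otimes> w = w \<otimes> comm y z" if yz: "y \<in> B" "z \<in> B" and w: "w \<in> B" for y z w
    proof (rule generate_commute[OF B0G])
      show "comm y z \<in> carrier G" using yz BG by (simp add: subsetD)
      show "w \<in> generate G B0" using w B1eq by simp
      fix a assume "a \<in> B0"
      then obtain h u where u: "h \<in> carrier G" "u \<in> ?I S" "u \<in> B" "a = conjug h u" unfolding B0_def by blast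
      define c where "c = conjug (inv h) (comm y z)"
      have "c \<in> ?D" unfolding c_def using normal_conj[OF D _ commD[OF yz], of "inv h"] u(1) by simp
      then have "c \<in> ?I S" using DI by blast
      then have "c \<otimes> u = u \<otimes> c" using u(2) by (rule family_core_commute)
      moreover have G: "c \<in> carrier G" "u \<in> carrier G" "comm y z \<in> carrier G"
        using \<open>c \<in> ?I S\<close> u IG yz BG by (simp_all add: subsetD)
      ultimately have "conjug h c \<otimes> conjug h u = conjug h u \<otimes> conjug h c"
        using conj_mult[OF u(1) G(1,2)] conj_mult[OF u(1) G(2,1)] by simp
      moreover have "conjug h c = comm y z" unfolding c_def using u(1) G by simp
      ultimately show "comm y z \<otimes> a = a \<otimes> comm y z" using u(4) by simp
    qed
    define K where "K = O_p_act p G (G \<restriction>\<^sub>g B) (conj_act G B)"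
    define C where "C = centralizer G B"
    have pB: "p_stable p G (G \<restriction>\<^sub>g B) (conj_act G B)" using stab[OF B] p_group_subgroup_iff[OF sB] cB by blast
    have K: "K \<lhd> G" "C \<subseteq> K" "\<exists>r. card K = card C * p ^ r"
      unfolding K_def C_def by (rule O_p_act_conj[OF p(1) fin B])+
    have C: "C \<lhd> G" unfolding C_def by (rule centralizer_normal[OF B])
    let ?Q = "S \<inter> K"
    have QG: "?Q \<subseteq> carrier G" using SG by blast
    have Cfix: "conjug c y = y" if c: "c \<in> C" and y: "y \<in> B" for c y
    proof -
      have "c \<in> carrier G" "c \<otimes> y = y \<otimes> c" using c y unfolding C_def centralizer_def by auto
      then show ?thesis using conj_eq_iff[of c y] BG y by blast
    qed
    \<comment> \<open>In G = C_G(B) N_G(Q) the first factor acts trivially on \<open>B\<close> and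
      the second preserves the core of Q.\<close>
    have QI: "conjug h y \<in> ?I ?Q \<inter> B" if h: "h \<in> carrier G" and y: "y \<in> ?I ?Q \<inter> B" for h y
    proof -
      obtain r where r: "card K = card C * p ^ r" using K(3) by blast
      obtain c n where cn: "c \<in> C" "n \<in> carrier G" "h = c \<otimes> n" "conjug n ` ?Q = ?Q"
        using frattini_mod[OF p(1) fin S K(1) C K(2) r h] by blast
      have cG: "c \<in> carrier G" using cn(1) unfolding C_def centralizer_def by blast
      have yG: "y \<in> carrier G" using y BG by blast
      have nB: "conjug n y \<in> B" using normal_conj[OF B cn(2)] y by blast
      have "conjug h y = conjug c (conjug n y)" unfolding cn(3) using conj_conj[OF cG cn(2) yG] by simp
      also have "\<dots> = conjug n y" by (rule Cfix[OF cn(1) nB])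
      finally have e: "conjug h y = conjug n y" .
      have "conjug n y \<in> ?I ?Q" using family_core_conj_closed[OF cn(2) QG cn(4)] y by blast
      then show ?thesis using nB e by simp
    qed
    have FQ: "?F ?Q \<subseteq> ?F S" unfolding abelian_family_def by blast
    show ?thesis
    proof (cases "\<forall>A\<in>?F S. A \<subseteq> K")
      case True
      then have "?F S = ?F ?Q" unfolding abelian_family_def by blast
      then have "?I S = ?I ?Q" unfolding family_core_def by simp
      then show ?thesis using QI[OF less.prems(3)] less.prems(4) by simp
    next
      case False
      define bad where "bad = {A \<in> ?F S. \<not> A \<subseteq> K}"
      have "bad \<noteq> {}" using False unfolding bad_def by blast
      moreover have "bad \<subseteq> Pow S" unfolding bad_def abelian_family_def by blast
      ultimately have "Max ((\<lambda>A. card (A \<inter> B)) ` bad) \<in> (\<lambda>A. card (A \<inter> B)) ` bad"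
        and fbad: "finite ((\<lambda>A. card (A \<inter> B)) ` bad)"
        using fS by (simp_all add: finite_subset)
      then obtain A where A: "A \<in> bad" "card (A \<inter> B) = Max ((\<lambda>A. card (A \<inter> B)) ` bad)" by auto
      have Amax: "card (A' \<inter> B) \<le> card (A \<inter> B)" if "A' \<in> bad" for A'
        unfolding A(2) using that fbad by (intro Max_ge) auto
      have AF: "A \<in> ?F S" "\<not> A \<subseteq> K" using A unfolding bad_def by auto
      have AS: "A \<subseteq> S" using AF(1) unfolding abelian_family_def by blast
      have "\<exists>b\<in>B. \<exists>a\<in>A. \<exists>a'\<in>A. comm (comm b a) a' \<noteq> \<one>"
      proof (rule ccontr)
        assume n: "\<not> ?thesis"
        have "A \<subseteq> K"
        proof
          fix a assume a: "a \<in> A"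
          have "comm (comm w a) a = \<one>" if "w \<in> B" for w using n a that by blast
          then show "a \<in> K" unfolding K_def
            using quadratic_in_O_p_act[OF B pB, of a] a AS SG by blast
        qed
        then show False using AF by blast
      qed
      then obtain b a a' where nq: "b \<in> B" "a \<in> A" "a' \<in> A" "comm (comm b a) a' \<noteq> \<one>" by blast
      have BA: "comm y z \<in> A" if "y \<in> B" "z \<in> B" for y z
        using commI[OF that] family_core_le[OF AF(1)] by blast
      have nB: "conjug u y \<in> B" if "u \<in> A" "y \<in> B" for u y
        using normal_conj[OF B _ that(2), of u] that(1) AS SG by blast
      obtain A' where A': "A' \<in> ?F S" "card (A \<inter> B) < card (A' \<inter> B)" "\<not> B \<subseteq> A'"
        using replacement[OF p sS cS AF(1) sB BS nB BA central nq] by blast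
      have "A' \<subseteq> K" using Amax[of A'] A'(1,2) unfolding bad_def by force
      then have A'Q: "A' \<in> ?F ?Q" using A'(1) unfolding abelian_family_def by blast
      \<comment> \<open>A subfamily has the larger intersection. Here \<open>A'\<close> is
        essential: were the family inside Q empty, its core would default to the trivial
        group.\<close>
      have "?I S \<subseteq> ?I ?Q"
      proof -
        have "?F ?Q \<noteq> {}" "?F S \<noteq> {}" using A'Q A'(1) by auto
        then show ?thesis unfolding family_core_def I_int_def using FQ by auto
      qed
      then have "B0 \<subseteq> ?I ?Q" unfolding B0_def using QI by blast
      then have "B \<subseteq> ?I ?Q" using generate_subgroup_incl[OF _ family_core_subgroup] B1eq by blast
      also have "\<dots> \<subseteq> A'" by (rule family_core_le[OF A'Q])
      finally show ?thesis using A'(3) by blast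
    qed
  qed
qed

text \<open>It suffices to place the core inside B = O_p(G), where it equals its intersection with
  B. As C_G(B) lies in B, the preimage of O_p(G/C_G(B)) is a normal p-subgroup, hence inside B. The
  core is abelian and normalized by \<open>S\<close>, so [w, x] with w in B and x in the core stays
  in the core and commutes with x.\<close>

lemma family_core_normal:
  assumes cent: "centralizer G (O_p p G) \<subseteq> O_p p G"
  shows "family_core p N k \<zeta> G S \<lhd> G"
proof -
  let ?I = "family_core p N k \<zeta> G S" and ?B = "O_p p G"
  obtain m where m: "card ?B = p ^ m" using O_p_greatest(2)[OF p(1) fin] by blast
  have B: "?B \<lhd> G" by (rule O_p_greatest(1)[OF p(1) fin])
  have sB: "subgroup ?B G" by (rule normal_imp_subgroup[OF B])
  have sS: "subgroup S G" using S by (simp add: sylow_subgroup_def)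
  have SG: "S \<subseteq> carrier G" and BG: "?B \<subseteq> carrier G" using sS sB subgroup.subset by blast+
  have sI: "subgroup ?I G" by (rule family_core_subgroup)
  have IS: "?I \<subseteq> S" by (rule family_core_le'[OF sS])
  have BS: "?B \<subseteq> S" by (rule normal_p_subgroup_le_sylow[OF p(1) fin S B m])
  let ?K = "O_p_act p G (G \<restriction>\<^sub>g ?B) (conj_act G ?B)"
  have K: "?K \<lhd> G" "\<exists>r. card ?K = card (centralizer G ?B) * p ^ r"
    using O_p_act_conj[OF p(1) fin B] by auto
  have "card (centralizer G ?B) dvd p ^ m"
  proof -
    have "finite ?B" using finite_subset[OF BG fin] .
    then have "card (centralizer G ?B) dvd card ?B"
      using card_subgroup_dvd[OF sB _ normal_imp_subgroup[OF centralizer_normal[OF B]] cent] by blast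
    then show ?thesis using m by simp
  qed
  then obtain i where "card (centralizer G ?B) = p ^ i" using divides_primepow_nat[OF p(1)] by blast
  then obtain j where "card ?K = p ^ j" using K(2) by (metis power_add)
  then have KB: "?K \<subseteq> ?B" by (rule O_p_greatest(3)[OF p(1) fin K(1)])
  have st: "p_stable p G (G \<restriction>\<^sub>g ?B) (conj_act G ?B)"
    using stab[OF B] p_group_subgroup_iff[OF sB] m by blast
  have "?I \<subseteq> ?B"
  proof
    fix x assume x: "x \<in> ?I"
    have xG: "x \<in> carrier G" using x IS SG by blast
    have "comm (comm w x) x = \<one>" if w: "w \<in> ?B" for w
    proof -
      have wS: "w \<in> S" "w \<in> carrier G" using w BS SG by auto
      have "conjug (inv w) (inv x) \<in> ?I"
      proof (rule family_core_conj_closed[OF _ SG])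
        have "inv w \<in> S" using wS sS by (simp add: subgroup.m_inv_closed)
        then show "conjug (inv w) ` S = S" by (rule conj_image_subgroup[OF sS])
        show "inv w \<in> carrier G" using wS by simp
        show "inv x \<in> ?I" using x sI by (simp add: subgroup.m_inv_closed)
      qed
      moreover have "comm w x = conjug (inv w) (inv x) \<otimes> x" using wS xG by (simp add: word_simps)
      ultimately have "comm w x \<in> ?I" using x subgroup.m_closed[OF sI] by simp
      then have "comm w x \<otimes> x = x \<otimes> comm w x" using x by (rule family_core_commute)
      moreover have "comm w x \<in> carrier G" using wS(2) xG by simp
      ultimately show ?thesis using comm_eq_one_iff[of "comm w x" x] xG by blast
    qed
    then have "x \<in> ?K" by (rule quadratic_in_O_p_act[OF B st xG])
    then show "x \<in> ?B" using KB by blast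
  qed
  then have e: "?I \<inter> ?B = ?I" by blast
  show ?thesis
  proof (rule normal_conjI[OF sI])
    fix g x assume "g \<in> carrier G" "x \<in> ?I"
    then show "conjug g x \<in> ?I" using family_core_inter_normal[OF B m, of g x N k \<zeta>] unfolding e by blast
  qed
qed

text \<open>An automorphism carries \<open>S\<close> to a conjugate of \<open>S\<close> by Sylow.
  Forming the core commutes with automorphisms, so the image of the core is a conjugate of the core,
  which is normal.\<close>

lemma family_core_characteristic:
  assumes cent: "centralizer G (O_p p G) \<subseteq> O_p p G"
  shows "characteristic (family_core p N k \<zeta> G S) G"
  unfolding characteristic_def
proof (intro conjI ballI)
  let ?I = "family_core p N k \<zeta> G"
  show "subgroup (?I S) G" by (rule family_core_subgroup)
  fix \<alpha> assume \<alpha>: "\<alpha> \<in> iso G G"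
  have mon: "\<alpha> \<in> mon G G" using \<alpha> iso_iff_mon_epi by blast
  interpret a: group_hom G G \<alpha> using mon by (simp add: group_hom_def group_hom_axioms_def mon_def)
  have sS: "subgroup S G" and cS: "card S = p ^ multiplicity p (order G)"
    using S by (auto simp: sylow_subgroup_def)
  have SG: "S \<subseteq> carrier G" using sS subgroup.subset by blast
  have s\<alpha>: "subgroup (\<alpha> ` S) G" by (rule a.subgroup_img_is_subgroup[OF sS])
  have c\<alpha>: "card (\<alpha> ` S) = card S"
    by (rule card_image, rule inj_on_subset[OF _ SG]) (use mon in \<open>simp add: mon_def\<close>)
  have "\<not> p dvd card (carrier G) div card (S \<inter> carrier G)"
    using sylow_inter_normal[OF p(1) fin S, of "carrier G"] normal_invI[OF subgroup_self] by simp
  then have idx: "\<not> p dvd card (carrier G) div card S" using SG by (simp add: Int_absorb2)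
  obtain g where g: "g \<in> carrier G" "\<And>x. x \<in> \<alpha> ` S \<Longrightarrow> conjug (inv g) x \<in> S"
    using sylow_conjugate[OF p(1) fin sS subgroup_self s\<alpha> _ SG subgroup.subset[OF s\<alpha>] idx] c\<alpha> cS by metis
  have "\<alpha> ` S \<subseteq> conjug g ` S"
  proof
    fix x assume x: "x \<in> \<alpha> ` S"
    then have "x = conjug g (conjug (inv g) x)" using g(1) subgroup.mem_carrier[OF s\<alpha>] by simp
    then show "x \<in> conjug g ` S" using g(2)[OF x] by blast
  qed
  then have "\<alpha> ` S = conjug g ` S"
    using card_subset_eq[of "conjug g ` S" "\<alpha> ` S"] c\<alpha> card_conj_image[OF g(1) SG] finite_subset[OF SG fin] by simp
  then have "\<alpha> ` ?I S = conjug g ` ?I S"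
    using family_core_image[OF group_axioms group_axioms mon SG, of p N k \<zeta>] family_core_conj[OF g(1) SG, of p N k \<zeta>] by simp
  also have "\<dots> = ?I S"
  proof (rule card_subset_eq)
    have IG: "?I S \<subseteq> carrier G" using family_core_subgroup subgroup.subset by blast
    show "finite (?I S)" using finite_subset[OF IG fin] .
    show "card (conjug g ` ?I S) = card (?I S)" by (rule card_conj_image[OF g(1) IG])
    show "conjug g ` ?I S \<subseteq> ?I S" using normal_conj[OF family_core_normal[OF cent] g(1)] by blast
  qed
  finally show "\<alpha> ` ?I S = ?I S" .
qed

end

end

lemma glauberman_property_family_core:
  fixes S :: "('a, 'm) monoid_scheme"
  assumes p: "Factorial_Ring.prime p" "odd p" and S: "p_group p S"
  shows "glauberman_property TYPE('g) p S (family_core p N k \<zeta> S (carrier S))"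
  unfolding glauberman_property_def
proof (intro conjI allI impI)
  interpret S: group S using S by (simp add: p_group_def)
  show "subgroup (family_core p N k \<zeta> S (carrier S)) S" by (rule S.family_core_subgroup)
  fix G :: "'g monoid" and f
  assume *: "group G \<and> finite (carrier G) \<and> f \<in> mon S G \<and> sylow_subgroup p G (f ` carrier S) \<and>
    centralizer G (O_p p G) \<subseteq> O_p p G \<and>
    (\<forall>P. P \<lhd> G \<and> p_group p (G \<restriction>\<^sub>g P) \<longrightarrow> p_stable p G (G \<restriction>\<^sub>g P) (conj_act G P))"
  then interpret G: group G by blast
  have "f ` family_core p N k \<zeta> S (carrier S) = family_core p N k \<zeta> G (f ` carrier S)"
    using family_core_image[OF S.group_axioms G.group_axioms, of f "carrier S"] * by simp
  moreover have "characteristic (family_core p N k \<zeta> G (f ` carrier S)) G"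
    by (rule G.family_core_characteristic[OF p]) (use * in auto)
  ultimately show "characteristic (f ` family_core p N k \<zeta> S (carrier S)) G" by simp
qed

section \<open>The five subgroups as intersections of families\<close>

lemma lex_ge_trans:
  assumes "lex_ge a b" "lex_ge b c" shows "lex_ge a c"
proof (cases "\<forall>j\<ge>1. a j = b j")
  case True
  then show ?thesis using assms(2) unfolding lex_ge_def by (metis le_eq_less_or_eq)
next
  case False
  then obtain k where k: "k \<ge> 1" "a k > b k" "\<And>j. 1 \<le> j \<Longrightarrow> j < k \<Longrightarrow> a j = b j"
    using assms(1) unfolding lex_ge_def by blast
  from assms(2) consider "\<forall>j\<ge>1. b j = c j" | l where "l \<ge> 1" "b l > c l" "\<And>j. 1 \<le> j \<Longrightarrow> j < l \<Longrightarrow> b j = c j"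
    unfolding lex_ge_def by blast
  then show ?thesis
  proof cases
    case 1
    then have "a k > c k" "\<forall>j. 1 \<le> j \<and> j < k \<longrightarrow> a j = c j" using k by auto
    then show ?thesis unfolding lex_ge_def using k(1) by blast
  next
    case 2
    define m where "m = min k l"
    have m: "m \<ge> 1" "m \<le> k" "m \<le> l" "m = k \<or> m = l" unfolding m_def using k(1) 2(1) by auto
    have "a j = c j" if "1 \<le> j" "j < m" for j using k(3)[of j] 2(3)[of j] that m by simp
    moreover have "a m > c m"
    proof -
      have "a m \<ge> b m" using k m by (cases "m = k") auto
      moreover have "b m \<ge> c m" using 2 m by (cases "m = l") auto
      moreover have "a m > b m \<or> b m > c m" using m(4) k(2) 2(2) by auto
      ultimately show ?thesis by linarith
    qed
    ultimately show ?thesis unfolding lex_ge_def using m(1) by blast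
  qed
qed

lemma lex_ge_le_imp_eq:
  assumes "lex_ge a b" "\<And>j. a j \<le> b j" "j \<ge> 1" shows "a j = b j"
  using assms unfolding lex_ge_def by (metis not_less)

lemma lex_ge_antisym:
  assumes "lex_ge a b" "lex_ge b a" "j \<ge> 1" shows "a j = b j"
proof (rule ccontr)
  assume ne: "a j \<noteq> b j"
  from assms(1) ne obtain k where k: "k \<ge> 1" "a k > b k" "\<And>j. 1 \<le> j \<Longrightarrow> j < k \<Longrightarrow> a j = b j"
    unfolding lex_ge_def using assms(3) by blast
  from assms(2) ne[symmetric] obtain l where l: "l \<ge> 1" "b l > a l" "\<And>j. 1 \<le> j \<Longrightarrow> j < l \<Longrightarrow> b j = a j"
    unfolding lex_ge_def using assms(3) by blast
  show False using k(2) l(2) k(3)[OF l(1)] l(3)[OF k(1)] by (cases k l rule: linorder_cases) auto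
qed

section \<open>Extensions and generating sets of abelian p-groups\<close>

context group
begin

text \<open>Orders of elements are powers of p, so a bound by size, as in \<open>Omega\<close>,
  amounts to divisibility.\<close>

lemma ord_le_prime_power_iff:
  assumes p: "Factorial_Ring.prime p" and H: "subgroup H G" "card H = p ^ s" "x \<in> H"
  shows "ord x \<le> p ^ j \<longleftrightarrow> x [^] (p ^ j) = \<one>"
proof -
  have xG: "x \<in> carrier G" using subgroup.mem_carrier[OF H(1,3)] .
  have "ord x dvd p ^ s" using pow_card_subgroup[OF H(1,3)] H(2) pow_eq_id[OF xG] by simp
  then obtain e where e: "ord x = p ^ e" using divides_primepow_nat[OF p] by blast
  have "p ^ e \<le> p ^ j \<longleftrightarrow> e \<le> j" using prime_gt_1_nat[OF p] by (rule power_increasing_iff)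
  also have "\<dots> \<longleftrightarrow> p ^ e dvd p ^ j"
    using power_dvd_imp_le[OF _ prime_gt_1_nat[OF p], of e j] le_imp_power_dvd[of e j p] by blast
  finally show ?thesis using pow_eq_id[OF xG, of "p ^ j"] e by simp
qed

lemma generate_subgroup_eq: "subgroup H G \<Longrightarrow> generate G H = H"
  using generate_subgroup_incl[of H H] generate.incl[of _ H G] by blast

lemma Omega_eq_torsion:
  assumes p: "Factorial_Ring.prime p" and A: "subgroup A G" "card A = p ^ s"
    and c: "\<And>x y. x \<in> A \<Longrightarrow> y \<in> A \<Longrightarrow> x \<otimes> y = y \<otimes> x"
  shows "Omega p j (G \<restriction>\<^sub>g A) = torsion G (p ^ j) A"
proof -
  interpret A: group "G \<restriction>\<^sub>g A" by (rule subgroup_imp_group[OF A(1)])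
  have sA: "subgroup A (G \<restriction>\<^sub>g A)" using A.subgroup_self by simp
  have pw: "x [^]\<^bsub>G \<restriction>\<^sub>g A\<^esub> (n::nat) = x [^] n" for x n by (simp add: nat_pow_def)
  have "{x \<in> carrier (G \<restriction>\<^sub>g A). A.ord x \<le> p ^ j} = torsion G (p ^ j) A"
    unfolding torsion_def using A.ord_le_prime_power_iff[OF p sA A(2), of _ j] by (auto simp: pw)
  then show ?thesis unfolding Omega_def
    using generate_consistent[OF torsion_subset[of G "p ^ j" A] A(1)] generate_subgroup_eq[OF torsion_subgroup[OF A(1) c]] by simp
qed

text \<open>The witness is \<open>A\<close> times the cyclic group of x. The conclusion on exponents
  keeps the extension elementary abelian when \<open>A\<close> is and x^p = 1.\<close>

lemma adjoin_abelian:
  assumes A: "subgroup A G" "\<And>x y. x \<in> A \<Longrightarrow> y \<in> A \<Longrightarrow> x \<otimes> y = y \<otimes> x"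
    and x: "x \<in> carrier G" "\<And>a. a \<in> A \<Longrightarrow> x \<otimes> a = a \<otimes> x"
  obtains A' where "subgroup A' G" "A \<subseteq> A'" "x \<in> A'" "\<And>y z. y \<in> A' \<Longrightarrow> z \<in> A' \<Longrightarrow> y \<otimes> z = z \<otimes> y"
    "\<And>n::nat. (\<And>a. a \<in> A \<Longrightarrow> a [^] n = \<one>) \<Longrightarrow> x [^] n = \<one> \<Longrightarrow> (\<And>a. a \<in> A' \<Longrightarrow> a [^] n = \<one>)"
proof -
  let ?X = "generate G {x}"
  have xs: "{x} \<subseteq> carrier G" using x by simp
  have sX: "subgroup ?X G" by (rule generate_is_subgroup[OF xs])
  have XG: "?X \<subseteq> carrier G" using sX subgroup.subset by blast
  have AG: "A \<subseteq> carrier G" using A(1) subgroup.subset by blast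
  have aX: "a \<otimes> y = y \<otimes> a" if a: "a \<in> A" and y: "y \<in> ?X" for a y
    using generate_commute[OF xs _ _ y, of a] x(2)[OF a] a AG by auto
  have xX: "y \<otimes> x = x \<otimes> y" if y: "y \<in> ?X" for y
    using generate_commute[OF xs x(1) _ y] by simp
  have XX: "y \<otimes> z = z \<otimes> y" if y: "y \<in> ?X" and z: "z \<in> ?X" for y z
    using generate_commute[OF xs _ _ z, of y] xX[OF y] y XG by auto
  have sAX: "subgroup (A <#> ?X) G"
    by (rule set_mult_abelian(1)[OF A(1) sX A(2) XX aX]; assumption)
  show thesis
  proof (rule that[OF sAX])
    show "A \<subseteq> A <#> ?X" by (rule set_mult_superset(1)[OF A(1) sX])
    show "x \<in> A <#> ?X" using set_mult_superset(2)[OF A(1) sX] generate.incl[of x "{x}" G] by blast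
    show "y \<otimes> z = z \<otimes> y" if "y \<in> A <#> ?X" "z \<in> A <#> ?X" for y z
      by (rule set_mult_abelian(2)[OF A(1) sX A(2) XX aX that]; assumption)
    fix n :: nat and a assume h: "\<And>a. a \<in> A \<Longrightarrow> a [^] n = \<one>" "x [^] n = \<one>" and a: "a \<in> A <#> ?X"
    obtain u v where uv: "u \<in> A" "v \<in> ?X" "a = u \<otimes> v" using a unfolding set_mult_def by blast
    have "?X \<subseteq> torsion G n ?X"
    proof (rule generate_subgroup_incl)
      show "{x} \<subseteq> torsion G n ?X" using h(2) generate.incl[of x "{x}" G] by (simp add: torsion_def)
      show "subgroup (torsion G n ?X) G" by (rule torsion_subgroup[OF sX XX])
    qed
    then have "v [^] n = \<one>" using uv(2) unfolding torsion_def by blast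
    moreover have "u \<in> carrier G" "v \<in> carrier G" using uv AG XG by auto
    ultimately show "a [^] n = \<one>" using uv(3) h(1)[OF uv(1)] pow_mult_distrib[OF aX[OF uv(1,2)]] by simp
  qed
qed

text \<open>Induction through a maximal subgroup: one further generator suffices above it, and the
  order grows by at least a factor p.\<close>

lemma p_group_small_generators:
  assumes p: "Factorial_Ring.prime p" and H: "subgroup H G" "card H = p ^ s"
  shows "\<exists>U. U \<subseteq> H \<and> finite U \<and> generate G U = H \<and> p ^ card U \<le> card H"
  using H
proof (induction "card H" arbitrary: H s rule: less_induct)
  case less
  note H = less.prems
  have fH: "finite H" using H(2) p by (metis card.infinite not_prime_0 power_eq_0_iff)
  show ?case
  proof (cases "H = {\<one>}")
    case True
    then show ?thesis by (intro exI[of _ "{}"]) (simp add: generate_empty)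
  next
    case False
    define C where "C = {K. subgroup K G \<and> K \<subset> H}"
    have "C \<subseteq> Pow H" unfolding C_def by blast
    then have "finite C" using fH by (simp add: finite_subset)
    moreover have "{\<one>} \<in> C" unfolding C_def using False H(1) triv_subgroup subgroup.one_closed by blast
    ultimately obtain K where K: "K \<in> C" "\<And>L. L \<in> C \<Longrightarrow> K \<subseteq> L \<Longrightarrow> K = L"
      using finite_has_maximal[of C] by blast
    have sK: "subgroup K G" "K \<subset> H" using K(1) unfolding C_def by auto
    have lt: "card K < card H" by (rule psubset_card_mono[OF fH sK(2)])
    have KH: "card K dvd p ^ s" using card_subgroup_dvd[OF H(1) fH sK(1)] sK(2) H(2) by auto
    then obtain t where t: "card K = p ^ t" using divides_primepow_nat[OF p] by blast
    obtain U where U: "U \<subseteq> K" "finite U" "generate G U = K" "p ^ card U \<le> card K"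
      using less.hyps[OF lt sK(1) t] by blast
    obtain x where x: "x \<in> H" "x \<notin> K" using sK(2) by blast
    have sub: "insert x U \<subseteq> H" using x U(1) sK(2) by blast
    have HG: "H \<subseteq> carrier G" using H(1) subgroup.subset by blast
    let ?L = "generate G (insert x U)"
    have "subgroup ?L G" by (rule generate_is_subgroup[OF subset_trans[OF sub HG]])
    moreover have "?L \<subseteq> H" by (rule generate_subgroup_incl[OF sub H(1)])
    moreover have "K \<subseteq> ?L" using mono_generate[of U "insert x U"] U(3) by blast
    moreover have "x \<in> ?L" by (rule generate.incl) simp
    ultimately have "?L = H" using K(2)[of ?L] x(2) unfolding C_def by blast
    moreover have "p ^ card (insert x U) \<le> card H"
    proof -
      have "p ^ card (insert x U) = p * p ^ card U" using U x by (subst card_insert_disjoint) auto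
      also have "\<dots> \<le> p * card K" using U(4) by simp
      also have "\<dots> \<le> card H" by (rule prime_power_less_imp[OF p KH _ lt]) (simp add: H(2))
      finally show ?thesis .
    qed
    ultimately show ?thesis using sub U(2) by blast
  qed
qed

lemma card_subgroup_adjoin_le:
  assumes p: "Factorial_Ring.prime p" and fin: "finite (carrier G)"
    and c: "\<And>x y. x \<in> carrier G \<Longrightarrow> y \<in> carrier G \<Longrightarrow> x \<otimes> y = y \<otimes> x"
    and P: "subgroup P G" and U: "finite U" "U \<subseteq> carrier G" "\<And>u. u \<in> U \<Longrightarrow> u [^] p \<in> P"
  shows "\<exists>K. subgroup K G \<and> P \<subseteq> K \<and> U \<subseteq> K \<and> card K \<le> p ^ card U * card P"
  using U
proof (induction U rule: finite_induct)
  case empty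
  then show ?case using P by auto
next
  case (insert u U)
  then obtain K where K: "subgroup K G" "P \<subseteq> K" "U \<subseteq> K" "card K \<le> p ^ card U * card P" by auto
  have uG: "u \<in> carrier G" using insert.prems by blast
  have cK: "p * card K \<le> p ^ card (insert u U) * card P"
    using K(4) insert.hyps by simp
  show ?case
  proof (cases "u \<in> K")
    case True
    have "card K \<le> p * card K" using prime_gt_0_nat[OF p] by simp
    then have "card K \<le> p ^ card (insert u U) * card P" using cK by (rule le_trans)
    then show ?thesis using K True by blast
  next
    case False
    have fK: "finite K" using finite_subset[OF subgroup.subset[OF K(1)] fin] .
    have uP: "u [^] p \<in> K" using insert.prems(2) K(2) by blast
    let ?K = "{h \<otimes> u [^] i | h i. h \<in> K \<and> i < p}"
    have "h \<otimes> u = u \<otimes> h" if "h \<in> K" for h using c[of h u] uG that subgroup.mem_carrier[OF K(1)] by blast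
    note a = adjoin_prime[OF p K(1) fK uG False uP this]
    show ?thesis
    proof (intro exI[of _ ?K] conjI)
      show "subgroup ?K G" by (rule a(1))
      show "P \<subseteq> ?K" using a(3) K(2) by (rule subset_trans[rotated])
      show "insert u U \<subseteq> ?K" using a(3,4) K(3) by blast
      show "card ?K \<le> p ^ card (insert u U) * card P" using a(2) cK by simp
    qed
  qed
qed

text \<open>The p-th power map is an endomorphism with kernel the p-torsion, so the torsion has
  order |G : G^p|. Adjoining the generators one at a time to G^p multiplies the order by at most p
  each time.\<close>

lemma card_torsion_le_generators:
  assumes p: "Factorial_Ring.prime p" and fin: "finite (carrier G)"
    and c: "\<And>x y. x \<in> carrier G \<Longrightarrow> y \<in> carrier G \<Longrightarrow> x \<otimes> y = y \<otimes> x"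
    and U: "U \<subseteq> carrier G" "finite U" "generate G U = carrier G"
  shows "card (torsion G p (carrier G)) \<le> p ^ card U"
proof -
  let ?P = "(\<lambda>x. x [^] p) ` carrier G"
  have pd: "(x \<otimes> y) [^] p = x [^] p \<otimes> y [^] p" if "x \<in> carrier G" "y \<in> carrier G" for x y
    using pow_mult_distrib[OF c[OF that]] that .
  have sP: "subgroup ?P G"
  proof -
    have "(\<lambda>x. x [^] p) \<in> hom G G" using pd by (simp add: hom_def)
    then interpret f: group_hom G G "\<lambda>x. x [^] p" by (simp add: group_hom_def group_hom_axioms_def)
    show ?thesis by (rule f.img_is_subgroup)
  qed
  have sT: "subgroup (torsion G p (carrier G)) G" by (rule torsion_subgroup[OF subgroup_self c])
  have "card (carrier G) = card (torsion G p (carrier G)) * card ?P"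
  proof (rule card_subgroup_fibers[OF subgroup_self fin sT torsion_subset])
    fix x y assume xy: "x \<in> carrier G" "y \<in> carrier G"
    have "(inv x \<otimes> y) [^] p = inv (x [^] p) \<otimes> y [^] p" using pd[of "inv x" y] xy by (simp add: nat_pow_inv)
    moreover have "inv (x [^] p) \<otimes> y [^] p = \<one> \<longleftrightarrow> x [^] p = y [^] p"
    proof -
      have "\<one> = inv (x [^] p) \<otimes> y [^] p \<longleftrightarrow> y [^] p = x [^] p"
        using xy inv_solve_left[of \<one> "x [^] p" "y [^] p"] by simp
      then show ?thesis by (simp add: eq_commute[of _ \<one>] eq_commute[of "x [^] p"])
    qed
    ultimately show "x [^] p = y [^] p \<longleftrightarrow> inv x \<otimes> y \<in> torsion G p (carrier G)"
      using xy by (simp add: torsion_def)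
  qed
  moreover obtain K where K: "subgroup K G" "U \<subseteq> K" "card K \<le> p ^ card U * card ?P"
    using card_subgroup_adjoin_le[OF p fin c sP U(2,1)] U(1) by blast
  moreover have "K = carrier G" using generate_subgroup_incl[OF K(2,1)] U(3) subgroup.subset[OF K(1)] by blast
  ultimately have "card (torsion G p (carrier G)) * card ?P \<le> p ^ card U * card ?P" by simp
  moreover have "card ?P > 0" using subgroup.one_closed[OF sP] fin card_gt_0_iff by blast
  ultimately show ?thesis by simp
qed

lemma min_generators_attained:
  assumes "finite (carrier G)"
  obtains U where "U \<subseteq> carrier G" "finite U" "card U = min_generators G" "generate G U = carrier G"
proof -
  have "\<exists>U. U \<subseteq> carrier G \<and> finite U \<and> card U = card (carrier G) \<and> generate G U = carrier G"
    using assms generate_subgroup_eq[OF subgroup_self] by blast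
  from LeastI[of "\<lambda>n. \<exists>U. U \<subseteq> carrier G \<and> finite U \<and> card U = n \<and> generate G U = carrier G", OF this]
  show thesis unfolding min_generators_def[symmetric] using that by blast
qed

lemma card_elementary_abelian:
  assumes p: "Factorial_Ring.prime p" and G: "order G = p ^ s" and e: "elementary_abelian p G"
  shows "card (carrier G) = p ^ min_generators G"
proof -
  have fin: "finite (carrier G)" using G p unfolding order_def by (metis card.infinite not_prime_0 power_eq_0_iff)
  interpret comm_group G using e by (simp add: elementary_abelian_def)
  obtain U where U: "U \<subseteq> carrier G" "finite U" "card U = min_generators G" "generate G U = carrier G"
    using min_generators_attained[OF fin] .
  have "torsion G p (carrier G) = carrier G" using e by (auto simp: torsion_def elementary_abelian_def)
  then have 1: "card (carrier G) \<le> p ^ min_generators G"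
    using card_torsion_le_generators[OF p fin m_comm U(1,2,4)] U(3) by simp
  obtain V where V: "V \<subseteq> carrier G" "finite V" "generate G V = carrier G" "p ^ card V \<le> card (carrier G)"
    using p_group_small_generators[OF p subgroup_self] G unfolding order_def by blast
  have "min_generators G \<le> card V" unfolding min_generators_def using V by (intro Least_le) blast
  then have "p ^ min_generators G \<le> p ^ card V" using prime_gt_1_nat[OF p] by (simp add: power_increasing)
  then show ?thesis using 1 V(4) by linarith
qed

section \<open>Abelian subgroups, the center of the subgroup they generate, and exponents\<close>

lemma abelian_subgroups_iff:
  "A \<in> abelian_subgroups G \<longleftrightarrow> subgroup A G \<and> (\<forall>x\<in>A. \<forall>y\<in>A. x \<otimes> y = y \<otimes> x)"
proof -
  have "comm_group (G \<restriction>\<^sub>g A) \<longleftrightarrow> (\<forall>x\<in>A. \<forall>y\<in>A. x \<otimes> y = y \<otimes> x)" if A: "subgroup A G"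
  proof
    assume "comm_group (G \<restriction>\<^sub>g A)"
    then interpret A: comm_group "G \<restriction>\<^sub>g A" .
    show "\<forall>x\<in>A. \<forall>y\<in>A. x \<otimes> y = y \<otimes> x" using A.m_comm by simp
  next
    assume "\<forall>x\<in>A. \<forall>y\<in>A. x \<otimes> y = y \<otimes> x"
    then show "comm_group (G \<restriction>\<^sub>g A)"
      by (intro group.group_comm_groupI[OF subgroup_imp_group[OF A]]) simp
  qed
  then show ?thesis unfolding abelian_subgroups_def by blast
qed

lemma abelian_subgroups_Union:
  assumes "\<A> \<subseteq> abelian_subgroups G" shows "\<Union>\<A> \<subseteq> carrier G"
proof (rule Union_least)
  fix A assume "A \<in> \<A>"
  then have "subgroup A G" using assms abelian_subgroups_iff[of A] by blast
  then show "A \<subseteq> carrier G" by (rule subgroup.subset)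
qed

lemma J_gen_subgroup: "\<Union>\<A> \<subseteq> carrier G \<Longrightarrow> subgroup (J_gen G \<A>) G"
  unfolding J_gen_def by (rule generate_is_subgroup)

lemma mem_center_J_gen_iff:
  assumes ab: "\<A> \<subseteq> abelian_subgroups G"
  shows "z \<in> center (G \<restriction>\<^sub>g J_gen G \<A>) \<longleftrightarrow> z \<in> J_gen G \<A> \<and> (\<forall>A\<in>\<A>. \<forall>a\<in>A. z \<otimes> a = a \<otimes> z)"
proof -
  have sub: "\<Union>\<A> \<subseteq> carrier G" by (rule abelian_subgroups_Union[OF ab])
  have JG: "J_gen G \<A> \<subseteq> carrier G" by (rule subgroup.subset[OF J_gen_subgroup[OF sub]])
  have "(\<forall>g\<in>J_gen G \<A>. g \<otimes> z = z \<otimes> g) \<longleftrightarrow> (\<forall>A\<in>\<A>. \<forall>a\<in>A. z \<otimes> a = a \<otimes> z)" if z: "z \<in> J_gen G \<A>"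
  proof
    assume l: "\<forall>g\<in>J_gen G \<A>. g \<otimes> z = z \<otimes> g"
    show "\<forall>A\<in>\<A>. \<forall>a\<in>A. z \<otimes> a = a \<otimes> z"
    proof (intro ballI)
      fix A a assume "A \<in> \<A>" "a \<in> A"
      then have "a \<in> J_gen G \<A>" unfolding J_gen_def by (intro generate.incl) blast
      then have "a \<otimes> z = z \<otimes> a" using l by blast
      then show "z \<otimes> a = a \<otimes> z" by (rule sym)
    qed
  next
    assume r: "\<forall>A\<in>\<A>. \<forall>a\<in>A. z \<otimes> a = a \<otimes> z"
    have zG: "z \<in> carrier G" using z JG by blast
    show "\<forall>g\<in>J_gen G \<A>. g \<otimes> z = z \<otimes> g"
    proof
      fix g assume "g \<in> J_gen G \<A>"
      then have "z \<otimes> g = g \<otimes> z" unfolding J_gen_def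
        using generate_commute[OF sub zG, of g] r by blast
      then show "g \<otimes> z = z \<otimes> g" by (rule sym)
    qed
  qed
  then show ?thesis unfolding center_def by (simp, blast)
qed

text \<open>A central element commutes with every member and so lies in each; conversely the members
  are abelian. For the empty family both sides are trivial.\<close>

lemma center_J_gen_eq_I_int:
  assumes ab: "\<A> \<subseteq> abelian_subgroups G"
    and sc: "\<And>A x. A \<in> \<A> \<Longrightarrow> x \<in> carrier G \<Longrightarrow> (\<And>a. a \<in> A \<Longrightarrow> x \<otimes> a = a \<otimes> x) \<Longrightarrow> x \<in> A"
  shows "center (G \<restriction>\<^sub>g J_gen G \<A>) = I_int G \<A>"
proof (cases "\<A> = {}")
  case True
  then show ?thesis by (auto simp: center_def J_gen_def I_int_def generate_empty)
next
  case False
  have sub: "\<Union>\<A> \<subseteq> carrier G" by (rule abelian_subgroups_Union[OF ab])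
  have JG: "J_gen G \<A> \<subseteq> carrier G" by (rule subgroup.subset[OF J_gen_subgroup[OF sub]])
  have "z \<in> center (G \<restriction>\<^sub>g J_gen G \<A>) \<longleftrightarrow> z \<in> \<Inter>\<A>" for z
  proof
    assume "z \<in> center (G \<restriction>\<^sub>g J_gen G \<A>)"
    then have "z \<in> carrier G" "\<forall>A\<in>\<A>. \<forall>a\<in>A. z \<otimes> a = a \<otimes> z" using mem_center_J_gen_iff[OF ab] JG by auto
    then show "z \<in> \<Inter>\<A>" using sc by blast
  next
    assume z: "z \<in> \<Inter>\<A>"
    then have "z \<in> J_gen G \<A>" unfolding J_gen_def using False by (intro generate.incl) blast
    moreover have "z \<otimes> a = a \<otimes> z" if "A \<in> \<A>" "a \<in> A" for A a
      using z that ab abelian_subgroups_iff[of A] by blast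
    ultimately show "z \<in> center (G \<restriction>\<^sub>g J_gen G \<A>)" using mem_center_J_gen_iff[OF ab] by blast
  qed
  then show ?thesis unfolding I_int_def using False by auto
qed

end

lemma power_int_neg_less_one:
  assumes "p > 1" "m < 0" shows "(of_nat p :: rat) powi m < 1"
proof -
  obtain n where n: "m = - int (Suc n)" using assms(2) by (metis negD)
  have "(of_nat p :: rat) ^ Suc n > 1" using assms(1) by (intro one_less_power) simp_all
  then have "inverse ((of_nat p :: rat) ^ Suc n) < 1" by (simp only: inverse_less_1_iff) simp
  then show ?thesis unfolding n power_int_minus power_int_of_nat .
qed

context group
begin

lemma group_exponent_pos_pow:
  assumes A: "subgroup A G" "finite A"
  shows "group_exponent (G \<restriction>\<^sub>g A) > 0" "\<And>x. x \<in> A \<Longrightarrow> x [^] group_exponent (G \<restriction>\<^sub>g A) = \<one>"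
proof -
  have pw: "x [^]\<^bsub>G \<restriction>\<^sub>g A\<^esub> (n::nat) = x [^] n" for x n by (simp add: nat_pow_def)
  let ?P = "\<lambda>n::nat. n > 0 \<and> (\<forall>x\<in>A. x [^] n = \<one>)"
  have eq: "group_exponent (G \<restriction>\<^sub>g A) = (LEAST n. ?P n)" unfolding group_exponent_def pw by simp
  have "card A > 0" using subgroup.one_closed[OF A(1)] A(2) card_gt_0_iff by blast
  then have "?P (card A)" using pow_card_subgroup[OF A(1)] by blast
  then have "?P (LEAST n. ?P n)" by (rule LeastI[of ?P])
  then show "group_exponent (G \<restriction>\<^sub>g A) > 0" "\<And>x. x \<in> A \<Longrightarrow> x [^] group_exponent (G \<restriction>\<^sub>g A) = \<one>"
    unfolding eq by blast+
qed

lemma group_exponent_le_iff: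
  assumes p: "Factorial_Ring.prime p" and A: "subgroup A G" "card A = p ^ s"
  shows "group_exponent (G \<restriction>\<^sub>g A) \<le> p ^ k \<longleftrightarrow> (\<forall>x\<in>A. x [^] (p ^ k) = \<one>)"
proof
  have fA: "finite A" using A(2) p by (metis card.infinite not_prime_0 power_eq_0_iff)
  note e = group_exponent_pos_pow[OF A(1) fA]
  assume le: "group_exponent (G \<restriction>\<^sub>g A) \<le> p ^ k"
  show "\<forall>x\<in>A. x [^] (p ^ k) = \<one>"
  proof
    fix x assume x: "x \<in> A"
    have "ord x dvd group_exponent (G \<restriction>\<^sub>g A)" using e(2)[OF x] pow_eq_id subgroup.mem_carrier[OF A(1) x] by simp
    then have "ord x \<le> p ^ k" using e(1) le by (meson dvd_imp_le le_trans)
    then show "x [^] (p ^ k) = \<one>" using ord_le_prime_power_iff[OF p A x] by simp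
  qed
next
  assume a: "\<forall>x\<in>A. x [^] (p ^ k) = \<one>"
  have pw: "x [^]\<^bsub>G \<restriction>\<^sub>g A\<^esub> (n::nat) = x [^] n" for x n by (simp add: nat_pow_def)
  show "group_exponent (G \<restriction>\<^sub>g A) \<le> p ^ k" unfolding group_exponent_def pw
    by (rule Least_le) (use a prime_gt_0_nat[OF p] in simp)
qed

section \<open>The families over a p-group of exponent dividing p^i\<close>

context
  fixes p s i :: nat
  assumes p: "Factorial_Ring.prime p" and card_G: "card (carrier G) = p ^ s"
    and i: "i \<ge> 1" and exp_G: "\<And>x. x \<in> carrier G \<Longrightarrow> x [^] (p ^ i) = \<one>"
begin

lemma finite_G: "finite (carrier G)"
  using card_G p by (metis card.infinite not_prime_0 power_eq_0_iff)

lemma subgroup_card: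
  assumes "subgroup A G" obtains t where "card A = p ^ t"
proof -
  have "card A dvd p ^ s"
    using card_subgroup_dvd[OF subgroup_self finite_G assms subgroup.subset[OF assms]] card_G by simp
  then show thesis using divides_primepow_nat[OF p] that by blast
qed

lemma subgroup_finite: "subgroup A G \<Longrightarrow> finite A"
  using finite_subset[OF subgroup.subset finite_G] .

lemma subgroup_card_pos: "subgroup A G \<Longrightarrow> card A > 0"
  using subgroup.one_closed subgroup_finite card_gt_0_iff by blast

lemma omega_eq:
  assumes "A \<in> abelian_subgroups G"
  shows "omega p (G \<restriction>\<^sub>g A) = (\<lambda>j. int (card (torsion G (p ^ j) A)))"
proof
  fix j
  have A: "subgroup A G" "\<And>x y. x \<in> A \<Longrightarrow> y \<in> A \<Longrightarrow> x \<otimes> y = y \<otimes> x"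
    using assms abelian_subgroups_iff[of A] by blast+
  obtain t where "card A = p ^ t" using subgroup_card[OF A(1)] .
  then show "omega p (G \<restriction>\<^sub>g A) j = int (card (torsion G (p ^ j) A))"
    unfolding omega_def using Omega_eq_torsion[OF p A(1) _ A(2)] by simp
qed

lemma mem_abelian_family_iff:
  "A \<in> abelian_family p N k \<zeta> G (carrier G) \<longleftrightarrow> A \<in> abelian_subgroups G \<and> card A = N \<and>
     (\<forall>x\<in>A. x [^] (p ^ k) = \<one>) \<and> lex_ge (omega p (G \<restriction>\<^sub>g A)) \<zeta>" (is "?l \<longleftrightarrow> ?r")
proof
  assume l: ?l
  then have "A \<in> abelian_subgroups G" unfolding abelian_family_def abelian_subgroups_iff by blast
  then show ?r using l omega_eq unfolding abelian_family_def by simp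
next
  assume r: ?r
  then have "subgroup A G" using abelian_subgroups_iff by blast
  then have "A \<subseteq> carrier G" by (rule subgroup.subset)
  then show ?l using r omega_eq abelian_subgroups_iff[of A] unfolding abelian_family_def by simp
qed

lemma mem_abelian_family_exp_iff:
  "A \<in> abelian_family p N i \<zeta> G (carrier G) \<longleftrightarrow> A \<in> abelian_subgroups G \<and> card A = N \<and>
     lex_ge (omega p (G \<restriction>\<^sub>g A)) \<zeta>"
proof -
  have "\<forall>x\<in>A. x [^] (p ^ i) = \<one>" if "A \<in> abelian_subgroups G"
    using exp_G that abelian_subgroups_iff[of A] subgroup.mem_carrier[of A G] by blast
  then show ?thesis unfolding mem_abelian_family_iff by blast
qed

text \<open>The order 0 encodes the empty family, so that a family without members also has the
  common form.\<close>

lemma abelian_family_zero: "abelian_family p 0 k \<zeta> G (carrier G) = {}"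
  using subgroup_card_pos unfolding abelian_family_def by fastforce

text \<open>The zero sequence is a void lower bound, as \<omega>_1 is positive.\<close>

lemma lex_ge_omega_zero:
  assumes "A \<in> abelian_subgroups G" shows "lex_ge (omega p (G \<restriction>\<^sub>g A)) (\<lambda>_. 0)"
proof -
  have A: "subgroup A G" using assms abelian_subgroups_iff by blast
  have "\<one> \<in> torsion G (p ^ 1) A" using subgroup.one_closed[OF A] by (simp add: torsion_def)
  then have "card (torsion G (p ^ 1) A) > 0"
    using finite_subset[OF torsion_subset subgroup_finite[OF A]] card_gt_0_iff by blast
  then show ?thesis unfolding omega_eq[OF assms] lex_ge_def by (intro disjI2 exI[of _ 1]) auto
qed

lemma A_o_family: "\<exists>N \<zeta>. A_o G = abelian_family p N i \<zeta> G (carrier G)"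
proof (cases "A_o G = {}")
  case True then show ?thesis using abelian_family_zero by metis
next
  case False
  then obtain A0 where A0: "A0 \<in> A_o G" by blast
  have "A \<in> A_o G \<longleftrightarrow> A \<in> abelian_family p (card A0) i (\<lambda>_. 0) G (carrier G)" for A
  proof -
    have "A \<in> A_o G \<longleftrightarrow> A \<in> abelian_subgroups G \<and> card A = card A0"
      using A0 unfolding A_o_def by (auto intro: le_antisym)
    then show ?thesis unfolding mem_abelian_family_exp_iff using lex_ge_omega_zero by blast
  qed
  then show ?thesis by blast
qed

lemma omega_mono:
  assumes "A \<in> abelian_subgroups G" "A' \<in> abelian_subgroups G" "A \<subseteq> A'"
  shows "omega p (G \<restriction>\<^sub>g A) j \<le> omega p (G \<restriction>\<^sub>g A') j"
proof -
  have "subgroup A' G" using assms(2) abelian_subgroups_iff by blast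
  then have "finite (torsion G (p ^ j) A')" by (rule finite_subset[OF torsion_subset subgroup_finite])
  moreover have "torsion G (p ^ j) A \<subseteq> torsion G (p ^ j) A'" using assms(3) by (auto simp: torsion_def)
  ultimately show ?thesis unfolding omega_eq[OF assms(1)] omega_eq[OF assms(2)] by (simp add: card_mono)
qed

text \<open>At level i the torsion is the whole subgroup, so the sequence of the \<omega>_j
  determines the order; this ties lexicographic optimality to a fixed order.\<close>

lemma omega_i: "A \<in> abelian_subgroups G \<Longrightarrow> omega p (G \<restriction>\<^sub>g A) i = int (card A)"
proof -
  assume A: "A \<in> abelian_subgroups G"
  then have "subgroup A G" using abelian_subgroups_iff by blast
  then have "torsion G (p ^ i) A = A"
    unfolding torsion_def using exp_G subgroup.mem_carrier[of A G] by blast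
  then show ?thesis using omega_eq[OF A] by simp
qed

text \<open>Fix an optimal member A0. Optimality then means being lexicographically at least A0, and
  equality of the sequences at index i gives equality of orders.\<close>

lemma A_lex_family: "\<exists>N \<zeta>. A_lex p G = abelian_family p N i \<zeta> G (carrier G)"
proof (cases "A_lex p G = {}")
  case True then show ?thesis using abelian_family_zero by metis
next
  case False
  let ?\<omega> = "\<lambda>A. omega p (G \<restriction>\<^sub>g A)"
  obtain A0 where A0: "A0 \<in> A_lex p G" using False by blast
  then have A0': "A0 \<in> abelian_subgroups G" "\<And>A. A \<in> abelian_subgroups G \<Longrightarrow> lex_ge (?\<omega> A0) (?\<omega> A)"
    unfolding A_lex_def by auto
  have "A \<in> A_lex p G \<longleftrightarrow> A \<in> abelian_family p (card A0) i (?\<omega> A0) G (carrier G)" for A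
  proof
    assume "A \<in> A_lex p G"
    then have A: "A \<in> abelian_subgroups G" "lex_ge (?\<omega> A) (?\<omega> A0)" using A0' unfolding A_lex_def by auto
    have "?\<omega> A i = ?\<omega> A0 i" by (rule lex_ge_antisym[OF A(2) A0'(2)[OF A(1)] i])
    then show "A \<in> abelian_family p (card A0) i (?\<omega> A0) G (carrier G)"
      unfolding mem_abelian_family_exp_iff using A omega_i A0'(1) by simp
  next
    assume "A \<in> abelian_family p (card A0) i (?\<omega> A0) G (carrier G)"
    then have A: "A \<in> abelian_subgroups G" "lex_ge (?\<omega> A) (?\<omega> A0)" unfolding mem_abelian_family_exp_iff by auto
    then show "A \<in> A_lex p G" unfolding A_lex_def using lex_ge_trans[OF A(2) A0'(2)] by blast
  qed
  then show ?thesis by blast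
qed

lemma A_olex_family: "\<exists>N \<zeta>. A_olex p G = abelian_family p N i \<zeta> G (carrier G)"
proof (cases "A_olex p G = {}")
  case True then show ?thesis using abelian_family_zero by metis
next
  case False
  let ?\<omega> = "\<lambda>A. omega p (G \<restriction>\<^sub>g A)"
  obtain A0 where A0: "A0 \<in> A_olex p G" using False by blast
  then have A0': "A0 \<in> A_o G" "\<And>A. A \<in> A_o G \<Longrightarrow> lex_ge (?\<omega> A0) (?\<omega> A)" unfolding A_olex_def by auto
  have o: "A \<in> A_o G \<longleftrightarrow> A \<in> abelian_subgroups G \<and> card A = card A0" for A
    using A0'(1) unfolding A_o_def by (auto intro: le_antisym)
  have "A \<in> A_olex p G \<longleftrightarrow> A \<in> abelian_family p (card A0) i (?\<omega> A0) G (carrier G)" for A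
  proof
    assume "A \<in> A_olex p G"
    then have A: "A \<in> A_o G" "lex_ge (?\<omega> A) (?\<omega> A0)" using A0' unfolding A_olex_def by auto
    then show "A \<in> abelian_family p (card A0) i (?\<omega> A0) G (carrier G)"
      unfolding mem_abelian_family_exp_iff using o by blast
  next
    assume "A \<in> abelian_family p (card A0) i (?\<omega> A0) G (carrier G)"
    then have A: "A \<in> A_o G" "lex_ge (?\<omega> A) (?\<omega> A0)" unfolding mem_abelian_family_exp_iff using o by auto
    then show "A \<in> A_olex p G" unfolding A_olex_def using lex_ge_trans[OF A(2) A0'(2)] by blast
  qed
  then show ?thesis by blast
qed

lemma elementary_abelian_iff:
  assumes "A \<in> abelian_subgroups G"
  shows "elementary_abelian p (G \<restriction>\<^sub>g A) \<longleftrightarrow> (\<forall>x\<in>A. x [^] p = \<one>)"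
proof -
  have pw: "x [^]\<^bsub>G \<restriction>\<^sub>g A\<^esub> (n::nat) = x [^] n" for x n by (simp add: nat_pow_def)
  show ?thesis using assms unfolding elementary_abelian_def abelian_subgroups_def pw by simp
qed

lemma card_elementary:
  assumes A: "A \<in> abelian_subgroups G" and e: "elementary_abelian p (G \<restriction>\<^sub>g A)"
  shows "card A = p ^ min_generators (G \<restriction>\<^sub>g A)"
proof -
  have sA: "subgroup A G" using A abelian_subgroups_iff by blast
  interpret A: group "G \<restriction>\<^sub>g A" by (rule subgroup_imp_group[OF sA])
  obtain t where "card A = p ^ t" using subgroup_card[OF sA] .
  then show ?thesis using A.card_elementary_abelian[OF p _ e, of t] by (simp add: order_def)
qed

lemma rank_abelian:
  assumes A: "A \<in> abelian_subgroups G" shows "rank (G \<restriction>\<^sub>g A) = min_generators (G \<restriction>\<^sub>g A)"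
  using A unfolding abelian_subgroups_def rank_def by simp

text \<open>For an elementary abelian group the rank is the logarithm of the order to base p, so the
  rank condition becomes a prescribed order, with exponent bound p and the void bound 0.\<close>

lemma A_e_family: "\<exists>N \<zeta>. A_e p G = abelian_family p N 1 \<zeta> G (carrier G)"
proof -
  have "A \<in> A_e p G \<longleftrightarrow> A \<in> abelian_family p (p ^ rank G) 1 (\<lambda>_. 0) G (carrier G)" for A
  proof (cases "A \<in> abelian_subgroups G \<and> (\<forall>x\<in>A. x [^] p = \<one>)")
    case True
    then have A: "A \<in> abelian_subgroups G" "elementary_abelian p (G \<restriction>\<^sub>g A)" using elementary_abelian_iff by auto
    have "rank (G \<restriction>\<^sub>g A) = rank G \<longleftrightarrow> card A = p ^ rank G"
      unfolding card_elementary[OF A] rank_abelian[OF A(1)] using prime_gt_1_nat[OF p] by simp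
    then show ?thesis unfolding A_e_def mem_abelian_family_iff using A True lex_ge_omega_zero by simp
  next
    case False
    then show ?thesis unfolding A_e_def mem_abelian_family_iff using elementary_abelian_iff by auto
  qed
  then show ?thesis by blast
qed

text \<open>Two cases, because \<open>rank\<close> of an abelian group counts its own generators
  instead of taking a maximum over subgroups. There the elementary subgroup lies in the p-torsion,
  whose order the generators bound.\<close>

lemma elementary_card_le_rank:
  assumes A: "A \<in> abelian_subgroups G" and e: "elementary_abelian p (G \<restriction>\<^sub>g A)"
  shows "card A \<le> p ^ rank G"
proof (cases "comm_group G")
  case True
  then interpret c: comm_group G .
  have sA: "subgroup A G" using A abelian_subgroups_iff by blast
  obtain U where U: "U \<subseteq> carrier G" "finite U" "card U = min_generators G" "generate G U = carrier G"
    using min_generators_attained[OF finite_G] .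
  have "A \<subseteq> torsion G p (carrier G)"
    using e elementary_abelian_iff[OF A] subgroup.mem_carrier[OF sA] by (auto simp: torsion_def)
  then have "card A \<le> card (torsion G p (carrier G))"
    using finite_subset[OF torsion_subset finite_G] by (intro card_mono)
  also have "\<dots> \<le> p ^ card U" by (rule card_torsion_le_generators[OF p finite_G c.m_comm U(1,2,4)])
  finally show ?thesis using True U(3) by (simp add: rank_def)
next
  case False
  let ?M = "{min_generators (G \<restriction>\<^sub>g A) | A. A \<in> abelian_subgroups G}"
  have "abelian_subgroups G \<subseteq> Pow (carrier G)"
    using abelian_subgroups_iff subgroup.subset by blast
  then have "finite (abelian_subgroups G)" using finite_G by (simp add: finite_subset)
  then have "finite ?M" by simp
  moreover have "min_generators (G \<restriction>\<^sub>g A) \<in> ?M" using A by blast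
  ultimately have "min_generators (G \<restriction>\<^sub>g A) \<le> rank G" using False by (simp add: rank_def)
  then show ?thesis unfolding card_elementary[OF A e] using prime_gt_0_nat[OF p] by (simp add: power_increasing)
qed

lemma abelian_extension:
  assumes A: "A \<in> abelian_subgroups G" and x: "x \<in> carrier G" "\<And>a. a \<in> A \<Longrightarrow> x \<otimes> a = a \<otimes> x"
  shows "\<exists>A'\<in>abelian_subgroups G. A \<subseteq> A' \<and> x \<in> A' \<and> finite A' \<and>
    (\<forall>n::nat. (\<forall>a\<in>A. a [^] n = \<one>) \<longrightarrow> x [^] n = \<one> \<longrightarrow> (\<forall>a\<in>A'. a [^] n = \<one>))"
proof -
  have A': "subgroup A G" "\<And>x y. x \<in> A \<Longrightarrow> y \<in> A \<Longrightarrow> x \<otimes> y = y \<otimes> x"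
    using A abelian_subgroups_iff[of A] by blast+
  show ?thesis
  proof (rule adjoin_abelian[OF A' x])
    fix B assume B: "subgroup B G" "A \<subseteq> B" "x \<in> B" "\<And>y z. y \<in> B \<Longrightarrow> z \<in> B \<Longrightarrow> y \<otimes> z = z \<otimes> y"
      "\<And>n a. (\<And>a. a \<in> A \<Longrightarrow> a [^] (n::nat) = \<one>) \<Longrightarrow> x [^] n = \<one> \<Longrightarrow> a \<in> B \<Longrightarrow> a [^] n = \<one>"
    show ?thesis
    proof (intro bexI[of _ B] conjI allI impI ballI)
      show "B \<in> abelian_subgroups G" using B(1,4) abelian_subgroups_iff[of B] by blast
      show "A \<subseteq> B" "x \<in> B" "finite B" using B(2,3) subgroup_finite[OF B(1)] by auto
      show "a [^] n = \<one>" if "\<forall>a\<in>A. a [^] n = \<one>" "x [^] n = \<one>" "a \<in> B" for n :: nat and a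
        by (rule B(5)) (use that in auto)
    qed
  qed
qed

lemma A_o_self_centralizing:
  assumes A: "A \<in> A_o G" and x: "x \<in> carrier G" "\<And>a. a \<in> A \<Longrightarrow> x \<otimes> a = a \<otimes> x" shows "x \<in> A"
proof -
  have ab: "A \<in> abelian_subgroups G" using A by (simp add: A_o_def)
  obtain A' where A': "A' \<in> abelian_subgroups G" "A \<subseteq> A'" "x \<in> A'" "finite A'"
    using abelian_extension[OF ab x] by blast
  have "card A' \<le> card A" using A A'(1) by (simp add: A_o_def)
  then have "A = A'" using card_seteq[OF A'(4,2)] by simp
  then show ?thesis using A'(3) by simp
qed

text \<open>Adjoining x yields an abelian subgroup with every \<omega>_j at least as large.
  Optimality forces equality, and equality at index i is equality of orders.\<close>

lemma A_lex_self_centralizing: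
  assumes A: "A \<in> A_lex p G" and x: "x \<in> carrier G" "\<And>a. a \<in> A \<Longrightarrow> x \<otimes> a = a \<otimes> x" shows "x \<in> A"
proof -
  have ab: "A \<in> abelian_subgroups G" using A by (simp add: A_lex_def)
  obtain A' where A': "A' \<in> abelian_subgroups G" "A \<subseteq> A'" "x \<in> A'" "finite A'"
    using abelian_extension[OF ab x] by blast
  have "lex_ge (omega p (G \<restriction>\<^sub>g A)) (omega p (G \<restriction>\<^sub>g A'))" using A A'(1) by (simp add: A_lex_def)
  then have "omega p (G \<restriction>\<^sub>g A) i = omega p (G \<restriction>\<^sub>g A') i"
    by (rule lex_ge_le_imp_eq[OF _ omega_mono[OF ab A'(1,2)] i])
  then have "card A' \<le> card A" using omega_i[OF ab] omega_i[OF A'(1)] by simp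
  then have "A = A'" using card_seteq[OF A'(4,2)] by simp
  then show ?thesis using A'(3) by simp
qed

text \<open>The condition x^p = 1 keeps the extension elementary abelian, so that the rank bounds
  its order. Since it restricts x, \<open>Omega p 1\<close> has to be applied to the center of the
  subgroup generated by these members.\<close>

lemma A_e_centralizing:
  assumes A: "A \<in> A_e p G" and x: "x \<in> carrier G" "\<And>a. a \<in> A \<Longrightarrow> x \<otimes> a = a \<otimes> x" "x [^] p = \<one>" shows "x \<in> A"
proof -
  have ab: "A \<in> abelian_subgroups G" and e: "elementary_abelian p (G \<restriction>\<^sub>g A)" and r: "rank (G \<restriction>\<^sub>g A) = rank G"
    using A by (auto simp: A_e_def)
  obtain A' where A': "A' \<in> abelian_subgroups G" "A \<subseteq> A'" "x \<in> A'" "finite A'"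
    "\<forall>n::nat. (\<forall>a\<in>A. a [^] n = \<one>) \<longrightarrow> x [^] n = \<one> \<longrightarrow> (\<forall>a\<in>A'. a [^] n = \<one>)"
    using abelian_extension[OF ab x(1,2)] by blast
  have "\<forall>a\<in>A'. a [^] p = \<one>" using A'(5)[rule_format, of p] e elementary_abelian_iff[OF ab] x(3) by blast
  then have "card A' \<le> p ^ rank G" using elementary_card_le_rank[OF A'(1)] elementary_abelian_iff[OF A'(1)] by blast
  also have "\<dots> = card A" using card_elementary[OF ab e] rank_abelian[OF ab] r by simp
  finally have "A = A'" using card_seteq[OF A'(4,2)] by simp
  then show ?thesis using A'(3) by simp
qed

lemma center_J_o: "\<exists>N \<zeta>. center (G \<restriction>\<^sub>g J_gen G (A_o G)) = I_int G (abelian_family p N i \<zeta> G (carrier G))"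
proof -
  have "A_o G \<subseteq> abelian_subgroups G" by (auto simp: A_o_def)
  then have "center (G \<restriction>\<^sub>g J_gen G (A_o G)) = I_int G (A_o G)"
    by (rule center_J_gen_eq_I_int) (rule A_o_self_centralizing)
  then show ?thesis using A_o_family by metis
qed

lemma center_J_lex: "\<exists>N \<zeta>. center (G \<restriction>\<^sub>g J_gen G (A_lex p G)) = I_int G (abelian_family p N i \<zeta> G (carrier G))"
proof -
  have "A_lex p G \<subseteq> abelian_subgroups G" by (auto simp: A_lex_def)
  then have "center (G \<restriction>\<^sub>g J_gen G (A_lex p G)) = I_int G (A_lex p G)"
    by (rule center_J_gen_eq_I_int) (rule A_lex_self_centralizing)
  then show ?thesis using A_lex_family by metis
qed

lemma center_J_olex: "\<exists>N \<zeta>. center (G \<restriction>\<^sub>g J_gen G (A_olex p G)) = I_int G (abelian_family p N i \<zeta> G (carrier G))"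
proof -
  have o: "A_olex p G \<subseteq> A_o G" by (auto simp: A_olex_def)
  then have "A_olex p G \<subseteq> abelian_subgroups G" by (auto simp: A_o_def)
  then have "center (G \<restriction>\<^sub>g J_gen G (A_olex p G)) = I_int G (A_olex p G)"
  proof (rule center_J_gen_eq_I_int)
    show "x \<in> A" if "A \<in> A_olex p G" "x \<in> carrier G" "\<And>a. a \<in> A \<Longrightarrow> x \<otimes> a = a \<otimes> x" for A x
      using o that(1) by (intro A_o_self_centralizing[OF _ that(2,3)]) auto
  qed
  then show ?thesis using A_olex_family by metis
qed

lemma mem_center_subgroup_iff: "z \<in> center (G \<restriction>\<^sub>g H) \<longleftrightarrow> z \<in> H \<and> (\<forall>g\<in>H. g \<otimes> z = z \<otimes> g)"
  by (simp add: center_def)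

lemma Omega_center_J_e:
  "\<exists>N \<zeta>. Omega p 1 (G \<restriction>\<^sub>g center (G \<restriction>\<^sub>g J_gen G (A_e p G))) = I_int G (abelian_family p N 1 \<zeta> G (carrier G))"
proof -
  let ?\<A> = "A_e p G" and ?Z = "center (G \<restriction>\<^sub>g J_gen G (A_e p G))"
  have ab: "?\<A> \<subseteq> abelian_subgroups G" by (auto simp: A_e_def)
  note mem = mem_center_J_gen_iff[OF ab]
  have sJ: "subgroup (J_gen G ?\<A>) G" by (rule J_gen_subgroup[OF abelian_subgroups_Union[OF ab]])
  have JG: "\<And>z. z \<in> J_gen G ?\<A> \<Longrightarrow> z \<in> carrier G" by (rule subgroup.mem_carrier[OF sJ])
  have Zc: "z \<otimes> w = w \<otimes> z" if "z \<in> ?Z" "w \<in> ?Z" for z w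
    using that unfolding mem_center_subgroup_iff by blast
  have AG: "\<And>A a. A \<in> ?\<A> \<Longrightarrow> a \<in> A \<Longrightarrow> a \<in> carrier G" using abelian_subgroups_Union[OF ab] by blast
  have iffc: "z \<in> ?Z \<longleftrightarrow> z \<in> J_gen G ?\<A> \<and> (\<forall>A\<in>?\<A>. \<forall>a\<in>A. conjug z a = a)" for z
  proof -
    have "conjug z a = a \<longleftrightarrow> z \<otimes> a = a \<otimes> z" if "z \<in> J_gen G ?\<A>" "A \<in> ?\<A>" "a \<in> A" for A a
      by (rule conj_eq_iff[OF JG[OF that(1)] AG[OF that(2,3)]])
    then show ?thesis unfolding mem by blast
  qed
  have sZ: "subgroup ?Z G"
  proof (rule subgroupI)
    show "?Z \<subseteq> carrier G" using JG mem by blast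
    have "\<one> \<in> ?Z" unfolding iffc using subgroup.one_closed[OF sJ] AG by simp
    then show "?Z \<noteq> {}" by blast
    show "inv z \<in> ?Z" if z: "z \<in> ?Z" for z
    proof -
      have "conjug (inv z) a = a" if a: "A \<in> ?\<A>" "a \<in> A" for A a
        using conj_inv_conj(2)[OF JG AG[OF a], of z] z a unfolding iffc by auto
      then show ?thesis using z subgroup.m_inv_closed[OF sJ] unfolding iffc by blast
    qed
    show "z \<otimes> w \<in> ?Z" if z: "z \<in> ?Z" and w: "w \<in> ?Z" for z w
    proof -
      have "conjug (z \<otimes> w) a = a" if a: "A \<in> ?\<A>" "a \<in> A" for A a
        using conj_conj[OF JG JG AG[OF a], of z w] z w a unfolding iffc by auto
      then show ?thesis using z w subgroup.m_closed[OF sJ] unfolding iffc by blast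
    qed
  qed
  obtain t where "card ?Z = p ^ t" using subgroup_card[OF sZ] .
  then have "Omega p 1 (G \<restriction>\<^sub>g ?Z) = torsion G (p ^ 1) ?Z" by (rule Omega_eq_torsion[OF p sZ]) (rule Zc)
  also have "\<dots> = I_int G ?\<A>"
  proof (cases "?\<A> = {}")
    case True
    then have "?Z = {\<one>}" by (auto simp: center_def J_gen_def generate_empty)
    then show ?thesis using True by (auto simp: torsion_def I_int_def)
  next
    case False
    have "z \<in> torsion G (p ^ 1) ?Z \<longleftrightarrow> z \<in> \<Inter>?\<A>" for z
    proof
      assume "z \<in> torsion G (p ^ 1) ?Z"
      then have z: "z \<in> ?Z" "z [^] p = \<one>" by (auto simp: torsion_def)
      then have "z \<in> carrier G" "\<forall>A\<in>?\<A>. \<forall>a\<in>A. z \<otimes> a = a \<otimes> z" using mem JG by auto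
      then show "z \<in> \<Inter>?\<A>" using A_e_centralizing z(2) by blast
    next
      assume z: "z \<in> \<Inter>?\<A>"
      then have "z \<in> J_gen G ?\<A>" unfolding J_gen_def using False by (intro generate.incl) blast
      moreover have "z \<otimes> a = a \<otimes> z" if "A \<in> ?\<A>" "a \<in> A" for A a
        using z that ab abelian_subgroups_iff[of A] by blast
      moreover have "z [^] p = \<one>"
      proof -
        obtain A where A: "A \<in> ?\<A>" using False by blast
        then show ?thesis using z elementary_abelian_iff[of A] unfolding A_e_def by blast
      qed
      ultimately show "z \<in> torsion G (p ^ 1) ?Z" using mem by (simp add: torsion_def)
    qed
    then show ?thesis unfolding I_int_def using False by auto
  qed
  finally show ?thesis using A_e_family by metis
qed

text \<open>Orders and exponents are at least 1, so a negative m or e leaves the family empty.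
  Otherwise the exponent bound may be capped at \<open>i\<close>, since the group has exponent
  dividing p^i; the cap permits the passage from Omega_i(S) to \<open>S\<close>.\<close>

lemma A_bounded_family: "\<exists>N k \<xi>. k \<le> i \<and> A_bounded p m e \<zeta> G = abelian_family p N k \<xi> G (carrier G)"
proof (cases "m < 0 \<or> e < 0")
  case True
  have "A_bounded p m e \<zeta> G = {}"
  proof -
    have False if A: "A \<in> A_bounded p m e \<zeta> G" for A
    proof -
      have sA: "subgroup A G" using A abelian_subgroups_iff by (simp add: A_bounded_def)
      have "card A \<ge> 1" "group_exponent (G \<restriction>\<^sub>g A) \<ge> 1"
        using subgroup_card_pos[OF sA] group_exponent_pos_pow(1)[OF sA subgroup_finite[OF sA]] by simp_all
      then have "(of_nat (card A) :: rat) \<ge> 1" "(of_nat (group_exponent (G \<restriction>\<^sub>g A)) :: rat) \<ge> 1"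
        by simp_all
      then have "(of_nat p :: rat) powi m \<ge> 1" "(of_nat p :: rat) powi e \<ge> 1"
        using A by (auto simp: A_bounded_def)
      then show False using True power_int_neg_less_one[OF prime_gt_1_nat[OF p]] by (metis not_less)
    qed
    then show ?thesis by blast
  qed
  then show ?thesis using abelian_family_zero by (metis le0)
next
  case False
  then obtain a b where ab: "m = int a" "e = int b" using nonneg_int_cases by (metis not_less)
  have "A \<in> A_bounded p m e \<zeta> G \<longleftrightarrow> A \<in> abelian_family p (p ^ a) (min b i) \<zeta> G (carrier G)" for A
  proof (cases "A \<in> abelian_subgroups G")
    case True
    then have sA: "subgroup A G" using abelian_subgroups_iff by blast
    obtain t where t: "card A = p ^ t" using subgroup_card[OF sA] .
    have "(of_nat (card A) :: rat) = of_nat p powi m \<longleftrightarrow> card A = p ^ a"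
      unfolding ab power_int_of_nat by (metis of_nat_eq_iff of_nat_power)
    moreover have "(of_nat (group_exponent (G \<restriction>\<^sub>g A)) :: rat) \<le> of_nat p powi e \<longleftrightarrow> group_exponent (G \<restriction>\<^sub>g A) \<le> p ^ b"
      unfolding ab power_int_of_nat by (metis of_nat_le_iff of_nat_power)
    moreover have "\<dots> \<longleftrightarrow> (\<forall>x\<in>A. x [^] (p ^ b) = \<one>)" by (rule group_exponent_le_iff[OF p sA t])
    moreover have "\<dots> \<longleftrightarrow> (\<forall>x\<in>A. x [^] (p ^ min b i) = \<one>)"
    proof (cases "b \<le> i")
      case False
      have "x [^] (p ^ b) = \<one>" if x: "x \<in> carrier G" for x
      proof -
        have "p ^ b = p ^ i * p ^ (b - i)" using False by (simp flip: power_add)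
        then have "x [^] (p ^ b) = (x [^] (p ^ i)) [^] (p ^ (b - i))" using x by (simp add: nat_pow_pow)
        then show ?thesis using exp_G[OF x] by simp
      qed
      then show ?thesis using False exp_G subgroup.mem_carrier[OF sA] by (simp add: min_def)
    qed simp
    ultimately show ?thesis unfolding A_bounded_def mem_abelian_family_iff using True by simp
  next
    case False
    then show ?thesis unfolding A_bounded_def mem_abelian_family_iff by simp
  qed
  then have "A_bounded p m e \<zeta> G = abelian_family p (p ^ a) (min b i) \<zeta> G (carrier G)" by blast
  then show ?thesis by (metis min.cobounded2)
qed

end

text \<open>The exponent bound forces every member of the family over \<open>G\<close> into
  \<open>H\<close>. With \<open>H\<close> = Omega_i(S) and k \<le> i this identifies families over D
  with families over \<open>S\<close>.\<close>

lemma abelian_family_subgroup: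
  assumes H: "subgroup H G" and T: "\<And>x. x \<in> carrier G \<Longrightarrow> x [^] (p ^ k) = \<one> \<Longrightarrow> x \<in> H"
  shows "abelian_family p N k \<zeta> (G \<restriction>\<^sub>g H) H = abelian_family p N k \<zeta> G (carrier G)"
proof -
  have pw: "x [^]\<^bsub>G \<restriction>\<^sub>g H\<^esub> (n::nat) = x [^] n" for x n by (simp add: nat_pow_def)
  have t: "torsion (G \<restriction>\<^sub>g H) n A = torsion G n A" for n A unfolding torsion_def pw by simp
  have "subgroup A (G \<restriction>\<^sub>g H) \<and> A \<subseteq> H \<longleftrightarrow> subgroup A G \<and> A \<subseteq> carrier G"
    if e: "\<forall>x\<in>A. x [^] (p ^ k) = \<one>" for A
  proof
    assume "subgroup A (G \<restriction>\<^sub>g H) \<and> A \<subseteq> H"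
    then have "subgroup A G" using incl_subgroup[OF H] by blast
    then show "subgroup A G \<and> A \<subseteq> carrier G" using subgroup.subset by blast
  next
    assume A: "subgroup A G \<and> A \<subseteq> carrier G"
    then have "A \<subseteq> H" using T e by blast
    then show "subgroup A (G \<restriction>\<^sub>g H) \<and> A \<subseteq> H" using subgroup_incl[of A H] A H by blast
  qed
  then show ?thesis unfolding abelian_family_def pw t by auto
qed

end

lemma glauberman_property_instances:
  fixes p i :: nat and S :: "('a, 'm) monoid_scheme"
  assumes p: "Factorial_Ring.prime p" "odd p" and S: "p_group p S" and i: "i \<ge> 1"
    and e: "group_exponent (S \<restriction>\<^sub>g Omega p i S) \<le> p ^ i"
  defines "D \<equiv> S \<restriction>\<^sub>g Omega p i S"
  shows "glauberman_property TYPE('g) p S (center (D \<restriction>\<^sub>g J_gen D (A_o D)))"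
    and "glauberman_property TYPE('g) p S (Omega p 1 (D \<restriction>\<^sub>g center (D \<restriction>\<^sub>g J_gen D (A_e p D))))"
    and "glauberman_property TYPE('g) p S (center (D \<restriction>\<^sub>g J_gen D (A_lex p D)))"
    and "glauberman_property TYPE('g) p S (center (D \<restriction>\<^sub>g J_gen D (A_olex p D)))"
    and "glauberman_property TYPE('g) p S (I_int D (A_bounded p m e' \<zeta> D))"
proof -
  interpret S: group S using S by (simp add: p_group_def)
  obtain n where n: "card (carrier S) = p ^ n" using S by (auto simp: p_group_def order_def)
  have fS: "finite (carrier S)" using n p by (metis card.infinite not_prime_0 power_eq_0_iff)
  have sO: "subgroup (Omega p i S) S" unfolding Omega_def by (rule S.generate_is_subgroup) blast
  have "card (Omega p i S) dvd p ^ n"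
    using S.card_subgroup_dvd[OF S.subgroup_self fS sO subgroup.subset[OF sO]] n by simp
  then obtain s where s: "card (Omega p i S) = p ^ s" using divides_primepow_nat[OF p(1)] by blast
  interpret D: group D unfolding D_def by (rule S.subgroup_imp_group[OF sO])
  have pw: "x [^]\<^bsub>D\<^esub> (n::nat) = x [^]\<^bsub>S\<^esub> n" for x n unfolding D_def by (simp add: nat_pow_def)
  have cD: "card (carrier D) = p ^ s" using s by (simp add: D_def)
  have eD: "x [^]\<^bsub>D\<^esub> (p ^ i) = \<one>\<^bsub>D\<^esub>" if "x \<in> carrier D" for x
    using S.group_exponent_le_iff[OF p(1) sO s, of i] e that unfolding pw by (simp add: D_def)
  have T: "x \<in> Omega p i S" if x: "x \<in> carrier S" "x [^]\<^bsub>S\<^esub> (p ^ k) = \<one>\<^bsub>S\<^esub>" and k: "k \<le> i" for x k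
  proof -
    have "S.ord x \<le> p ^ k" using S.ord_le_prime_power_iff[OF p(1) S.subgroup_self n x(1)] x(2) by simp
    also have "\<dots> \<le> p ^ i" using k prime_gt_0_nat[OF p(1)] by (simp add: power_increasing)
    finally show ?thesis unfolding Omega_def using x(1) by (intro generate.incl) simp
  qed
  have *: "glauberman_property TYPE('g) p S (I_int D (abelian_family p N k \<xi> D (carrier D)))" if k: "k \<le> i" for N k \<xi>
  proof -
    have "abelian_family p N k \<xi> D (carrier D) = abelian_family p N k \<xi> S (carrier S)"
      unfolding D_def using S.abelian_family_subgroup[OF sO, of p k N \<xi>] T[OF _ _ k] by simp
    then have "I_int D (abelian_family p N k \<xi> D (carrier D)) = family_core p N k \<xi> S (carrier S)"
      unfolding family_core_def by (simp add: I_int_def D_def)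
    then show ?thesis using glauberman_property_family_core[OF p S] by simp
  qed
  note ctx = p(1) cD i eD
  show "glauberman_property TYPE('g) p S (center (D \<restriction>\<^sub>g J_gen D (A_o D)))"
    using D.center_J_o[OF ctx] *[of i] by auto
  show "glauberman_property TYPE('g) p S (Omega p 1 (D \<restriction>\<^sub>g center (D \<restriction>\<^sub>g J_gen D (A_e p D))))"
    using D.Omega_center_J_e[OF ctx] *[OF i] by auto
  show "glauberman_property TYPE('g) p S (center (D \<restriction>\<^sub>g J_gen D (A_lex p D)))"
    using D.center_J_lex[OF ctx] *[of i] by auto
  show "glauberman_property TYPE('g) p S (center (D \<restriction>\<^sub>g J_gen D (A_olex p D)))"
    using D.center_J_olex[OF ctx] *[of i] by auto
  show "glauberman_property TYPE('g) p S (I_int D (A_bounded p m e' \<zeta> D))"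
    using D.A_bounded_family[OF ctx, of m e' \<zeta>] * by auto
qed

section \<open>Exponents in \<open>p\<close>-groups of small class\<close>

text \<open>From j (q choose j) = q (q-1 choose j-1) for q = p^i, with j prime to p.\<close>

lemma prime_power_dvd_choose:
  assumes p: "Factorial_Ring.prime p" and j: "0 < j" "j < p" shows "p ^ i dvd (p ^ i choose j)"
proof -
  have "\<not> p dvd j" using j by (auto dest: dvd_imp_le)
  then have c: "coprime (p ^ i) j" using p by (simp add: prime_imp_coprime)
  have "j * (p ^ i choose j) = p ^ i * (p ^ i - 1 choose (j - 1))"
    by (rule times_binomial_minus1_eq[OF j(1)])
  then have "p ^ i dvd j * (p ^ i choose j)" by simp
  then show ?thesis using c by (simp add: coprime_dvd_mult_right_iff)
qed

section \<open>The lower central series of a subgroup\<close>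

context group
begin

lemma hall_witt:
  assumes "x \<in> carrier G" "y \<in> carrier G" "z \<in> carrier G"
  shows "conjug (inv y) (comm (comm x (inv y)) z) \<otimes> conjug (inv z) (comm (comm y (inv z)) x)
    \<otimes> conjug (inv x) (comm (comm z (inv x)) y) = \<one>"
  using assms by (simp add: word_simps)

lemma mult3_eq_one:
  assumes "a \<otimes> b \<otimes> c = \<one>" "a \<in> carrier G" "b \<in> carrier G" "c \<in> carrier G"
  shows "b = inv a \<otimes> inv c"
proof -
  have "b = inv a \<otimes> (a \<otimes> b \<otimes> c) \<otimes> inv c" using assms(2-4) by (simp add: m_assoc)
  then show ?thesis using assms by simp
qed

text \<open>Commutators are formed in the ambient group, so that the series of different subgroups
  can be compared. Index n stands for gamma_(n+1).\<close>

primrec lower_series :: "'a set \<Rightarrow> nat \<Rightarrow> 'a set" where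
  "lower_series H 0 = H"
| "lower_series H (Suc n) = generate G {comm x y | x y. x \<in> lower_series H n \<and> y \<in> H}"

lemma lower_central_eq: "lower_central G n = lower_series (carrier G) n"
  by (induction n) (simp_all add: comm_def)

declare lower_series.simps(2) [simp del]

text \<open>The preimage of the centralizer of g modulo \<open>N\<close>, without the quotient. It
  reduces inclusions between commutator subgroups to generators.\<close>

lemma comm_mod_subgroup:
  assumes H: "subgroup H G" and N: "subgroup N G" and n: "\<And>h x. h \<in> H \<Longrightarrow> x \<in> N \<Longrightarrow> conjug h x \<in> N"
    and g: "g \<in> H"
  shows "subgroup {k \<in> H. comm k g \<in> N} G"
proof (rule subgroupI)
  have HG: "\<And>h. h \<in> H \<Longrightarrow> h \<in> carrier G" using subgroup.mem_carrier[OF H] .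
  show "{k \<in> H. comm k g \<in> N} \<subseteq> carrier G" using HG by blast
  have "\<one> \<in> {k \<in> H. comm k g \<in> N}" using subgroup.one_closed[OF H] subgroup.one_closed[OF N] HG[OF g]
    by (simp add: comm_def)
  then show "{k \<in> H. comm k g \<in> N} \<noteq> {}" by blast
  show "inv a \<in> {k \<in> H. comm k g \<in> N}" if "a \<in> {k \<in> H. comm k g \<in> N}" for a
  proof -
    have a: "a \<in> H" "comm a g \<in> N" using that by auto
    have "comm (inv a) g = conjug a (inv (comm a g))" using a g HG by (simp add: comm_inv_left)
    then show ?thesis using n[OF a(1) subgroup.m_inv_closed[OF N a(2)]] subgroup.m_inv_closed[OF H a(1)] by simp
  qed
  show "a \<otimes> b \<in> {k \<in> H. comm k g \<in> N}" if "a \<in> {k \<in> H. comm k g \<in> N}" "b \<in> {k \<in> H. comm k g \<in> N}" for a b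
  proof -
    have a: "a \<in> H" "comm a g \<in> N" "b \<in> H" "comm b g \<in> N" using that by auto
    have "comm (a \<otimes> b) g = conjug (inv b) (comm a g) \<otimes> comm b g" using a g HG by (simp add: comm_mult_left)
    then show ?thesis
      using subgroup.m_closed[OF N n[OF subgroup.m_inv_closed[OF H a(3)] a(2)] a(4)] subgroup.m_closed[OF H a(1,3)]
      by simp
  qed
qed

lemma comm_swap_mem:
  assumes "subgroup N G" "x \<in> carrier G" "y \<in> carrier G" "comm x y \<in> N" shows "comm y x \<in> N"
  using subgroup.m_inv_closed[OF assms(1,4)] inv_comm_eq[OF assms(2,3)] by simp

lemma lower_series_normal:
  assumes H: "subgroup H G"
  shows "subgroup (lower_series H n) G \<and> lower_series H n \<subseteq> H \<and>
    (\<forall>h\<in>H. \<forall>x\<in>lower_series H n. conjug h x \<in> lower_series H n)"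
proof (induction n)
  case 0
  then show ?case using H subgroup_conj[OF H] by simp
next
  case (Suc n)
  let ?L = "lower_series H n" and ?C = "{comm x y | x y. x \<in> lower_series H n \<and> y \<in> H}"
  have HG: "\<And>h. h \<in> H \<Longrightarrow> h \<in> carrier G" using subgroup.mem_carrier[OF H] .
  have CH: "?C \<subseteq> H" using Suc subgroup_comm[OF H] by blast
  then have CG: "?C \<subseteq> carrier G" using HG by blast
  have "conjug h x \<in> ?C" if h: "h \<in> H" and x: "x \<in> ?C" for h x
  proof -
    obtain u v where uv: "u \<in> ?L" "v \<in> H" "x = comm u v" using x by blast
    have uH: "u \<in> H" using uv(1) Suc by blast
    have "conjug h x = comm (conjug h u) (conjug h v)" unfolding uv(3) using h uv(2) uH HG by (simp add: conj_comm)
    moreover have "conjug h u \<in> ?L" "conjug h v \<in> H" using Suc h uv subgroup_conj[OF H] by auto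
    ultimately show ?thesis by blast
  qed
  then have "conjug h x \<in> generate G ?C" if "h \<in> H" "x \<in> generate G ?C" for h x
    using conj_closed_generate[OF CG HG[OF that(1)] _ that(2)] that(1) by blast
  then show ?case using generate_is_subgroup[OF CG] generate_subgroup_incl[OF CH H] by (simp add: lower_series.simps(2))
qed

context
  fixes H assumes H: "subgroup H G"
begin

lemma lower_series_subgroup: "subgroup (lower_series H n) G"
  and lower_series_le: "lower_series H n \<subseteq> H"
  and lower_series_conj: "h \<in> H \<Longrightarrow> x \<in> lower_series H n \<Longrightarrow> conjug h x \<in> lower_series H n"
  using lower_series_normal[OF H, of n] by auto

lemma lower_series_comm_Suc: "x \<in> lower_series H n \<Longrightarrow> y \<in> H \<Longrightarrow> comm x y \<in> lower_series H (Suc n)"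
  unfolding lower_series.simps(2) by (auto intro: generate.incl)

lemma H_carrier: "h \<in> H \<Longrightarrow> h \<in> carrier G"
  using subgroup.mem_carrier[OF H] .

lemma lower_series_carrier: "h \<in> lower_series H n \<Longrightarrow> h \<in> carrier G"
  using subgroup.mem_carrier[OF lower_series_subgroup] .

lemma lower_series_Suc_le: "lower_series H (Suc n) \<subseteq> lower_series H n"
proof -
  have "comm x y \<in> lower_series H n" if xy: "x \<in> lower_series H n" "y \<in> H" for x y
  proof -
    have "comm x y = inv x \<otimes> conjug (inv y) x"
      using lower_series_carrier[OF xy(1)] H_carrier[OF xy(2)] by (simp add: word_simps)
    moreover have "conjug (inv y) x \<in> lower_series H n"
      by (rule lower_series_conj[OF subgroup.m_inv_closed[OF H xy(2)] xy(1)])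
    ultimately show ?thesis
      using subgroup.m_closed[OF lower_series_subgroup subgroup.m_inv_closed[OF lower_series_subgroup xy(1)]] by simp
  qed
  then have "{comm x y | x y. x \<in> lower_series H n \<and> y \<in> H} \<subseteq> lower_series H n" by blast
  then show ?thesis unfolding lower_series.simps(2) by (rule generate_subgroup_incl[OF _ lower_series_subgroup])
qed

lemma lower_series_antimono: "m \<le> n \<Longrightarrow> lower_series H n \<subseteq> lower_series H m"
  by (rule lift_Suc_antimono_le[of "lower_series H"]) (rule lower_series_Suc_le)

text \<open>This is [gamma_(i+1), gamma_(j+1)] \<le> gamma_(i+j+2), by the three subgroups argument:
  the Hall-Witt identity expresses the commutator with a generator of the next term through two
  commutators covered by induction on j.\<close>

lemma lower_series_comm:
  "x \<in> lower_series H i \<Longrightarrow> y \<in> lower_series H j \<Longrightarrow> comm x y \<in> lower_series H (Suc (i + j))"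
proof (induction j arbitrary: i x y)
  case 0
  then show ?case using lower_series_comm_Suc by simp
next
  case (Suc j)
  let ?N = "lower_series H (Suc (i + Suc j))"
  have xH: "x \<in> H" using Suc.prems(1) lower_series_le by blast
  have xG: "x \<in> carrier G" using H_carrier[OF xH] .
  have step: "comm w x \<in> ?N" if w: "w \<in> {comm u v | u v. u \<in> lower_series H j \<and> v \<in> H}" for w
  proof -
    obtain u v where uv: "u \<in> lower_series H j" "v \<in> H" "w = comm u v" using w by blast
    \<comment> \<open>The Hall-Witt identity inverts one entry of each inner commutator; with z =
      v^-1 its middle factor is a conjugate of [[u, v], x].\<close>
    define z where "z = inv v"
    have z: "z \<in> H" "z \<in> carrier G" and zv: "v = inv z"
      unfolding z_def using subgroup.m_inv_closed[OF H uv(2)] H_carrier[OF uv(2)] by simp_all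
    have uH: "u \<in> H" "u \<in> carrier G" using uv(1) lower_series_le lower_series_carrier by blast+
    have iH: "inv x \<in> H" "inv u \<in> H" "inv z \<in> H" using subgroup.m_inv_closed[OF H] xH uH z by auto
    let ?A = "comm (comm x (inv u)) z" and ?B = "comm w x" and ?C = "comm (comm z (inv x)) u"
    have "inv u \<in> lower_series H j" by (rule subgroup.m_inv_closed[OF lower_series_subgroup uv(1)])
    then have A: "?A \<in> ?N" using lower_series_comm_Suc[OF Suc.IH[OF Suc.prems(1)] z(1)] by simp
    have "inv x \<in> lower_series H i" by (rule subgroup.m_inv_closed[OF lower_series_subgroup Suc.prems(1)])
    then have "comm (inv x) z \<in> lower_series H (Suc i)" using lower_series_comm_Suc z(1) by blast
    then have "comm z (inv x) \<in> lower_series H (Suc i)"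
      using comm_swap_mem[OF lower_series_subgroup] xG z(2) by simp
    then have C: "?C \<in> ?N" using Suc.IH[OF _ uv(1), of "comm z (inv x)" "Suc i"] by simp
    have G: "?A \<in> carrier G" "?B \<in> carrier G" "?C \<in> carrier G" using xG uH(2) z(2) uv(3) zv by simp_all
    have "conjug (inv u) ?A \<otimes> conjug (inv z) ?B \<otimes> conjug (inv x) ?C = \<one>"
      using hall_witt[OF xG uH(2) z(2)] unfolding uv(3) zv .
    then have "conjug (inv z) ?B = inv (conjug (inv u) ?A) \<otimes> inv (conjug (inv x) ?C)"
      using xG uH(2) z(2) G by (intro mult3_eq_one) simp_all
    moreover have "inv (conjug (inv u) ?A) \<in> ?N" "inv (conjug (inv x) ?C) \<in> ?N"
      using lower_series_conj[OF iH(2) A] lower_series_conj[OF iH(1) C] subgroup.m_inv_closed[OF lower_series_subgroup] by blast+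
    ultimately have "conjug (inv z) ?B \<in> ?N" using subgroup.m_closed[OF lower_series_subgroup] by simp
    then have "conjug z (conjug (inv z) ?B) \<in> ?N" by (rule lower_series_conj[OF z(1)])
    then show ?thesis using z(2) G(2) by simp
  qed
  have "{comm u v | u v. u \<in> lower_series H j \<and> v \<in> H} \<subseteq> {w \<in> H. comm w x \<in> ?N}"
    using step subgroup_comm[OF H] lower_series_le by blast
  moreover have "subgroup {w \<in> H. comm w x \<in> ?N} G"
    by (rule comm_mod_subgroup[OF H lower_series_subgroup lower_series_conj xH])
  ultimately have "lower_series H (Suc j) \<subseteq> {w \<in> H. comm w x \<in> ?N}"
    unfolding lower_series.simps(2) by (rule generate_subgroup_incl)
  then have "comm y x \<in> ?N" using Suc.prems(2) by blast
  then show ?case using comm_swap_mem[OF lower_series_subgroup _ xG] Suc.prems(2) lower_series_carrier by blast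
qed

end

text \<open>Modulo gamma_3(H) the group gamma_2(H) is central and x commutes with itself, so the
  commutators of \<open>K\<close> lie in gamma_3(H) and its series runs one step ahead.
  \<open>K\<close> is normalized by \<open>H\<close> because it contains gamma_2(H).\<close>

lemma lower_series_adjoin:
  assumes H: "subgroup H G" and x: "x \<in> H"
  defines "K \<equiv> generate G (insert x (lower_series H 1))"
  shows "subgroup K G" "K \<subseteq> H" "lower_series K (Suc n) \<subseteq> lower_series H (Suc (Suc n))"
    "\<And>h k. h \<in> H \<Longrightarrow> k \<in> K \<Longrightarrow> conjug h k \<in> K"
proof -
  let ?U = "insert x (lower_series H 1)"
  have UH: "?U \<subseteq> H" using x lower_series_le[OF H] by blast
  have HG: "\<And>h. h \<in> H \<Longrightarrow> h \<in> carrier G" using subgroup.mem_carrier[OF H] .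
  have UG: "?U \<subseteq> carrier G" using UH HG by blast
  show sK: "subgroup K G" unfolding K_def by (rule generate_is_subgroup[OF UG])
  show KH: "K \<subseteq> H" unfolding K_def by (rule generate_subgroup_incl[OF UH H])
  have UK: "?U \<subseteq> K" unfolding K_def using generate.incl by (metis subsetI)
  let ?N = "lower_series H 2"
  have sN: "subgroup ?N G" by (rule lower_series_subgroup[OF H])
  have cU: "comm u v \<in> ?N" if u: "u \<in> ?U" and v: "v \<in> ?U" for u v
  proof -
    have uvH: "u \<in> H" "v \<in> H" using u v UH by auto
    consider "u = x" "v = x" | "u \<in> lower_series H 1" | "v \<in> lower_series H 1" using u v by blast
    then show ?thesis
    proof cases
      case 1
      then have "comm u v = \<one>" using comm_eq_one_iff[of x x] HG[OF x] by simp
      then show ?thesis using subgroup.one_closed[OF sN] by simp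
    next
      case 2
      then show ?thesis using lower_series_comm_Suc[OF H 2 uvH(2)] by (simp only: numeral_2_eq_2 One_nat_def)
    next
      case 3
      have "comm v u \<in> ?N" using lower_series_comm_Suc[OF H 3 uvH(1)] by (simp only: numeral_2_eq_2 One_nat_def)
      then show ?thesis using comm_swap_mem[OF sN] uvH HG by blast
    qed
  qed
  have cK1: "comm k u \<in> ?N" if k: "k \<in> K" and u: "u \<in> ?U" for k u
  proof -
    have uH: "u \<in> H" using u UH by blast
    have "?U \<subseteq> {k \<in> H. comm k u \<in> ?N}" using cU u UH by blast
    then have "K \<subseteq> {k \<in> H. comm k u \<in> ?N}" unfolding K_def
      by (rule generate_subgroup_incl) (rule comm_mod_subgroup[OF H sN lower_series_conj[OF H] uH])
    then show ?thesis using k by blast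
  qed
  have cK: "comm k l \<in> ?N" if k: "k \<in> K" and l: "l \<in> K" for k l
  proof -
    have kH: "k \<in> H" using k KH by blast
    have "?U \<subseteq> {l \<in> H. comm l k \<in> ?N}" using cK1[OF k] UH comm_swap_mem[OF sN] HG kH by blast
    then have "K \<subseteq> {l \<in> H. comm l k \<in> ?N}" unfolding K_def
      by (rule generate_subgroup_incl) (rule comm_mod_subgroup[OF H sN lower_series_conj[OF H] kH])
    then have "comm l k \<in> ?N" using l by blast
    then show ?thesis using comm_swap_mem[OF sN] HG kH l KH by blast
  qed
  show "lower_series K (Suc n) \<subseteq> lower_series H (Suc (Suc n))"
  proof (induction n)
    case 0
    have "{comm x y | x y. x \<in> lower_series K 0 \<and> y \<in> K} \<subseteq> ?N" using cK by auto
    then have "lower_series K (Suc 0) \<subseteq> ?N"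
      unfolding lower_series.simps(2)[of K] by (rule generate_subgroup_incl[OF _ sN])
    then show ?case by (simp add: numeral_2_eq_2)
  next
    case (Suc n)
    have "{comm x y | x y. x \<in> lower_series K (Suc n) \<and> y \<in> K} \<subseteq> lower_series H (Suc (Suc (Suc n)))"
      using lower_series_comm_Suc[OF H] Suc KH by blast
    then show ?case unfolding lower_series.simps(2)[of K "Suc n"]
      by (rule generate_subgroup_incl[OF _ lower_series_subgroup[OF H]])
  qed
  show "conjug h k \<in> K" if h: "h \<in> H" and k: "k \<in> K" for h k
  proof -
    have kH: "k \<in> H" using k KH by blast
    have ih: "inv h \<in> H" by (rule subgroup.m_inv_closed[OF H h])
    have "comm k (inv h) \<in> lower_series H 1" using lower_series_comm_Suc[OF H, of k 0 "inv h"] kH ih by simp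
    then have "comm k (inv h) \<in> K" using UK by blast
    moreover have "conjug h k = k \<otimes> comm k (inv h)" using conj_inv_eq_comm[of k "inv h"] HG kH h by simp
    ultimately show ?thesis using subgroup.m_closed[OF sK k] by simp
  qed
qed

end

text \<open>Indexing from 0 makes room for \<Gamma> 0 = \<Gamma> 1. Then the sequence of powers h^n,
  with values in \<Gamma> 0 and constant difference h in \<Gamma> 1, is polynomial.\<close>

locale group_filtration = group +
  fixes \<Gamma> :: "nat \<Rightarrow> 'a set"
  assumes sub: "subgroup (\<Gamma> i) G" and Suc_le: "\<Gamma> (Suc i) \<subseteq> \<Gamma> i"
    and comm_mem: "x \<in> \<Gamma> i \<Longrightarrow> y \<in> \<Gamma> j \<Longrightarrow> comm x y \<in> \<Gamma> (i + j)"
begin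

text \<open>Polynomial sequences in the sense of Leibman: all \<open>j\<close>-th differences take values in
  \<open>\<Gamma> (k + j)\<close>. Only the first \<open>m\<close> differences are constrained, which makes the closure
  properties provable by induction on \<open>m\<close>.\<close>

primrec poly_seq :: "nat \<Rightarrow> nat \<Rightarrow> (nat \<Rightarrow> 'a) set" where
  "poly_seq 0 k = {f. \<forall>n. f n \<in> \<Gamma> k}"
| "poly_seq (Suc m) k = {f. (\<forall>n. f n \<in> \<Gamma> k) \<and> (\<lambda>n. inv (f n) \<otimes> f (Suc n)) \<in> poly_seq m (Suc k)}"

lemma \<Gamma>_carrier: "x \<in> \<Gamma> i \<Longrightarrow> x \<in> carrier G"
  using subgroup.mem_carrier[OF sub] .

lemma \<Gamma>_antimono: "i \<le> j \<Longrightarrow> \<Gamma> j \<subseteq> \<Gamma> i"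
  by (rule lift_Suc_antimono_le[of \<Gamma>]) (rule Suc_le)

lemma poly_seq_values: "f \<in> poly_seq m k \<Longrightarrow> f n \<in> \<Gamma> k"
  by (cases m) auto

lemma poly_seq_carrier [simp]: "f \<in> poly_seq m k \<Longrightarrow> f n \<in> carrier G"
  using poly_seq_values \<Gamma>_carrier by blast

lemma poly_seq_diff: "f \<in> poly_seq (Suc m) k \<Longrightarrow> (\<lambda>n. inv (f n) \<otimes> f (Suc n)) \<in> poly_seq m (Suc k)"
  by simp

lemma poly_seq_Suc_le: "f \<in> poly_seq (Suc m) k \<Longrightarrow> f \<in> poly_seq m k"
proof (induction m arbitrary: f k)
  case 0
  then show ?case by simp
next
  case (Suc m)
  have "(\<lambda>n. inv (f n) \<otimes> f (Suc n)) \<in> poly_seq m (Suc k)" by (rule Suc.IH[OF poly_seq_diff[OF Suc.prems]])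
  then show ?case using poly_seq_values[OF Suc.prems] by simp
qed

lemma poly_seq_antimono: "f \<in> poly_seq m l \<Longrightarrow> k \<le> l \<Longrightarrow> f \<in> poly_seq m k"
proof (induction m arbitrary: f k l)
  case 0 then show ?case using \<Gamma>_antimono by auto
next
  case (Suc m)
  have "(\<lambda>n. inv (f n) \<otimes> f (Suc n)) \<in> poly_seq m (Suc k)"
    by (rule Suc.IH[OF poly_seq_diff[OF Suc.prems(1)]]) (use Suc.prems(2) in simp)
  moreover have "f n \<in> \<Gamma> k" for n
    using poly_seq_values[OF Suc.prems(1)] \<Gamma>_antimono[OF Suc.prems(2)] by blast
  ultimately show ?case by simp
qed

text \<open>The three closures need each other: the difference of a product contains a conjugate, a
  conjugate is a product with a commutator, and the difference of a commutator is a product of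
  commutators and their conjugates.\<close>

lemma poly_seq_closed:
  "(\<forall>k f g. f \<in> poly_seq m k \<longrightarrow> g \<in> poly_seq m k \<longrightarrow> (\<lambda>n. f n \<otimes> g n) \<in> poly_seq m k) \<and>
   (\<forall>k f. f \<in> poly_seq m k \<longrightarrow> (\<lambda>n. inv (f n)) \<in> poly_seq m k) \<and>
   (\<forall>k l f g. f \<in> poly_seq m k \<longrightarrow> g \<in> poly_seq m l \<longrightarrow> (\<lambda>n. comm (f n) (g n)) \<in> poly_seq m (k + l))"
proof (induction m)
  case 0
  then show ?case using subgroup.m_closed[OF sub] subgroup.m_inv_closed[OF sub] comm_mem by simp
next
  case (Suc m)
  have mult: "(\<lambda>n. f n \<otimes> g n) \<in> poly_seq m k" if "f \<in> poly_seq m k" "g \<in> poly_seq m k" for f g k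
    using Suc.IH that by blast
  have inv': "(\<lambda>n. inv (f n)) \<in> poly_seq m k" if "f \<in> poly_seq m k" for f k
    using Suc.IH that by blast
  have cm: "(\<lambda>n. comm (f n) (g n)) \<in> poly_seq m (k + l)" if "f \<in> poly_seq m k" "g \<in> poly_seq m l" for f g k l
    using Suc.IH that by blast
  have cj: "(\<lambda>n. conjug (inv (g n)) (f n)) \<in> poly_seq m k" if f: "f \<in> poly_seq m k" and g: "g \<in> poly_seq m l" for f g k l
  proof -
    have "(\<lambda>n. comm (f n) (g n)) \<in> poly_seq m k" by (rule poly_seq_antimono[OF cm[OF f g]]) simp
    from mult[OF f this] show ?thesis using f g by (simp add: conj_inv_eq_comm)
  qed
  note lo = poly_seq_Suc_le
  show ?case
  proof (intro conjI allI impI)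
    fix k f g assume f: "f \<in> poly_seq (Suc m) k" and g: "g \<in> poly_seq (Suc m) k"
    let ?f' = "\<lambda>n. inv (f n) \<otimes> f (Suc n)" and ?g' = "\<lambda>n. inv (g n) \<otimes> g (Suc n)"
    have "(\<lambda>n. inv (f n \<otimes> g n) \<otimes> (f (Suc n) \<otimes> g (Suc n))) = (\<lambda>n. conjug (inv (g n)) (?f' n) \<otimes> ?g' n)"
      using f g by (intro ext) (simp add: word_simps del: poly_seq.simps)
    moreover have "(\<lambda>n. conjug (inv (g n)) (?f' n) \<otimes> ?g' n) \<in> poly_seq m (Suc k)"
      by (rule mult[OF cj[OF poly_seq_diff[OF f] lo[OF g]] poly_seq_diff[OF g]])
    moreover have "f n \<otimes> g n \<in> \<Gamma> k" for n
      using subgroup.m_closed[OF sub] poly_seq_values[OF f] poly_seq_values[OF g] by blast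
    ultimately show "(\<lambda>n. f n \<otimes> g n) \<in> poly_seq (Suc m) k" by simp
  next
    fix k f assume f: "f \<in> poly_seq (Suc m) k"
    let ?f' = "\<lambda>n. inv (f n) \<otimes> f (Suc n)"
    have "(\<lambda>n. inv (inv (f n)) \<otimes> inv (f (Suc n))) = (\<lambda>n. conjug (inv (inv (f n))) (inv (?f' n)))"
      using f by (intro ext) (simp add: word_simps del: poly_seq.simps)
    moreover have "(\<lambda>n. conjug (inv (inv (f n))) (inv (?f' n))) \<in> poly_seq m (Suc k)"
      by (rule cj[OF inv'[OF poly_seq_diff[OF f]] inv'[OF lo[OF f]]])
    moreover have "inv (f n) \<in> \<Gamma> k" for n
      using subgroup.m_inv_closed[OF sub] poly_seq_values[OF f] by blast
    ultimately show "(\<lambda>n. inv (f n)) \<in> poly_seq (Suc m) k" by simp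
  next
    fix k l f g assume f: "f \<in> poly_seq (Suc m) k" and g: "g \<in> poly_seq (Suc m) l"
    let ?f' = "\<lambda>n. inv (f n) \<otimes> f (Suc n)" and ?g' = "\<lambda>n. inv (g n) \<otimes> g (Suc n)"
    let ?u = "\<lambda>n. comm (f n) (g n)"
    have u: "?u \<in> poly_seq m (k + l)" by (rule cm[OF lo[OF f] lo[OF g]])
    note f' = poly_seq_diff[OF f] and g' = poly_seq_diff[OF g]
    have fS: "(\<lambda>n. f n \<otimes> ?f' n) \<in> poly_seq m k"
      by (rule mult[OF lo[OF f] poly_seq_antimono[OF f']]) simp
    have 1: "(\<lambda>n. comm (f n \<otimes> ?f' n) (?g' n)) \<in> poly_seq m (Suc (k + l))"
      using cm[OF fS g'] by simp
    have "(\<lambda>n. ?f' n \<otimes> ?g' n) \<in> poly_seq m 1"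
      by (rule mult[OF poly_seq_antimono[OF f'] poly_seq_antimono[OF g']]) simp_all
    then have 2: "(\<lambda>n. comm (?u n) (?f' n \<otimes> ?g' n)) \<in> poly_seq m (Suc (k + l))"
      using cm[OF u] by fastforce
    have 3: "(\<lambda>n. comm (?f' n) (g n)) \<in> poly_seq m (Suc (k + l))"
      using cm[OF f' lo[OF g]] by simp
    \<comment> \<open>This expands [f f', g g'] relative to [f, g]. Every factor on the right has an
      entry built from the differences f' and g', hence lies one step deeper.\<close>
    have "(\<lambda>n. inv (?u n) \<otimes> ?u (Suc n)) = (\<lambda>n. conjug (inv (?u n)) (comm (f n \<otimes> ?f' n) (?g' n)) \<otimes>
        comm (?u n) (?f' n \<otimes> ?g' n) \<otimes> conjug (inv (?g' n)) (comm (?f' n) (g n)))"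
      using f g by (intro ext) (simp add: word_simps del: poly_seq.simps)
    moreover have "(\<lambda>n. conjug (inv (?u n)) (comm (f n \<otimes> ?f' n) (?g' n)) \<otimes>
        comm (?u n) (?f' n \<otimes> ?g' n) \<otimes> conjug (inv (?g' n)) (comm (?f' n) (g n))) \<in> poly_seq m (Suc (k + l))"
      by (rule mult[OF mult[OF cj[OF 1 u] 2] cj[OF 3 g']])
    moreover have "?u n \<in> \<Gamma> (k + l)" for n
      using comm_mem[OF poly_seq_values[OF f] poly_seq_values[OF g]] .
    ultimately show "?u \<in> poly_seq (Suc m) (k + l)" by simp
  qed
qed

lemma poly_seq_mult: "f \<in> poly_seq m k \<Longrightarrow> g \<in> poly_seq m k \<Longrightarrow> (\<lambda>n. f n \<otimes> g n) \<in> poly_seq m k"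
  and poly_seq_inv: "f \<in> poly_seq m k \<Longrightarrow> (\<lambda>n. inv (f n)) \<in> poly_seq m k"
  using poly_seq_closed by blast+

text \<open>By Pascal's rule the difference of n choose j is n choose j-1, so each difference uses
  up one unit of the depth of a; after j of them the sequence is constant.\<close>

lemma poly_seq_binomial: "a \<in> \<Gamma> (k + j) \<Longrightarrow> (\<lambda>n. a [^] (n choose j)) \<in> poly_seq m k"
proof (induction m arbitrary: k j)
  case 0
  then show ?case using subgroup_pow[OF sub] \<Gamma>_antimono[of k "k + j"] by auto
next
  case (Suc m)
  have aG: "a \<in> carrier G" using \<Gamma>_carrier[OF Suc.prems] .
  have v: "a [^] (n choose j) \<in> \<Gamma> k" for n
    using subgroup_pow[OF sub] Suc.prems \<Gamma>_antimono[of k "k + j"] by auto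
  have "(\<lambda>n. inv (a [^] (n choose j)) \<otimes> a [^] (Suc n choose j)) \<in> poly_seq m (Suc k)"
  proof (cases j)
    case 0
    have "(\<lambda>n. inv (a [^] (n choose j)) \<otimes> a [^] (Suc n choose j)) = (\<lambda>n. \<one>)" using 0 aG by simp
    moreover have "(\<lambda>n::nat. \<one>) \<in> poly_seq m k" for m k
      by (induction m arbitrary: k) (simp_all add: subgroup.one_closed[OF sub])
    ultimately show ?thesis by simp
  next
    case (Suc i)
    have "(\<lambda>n. inv (a [^] (n choose j)) \<otimes> a [^] (Suc n choose j)) = (\<lambda>n. a [^] (n choose i))"
    proof
      fix n
      have "a [^] (Suc n choose j) = a [^] (n choose j) \<otimes> a [^] (n choose i)"
        using aG Suc by (simp add: nat_pow_mult add.commute)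
      then show "inv (a [^] (n choose j)) \<otimes> a [^] (Suc n choose j) = a [^] (n choose i)" using aG by simp
    qed
    then show ?thesis using Suc.IH[of "Suc k" i] Suc.prems Suc by simp
  qed
  then show ?case using v by simp
qed

text \<open>When all earlier values are trivial, f j is the j-th difference at 0.\<close>

lemma poly_seq_first_value: "f \<in> poly_seq m k \<Longrightarrow> j \<le> m \<Longrightarrow> (\<And>i. i < j \<Longrightarrow> f i = \<one>) \<Longrightarrow> f j \<in> \<Gamma> (k + j)"
proof (induction j arbitrary: f m k)
  case 0
  then show ?case using poly_seq_values by simp
next
  case (Suc j)
  obtain m' where m: "m = Suc m'" using Suc.prems(2) by (cases m) auto
  let ?f' = "\<lambda>n. inv (f n) \<otimes> f (Suc n)"
  have "?f' \<in> poly_seq m' (Suc k)" using Suc.prems(1) m by simp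
  moreover have "?f' i = \<one>" if "i < j" for i using Suc.prems(3)[of i] Suc.prems(3)[of "Suc i"] that by simp
  ultimately have "?f' j \<in> \<Gamma> (Suc k + j)" using Suc.IH[of ?f' m' "Suc k"] Suc.prems(2) m by simp
  then show ?case using Suc.prems(3)[of j] poly_seq_carrier[OF Suc.prems(1)] by simp
qed

text \<open>Newton interpolation: \<open>f\<close> is a product of sequences \<open>a\<^sub>j [^] (n choose j)\<close> with
  \<open>a\<^sub>j \<in> \<Gamma> j\<close>, and the prime power \<open>q\<close> divides \<open>q choose j\<close> for \<open>0 < j < p\<close>.\<close>

lemma poly_seq_vanishes:
  assumes p: "Factorial_Ring.prime p" and c: "\<Gamma> c = {\<one>}" "c \<le> p"
    and T: "subgroup T G" "\<And>t. t \<in> T \<Longrightarrow> t [^] (p ^ i) = \<one>"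
    and f: "\<And>m. f \<in> poly_seq m 0" "\<And>n. f n \<in> T" and j: "j > 0" "\<And>n. n < j \<Longrightarrow> f n = \<one>"
  shows "f (p ^ i) = \<one>"
  using f j
\<comment> \<open>Here j counts known initial trivial values. Once j reaches c, every later f n lies
  in \<Gamma> n and is trivial; before that, the j-th Newton factor is divided out and j
  increases.\<close>
proof (induction "c - j" arbitrary: f j)
  case 0
  have "f n = \<one>" for n
  proof (induction n rule: less_induct)
    case (less n)
    show ?case
    proof (cases "n < j")
      case True then show ?thesis using 0(5) by simp
    next
      case False
      have "f n \<in> \<Gamma> (0 + n)" by (rule poly_seq_first_value[OF 0(2)[of n]]) (use less in auto)
      moreover have "\<Gamma> (0 + n) \<subseteq> \<Gamma> c" by (rule \<Gamma>_antimono) (use False 0(1) in simp)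
      ultimately show ?thesis using c(1) by blast
    qed
  qed
  then show ?case .
next
  case (Suc d)
  have jc: "j < c" using Suc(2) by simp
  define a where "a = f j"
  have aT: "a \<in> T" unfolding a_def by (rule Suc.prems(2))
  have aG: "a \<in> carrier G" using subgroup.mem_carrier[OF T(1) aT] .
  have a\<Gamma>: "a \<in> \<Gamma> (0 + j)" unfolding a_def
    by (rule poly_seq_first_value[OF Suc.prems(1)[of j]]) (use Suc.prems(4) in auto)
  define g where "g n = inv (a [^] (n choose j)) \<otimes> f n" for n
  have "g (p ^ i) = \<one>"
  proof (rule Suc.hyps(1))
    show "d = c - Suc j" using Suc(2) by simp
    show "g \<in> poly_seq m 0" for m
      unfolding g_def using poly_seq_mult[OF poly_seq_inv[OF poly_seq_binomial[OF a\<Gamma>]] Suc.prems(1)] .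
    show "g n \<in> T" for n unfolding g_def
      using subgroup.m_closed[OF T(1) subgroup.m_inv_closed[OF T(1) subgroup_pow[OF T(1) aT]] Suc.prems(2)] .
    show "g n = \<one>" if "n < Suc j" for n
    proof (cases "n = j")
      case True then show ?thesis unfolding g_def using aG by (simp add: a_def)
    next
      case False then show ?thesis unfolding g_def using that Suc.prems(4)[of n] by (simp add: binomial_eq_0)
    qed
  qed simp
  moreover have "a [^] (p ^ i choose j) = \<one>"
  proof -
    have "p ^ i dvd (p ^ i choose j)" using prime_power_dvd_choose[OF p Suc.prems(3)] jc c(2) by simp
    then obtain e where "(p ^ i choose j) = p ^ i * e" by blast
    then have "a [^] (p ^ i choose j) = (a [^] (p ^ i)) [^] e" using aG by (simp add: nat_pow_pow)
    then show ?thesis using T(2)[OF aT] by simp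
  qed
  ultimately show ?case unfolding g_def using poly_seq_carrier[OF Suc.prems(1)] by simp
qed

end

context group
begin

text \<open>Truncated subtraction makes the terms 0 and 1 both equal to \<open>H\<close>; for n
  \<ge> 1 the n-th term is gamma_n(H).\<close>

lemma lower_series_filtration:
  assumes H: "subgroup H G" shows "group_filtration G (\<lambda>n. lower_series H (n - 1))"
proof (intro group_filtration.intro group_axioms group_filtration_axioms.intro)
  show "subgroup (lower_series H (i - 1)) G" for i by (rule lower_series_subgroup[OF H])
  show "lower_series H (Suc i - 1) \<subseteq> lower_series H (i - 1)" for i
    by (rule lower_series_antimono[OF H]) simp
  fix x y i j assume x: "x \<in> lower_series H (i - 1)" and y: "y \<in> lower_series H (j - 1)"
  have "comm x y \<in> lower_series H (Suc ((i - 1) + (j - 1)))" by (rule lower_series_comm[OF H x y])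
  moreover have "i + j - 1 \<le> Suc ((i - 1) + (j - 1))" by simp
  ultimately show "comm x y \<in> lower_series H (i + j - 1)" using lower_series_antimono[OF H] by blast
qed

text \<open>Hall's theorem on regular \<open>p\<close>-groups. The subgroup generated by \<open>x\<close> and the commutator
  subgroup has smaller class, so by induction its elements of order dividing \<open>p ^ i\<close> form a
  subgroup \<open>T\<close>, in which the polynomial sequence $(xy)^n y^{-n}$ takes its values.\<close>

lemma pow_mult_eq_one_small_class:
  assumes p: "Factorial_Ring.prime p"
  shows "subgroup H G \<Longrightarrow> lower_series H c = {\<one>} \<Longrightarrow> c < p \<Longrightarrow> x \<in> H \<Longrightarrow> y \<in> H \<Longrightarrow>
    x [^] (p ^ i) = \<one> \<Longrightarrow> y [^] (p ^ i) = \<one> \<Longrightarrow> (x \<otimes> y) [^] (p ^ i) = \<one>"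
proof (induction c arbitrary: H x y)
  case 0
  then show ?case by simp
next
  case (Suc c)
  note H = Suc.prems(1) and x = Suc.prems(4) and y = Suc.prems(5)
  have HG: "\<And>h. h \<in> H \<Longrightarrow> h \<in> carrier G" using subgroup.mem_carrier[OF H] .
  show ?case
  proof (cases c)
    case 0
    have "comm x y \<in> lower_series H (Suc 0)" using lower_series_comm_Suc[OF H, of x 0 y] x y by simp
    then have "comm x y = \<one>" using Suc.prems(2) 0 by simp
    then have "x \<otimes> y = y \<otimes> x" using comm_eq_one_iff HG x y by simp
    then show ?thesis using pow_mult_distrib HG x y Suc.prems(6,7) by simp
  next
    case (Suc d)
    define K where "K = generate G (insert x (lower_series H 1))"
    note K = lower_series_adjoin[OF H x, folded K_def]
    have KG: "\<And>k. k \<in> K \<Longrightarrow> k \<in> carrier G" using subgroup.mem_carrier[OF K(1)] .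
    have "lower_series K c \<subseteq> {\<one>}" using K(3)[of d] Suc.prems(2) Suc by simp
    then have Kc: "lower_series K c = {\<one>}"
      using subgroup.one_closed[OF lower_series_subgroup[OF K(1)], of c] by blast
    define T where "T = {k \<in> K. k [^] (p ^ i) = \<one>}"
    have T: "subgroup T G"
    proof (rule subgroupI)
      show "T \<subseteq> carrier G" unfolding T_def using KG by blast
      have "\<one> \<in> T" unfolding T_def using subgroup.one_closed[OF K(1)] by simp
      then show "T \<noteq> {}" by blast
      show "inv a \<in> T" if "a \<in> T" for a
        using that KG subgroup.m_inv_closed[OF K(1)] unfolding T_def by (auto simp: nat_pow_inv)
      show "a \<otimes> b \<in> T" if "a \<in> T" "b \<in> T" for a b
        using that Suc.IH[OF K(1) Kc, of a b] Suc.prems(3) subgroup.m_closed[OF K(1)] unfolding T_def by auto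
    qed
    have Tn: "conjug h t \<in> T" if "h \<in> H" "t \<in> T" for h t
      using that K(4)[of h t] conj_pow[of h t "p ^ i"] HG KG unfolding T_def by auto
    have xT: "x \<in> T" unfolding T_def K_def using Suc.prems(6) by (auto intro: generate.incl)
    interpret f: group_filtration G "\<lambda>n. lower_series H (n - 1)" by (rule lower_series_filtration[OF H])
    define f where "f n = (x \<otimes> y) [^] n \<otimes> inv (y [^] n)" for n :: nat
    have pw: "(\<lambda>n. h [^] n) \<in> f.poly_seq m 0" if h: "h \<in> H" for h m
    proof -
      have "h \<in> lower_series H (0 + 1 - 1)" using h by simp
      from f.poly_seq_binomial[OF this] show ?thesis by simp
    qed
    have fp: "f \<in> f.poly_seq m 0" for m
      unfolding f_def using f.poly_seq_mult[OF pw f.poly_seq_inv[OF pw]] subgroup.m_closed[OF H x y] y by blast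
    have fT: "f n \<in> T" for n
    proof (induction n)
      case 0
      then show ?case unfolding f_def using subgroup.one_closed[OF T] by simp
    next
      case (Suc n)
      \<comment> \<open>Each step multiplies (x y)^n y^-n by y^n x y^-n, which lies in
        \<open>T\<close> because \<open>H\<close> normalizes \<open>T\<close>.\<close>
      have G: "x \<in> carrier G" "y \<in> carrier G" "(x \<otimes> y) [^] n \<in> carrier G" "y [^] n \<in> carrier G" using HG x y by simp_all
      have "f (Suc n) = f n \<otimes> conjug (y [^] n) x" unfolding f_def using G by (simp add: word_simps)
      then show ?case using subgroup.m_closed[OF T Suc Tn[OF subgroup_pow[OF H y] xT]] by simp
    qed
    have "f (p ^ i) = \<one>"
    proof (rule f.poly_seq_vanishes[OF p _ _ T _ fp fT])
      \<comment> \<open>The shifted filtration becomes trivial at index c + 2, one later than the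
        series itself; c + 1 < p is exactly what \<open>poly_seq_vanishes\<close> then
        requires.\<close>
      show "lower_series H (Suc (Suc c) - 1) = {\<one>}" using Suc.prems(2) by simp
      show "Suc (Suc c) \<le> p" using Suc.prems(3) by simp
      show "t [^] (p ^ i) = \<one>" if "t \<in> T" for t using that unfolding T_def by simp
      show "(0::nat) < 1" by simp
      show "f n = \<one>" if "n < 1" for n unfolding f_def using that by simp
    qed
    then show ?thesis unfolding f_def using Suc.prems(7) HG x y by simp
  qed
qed

end

text \<open>The elements with x^(p^i) = 1 form a subgroup by
  \<open>pow_mult_eq_one_small_class\<close>; it contains the generators of Omega_i(S), hence
  Omega_i(S).\<close>

lemma group_exponent_Omega_small_class:
  fixes S :: "('a, 'm) monoid_scheme"
  assumes p: "Factorial_Ring.prime p" and S: "p_group p S" and cl: "nilpotency_class S < enat p"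
  shows "group_exponent (S \<restriction>\<^sub>g Omega p i S) \<le> p ^ i"
proof -
  interpret S: group S using S by (simp add: p_group_def)
  obtain n where n: "card (carrier S) = p ^ n" using S by (auto simp: p_group_def order_def)
  have fS: "finite (carrier S)" using n p by (metis card.infinite not_prime_0 power_eq_0_iff)
  obtain c where c: "lower_central S c = {\<one>\<^bsub>S\<^esub>}" "c < p"
    using cl unfolding nilpotency_class_def INF_less_iff by auto
  have lc: "S.lower_series (carrier S) c = {\<one>\<^bsub>S\<^esub>}" using c(1) S.lower_central_eq by simp
  let ?T = "torsion S (p ^ i) (carrier S)"
  have T: "subgroup ?T S"
  proof (rule S.subgroupI)
    have "\<one>\<^bsub>S\<^esub> \<in> ?T" by (simp add: torsion_def)
    then show "?T \<noteq> {}" by blast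
    show "?T \<subseteq> carrier S" by (rule torsion_subset)
    show "inv\<^bsub>S\<^esub> a \<in> ?T" if "a \<in> ?T" for a using that by (auto simp: torsion_def S.nat_pow_inv)
    show "a \<otimes>\<^bsub>S\<^esub> b \<in> ?T" if "a \<in> ?T" "b \<in> ?T" for a b
      using that S.pow_mult_eq_one_small_class[OF p S.subgroup_self lc c(2)] by (auto simp: torsion_def)
  qed
  have "{x \<in> carrier S. S.ord x \<le> p ^ i} \<subseteq> ?T"
    using S.ord_le_prime_power_iff[OF p S.subgroup_self n, of _ i] by (auto simp: torsion_def)
  then have OT: "Omega p i S \<subseteq> ?T" unfolding Omega_def by (rule S.generate_subgroup_incl[OF _ T])
  have sO: "subgroup (Omega p i S) S" unfolding Omega_def by (rule S.generate_is_subgroup) blast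
  have "card (Omega p i S) dvd p ^ n"
    using S.card_subgroup_dvd[OF S.subgroup_self fS sO subgroup.subset[OF sO]] n by simp
  then obtain s where s: "card (Omega p i S) = p ^ s" using divides_primepow_nat[OF p] by blast
  show ?thesis using S.group_exponent_le_iff[OF p sO s, of i] OT by (auto simp: torsion_def)
qed

theorem corollary1p7:
  fixes p i :: nat and S :: "('a, 'm) monoid_scheme"
  assumes "Factorial_Ring.prime p" and "odd p" and "p_group p S" and "i \<ge> 1"
  shows
    "(nilpotency_class S < enat p \<longrightarrow> group_exponent (S \<restriction>\<^sub>g Omega p i S) \<le> p ^ i) \<and>
     (group_exponent (S \<restriction>\<^sub>g Omega p i S) \<le> p ^ i \<longrightarrow>
       (let D = S \<restriction>\<^sub>g Omega p i S in
          glauberman_property TYPE('g) p S (center (D \<restriction>\<^sub>g J_gen D (A_o D))) \<and>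
          glauberman_property TYPE('g) p S
            (Omega p 1 (D \<restriction>\<^sub>g center (D \<restriction>\<^sub>g J_gen D (A_e p D)))) \<and>
          glauberman_property TYPE('g) p S (center (D \<restriction>\<^sub>g J_gen D (A_lex p D))) \<and>
          glauberman_property TYPE('g) p S (center (D \<restriction>\<^sub>g J_gen D (A_olex p D))) \<and>
          (\<forall>(m :: int) (e :: int) (\<zeta> :: nat \<Rightarrow> int).
             glauberman_property TYPE('g) p S (I_int D (A_bounded p m e \<zeta> D)))))"
proof (intro conjI impI)
  show "group_exponent (S \<restriction>\<^sub>g Omega p i S) \<le> p ^ i" if "nilpotency_class S < enat p"
    by (rule group_exponent_Omega_small_class[OF assms(1,3) that])
qed (unfold Let_def, intro conjI allI glauberman_property_instances[OF assms])

end
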